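(* Let $\Delta\ge 3$ be an integer and let $\boldsymbol\theta=(\theta_0,\ldots,\theta_\Delta)$ be a strictly positive log-convex vector. If there exists $c\in[0,\Delta]$ such that $$\max\Big(\frac{\theta_\Delta}{\theta_{\Delta-1}},\frac{\theta_0}{\theta_1}\Big)\le 1+\frac{c}{\Delta},$$ then $$\underline{\lambda}_{\boldsymbol\theta}\ \ge\ \big(2\exp(c)(1+4c)\big)^{-1}\frac{\theta_0}{\Delta}\qquad\text{and}\qquad \overline{\lambda}_{\boldsymbol\theta}\ \le\ 3\exp(12+c)\,\frac{\theta_0}{\Delta}.$$ It follows that, up to constant factors independent of $\Delta$, the critical activity $\lambda_{\boldsymbol\theta}$ scales like $\frac{\theta_0}{\Delta}$ (as $\Delta\to\infty$) for any vector $\boldsymbol\theta$ which does not deviate too much from the all ones vector (i.e. which satisfies the displayed condition with $c$ not depending on $\Delta$).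
   Context: Log-convexity: a strictly positive sequence $(x_0,\ldots,x_n)$ is log-convex if $x_{i+1}/x_i \ge x_i/x_{i-1}$ for all $i \in \{1,\ldots,n-1\}$. For log-convex $\boldsymbol\theta$, define $$\psi_{\boldsymbol\theta} = \max_{k=0,\ldots,\Delta-2}\Big(\big(\Delta-(k+1)\big)\frac{\theta_{k+1}}{\theta_k}\Big),$$ $$\underline{\lambda}_{\boldsymbol\theta} = \Bigg(2\,\psi_{\boldsymbol\theta}\,\theta_0^{-1}\Big(\frac{\theta_\Delta}{\theta_{\Delta-1}}\Big)^{\Delta-2}\bigg(\frac{\theta_\Delta}{\theta_{\Delta-1}} + (\Delta-1)\Big(\frac{\theta_\Delta}{\theta_{\Delta-1}}-\frac{\theta_1}{\theta_0}\Big)\bigg)\Bigg)^{-1},$$ $$\overline{\lambda}_{\boldsymbol\theta} = \frac{3\theta_0}{\Delta}\exp\Big(3\,\frac{\theta_\Delta}{\theta_{\Delta-1}}\,\frac{\theta_0}{\theta_1}\Big)\Big(\frac{\theta_0}{\theta_1}\Big)^{\Delta}.$$ Model and critical activity. Let $T_\infty$ be the infinite $\Delta$-regular tree, with spins $\omega_i\in\{0,1\}$ at its nodes. For an activity $\lambda>0$ and a strictly positive vector $\boldsymbol\theta$, assign to each node $i$, with $N(i)$ consisting of $i$ and its $\Delta$ neighbors, the potential $\Phi_{N(i)}(\omega)$ equal to $-\log\lambda$ if $\omega_i=1$ and all neighbors of $i$ have spin $0$; $-\log\theta_k$ if $\omega_i=0$ and exactly $k$ neighbors of $i$ have spin $1$;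 and $+\infty$ otherwise. (Thus configurations of finite energy are independent sets.) For finite $\Lambda\subseteq T_\infty$, the Hamiltonian on $\Lambda$ is the sum of $\Phi_{N(i)}$ over all $i$ with $N(i)\cap\Lambda\neq\emptyset$. An infinite-volume Gibbs measure is a probability measure on $\{0,1\}^{T_\infty}$ such that, for every finite $\Lambda$, the conditional law of the spins in $\Lambda$ given the spins outside $\Lambda$ is proportional to $\exp(-\text{Hamiltonian on }\Lambda)$. The pair $(\lambda,\boldsymbol\theta)$ belongs to the uniqueness regime if there is exactly one infinite-volume Gibbs measure. The vector $\boldsymbol\theta$ exhibits a phase transition if there are $0<\lambda_1<\lambda_2<\infty$ with $(\lambda_1,\boldsymbol\theta)$ in the uniqueness regime and $(\lambda_2,\boldsymbol\theta)$ not in it; this is the case for every log-convex $\boldsymbol\theta$, since $(\lambda,\boldsymbol\theta)$ belongs to the uniqueness regime for all $\lambda<\underline{\lambda}_{\boldsymbol\theta}$ and does not for all $\lambda>\overline{\lambda}_{\boldsymbol\theta}$. The critical activity is $\lambda_{\boldsymbol\theta}=\inf\{\lambda>0: (\lambda,\boldsymbol\theta)\text{ does not belong to the uniqueness regime}\}$. *)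

theory Defs
  imports "HOL-Probability.Probability"
begin

subsection \<open>Log-convex vectors and the two explicit bounds\<close>

(* A vector (\<theta>_0, ..., \<theta>_n) is a function on nat of which only the values at indices \<le> n are used. *)
definition log_convex :: "nat \<Rightarrow> (nat \<Rightarrow> real) \<Rightarrow> bool" where
  "log_convex n x \<longleftrightarrow>
     (\<forall>i\<in>{0..n}. x i > 0) \<and> (\<forall>i\<in>{1..n - 1}. x (i + 1) / x i \<ge> x i / x (i - 1))"

definition psi :: "nat \<Rightarrow> (nat \<Rightarrow> real) \<Rightarrow> real" where
  "psi \<Delta> \<theta> = Max ((\<lambda>k. (real \<Delta> - (real k + 1)) * (\<theta> (k + 1) / \<theta> k)) ` {0..\<Delta> - 2})"

definition lambda_lower :: "nat \<Rightarrow> (nat \<Rightarrow> real) \<Rightarrow> real" where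
  "lambda_lower \<Delta> \<theta> =
     inverse (2 * psi \<Delta> \<theta> * inverse (\<theta> 0) * (\<theta> \<Delta> / \<theta> (\<Delta> - 1)) ^ (\<Delta> - 2) *
       (\<theta> \<Delta> / \<theta> (\<Delta> - 1) + (real \<Delta> - 1) * (\<theta> \<Delta> / \<theta> (\<Delta> - 1) - \<theta> 1 / \<theta> 0)))"

definition lambda_upper :: "nat \<Rightarrow> (nat \<Rightarrow> real) \<Rightarrow> real" where
  "lambda_upper \<Delta> \<theta> =
     3 * \<theta> 0 / real \<Delta> * exp (3 * (\<theta> \<Delta> / \<theta> (\<Delta> - 1)) * (\<theta> 0 / \<theta> 1)) * (\<theta> 0 / \<theta> 1) ^ \<Delta>"


subsection \<open>The infinite regular tree\<close>

(* Concrete model: the Cayley graph of the free product of \<Delta> copies of Z/2Z. Nodes are the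
   reduced words over \<Delta> letters, i.e. words without two equal consecutive letters; neighbours
   differ by one letter at the head. *)
definition tree_nodes :: "nat \<Rightarrow> nat list set" where
  "tree_nodes \<Delta> = {w. set w \<subseteq> {..<\<Delta>} \<and> distinct_adj w}"

definition tree_nbrs :: "nat \<Rightarrow> nat list \<Rightarrow> nat list set" where
  "tree_nbrs \<Delta> i = {j \<in> tree_nodes \<Delta>. \<exists>x. j = x # i \<or> i = x # j}"

lemma card_tree_nbrs:
  assumes "i \<in> tree_nodes \<Delta>"
  shows "card (tree_nbrs \<Delta> i) = \<Delta>"
proof (cases i)
  case Nil
  have "tree_nbrs \<Delta> i = (\<lambda>x. [x]) ` {..<\<Delta>}"
    by (auto simp: tree_nbrs_def tree_nodes_def Nil)
  then show ?thesis by (simp add: card_image inj_on_def)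
next
  case (Cons a w)
  have a: "a < \<Delta>" using assms by (simp add: tree_nodes_def Cons)
  have w: "w \<in> tree_nodes \<Delta>"
    using assms by (cases w) (auto simp: tree_nodes_def Cons)
  have "tree_nbrs \<Delta> i = insert w ((\<lambda>x. x # i) ` ({..<\<Delta>} - {a}))"
    using assms w by (auto simp: tree_nbrs_def tree_nodes_def Cons)
  moreover have "w \<notin> (\<lambda>x. x # i) ` ({..<\<Delta>} - {a})"
    by (auto simp: Cons dest: arg_cong[where f = length])
  moreover have "card ((\<lambda>x. x # i) ` ({..<\<Delta>} - {a})) = \<Delta> - 1"
    using a by (simp add: card_image inj_on_def)
  ultimately show ?thesis using a by simp
qed


subsection \<open>Infinite-volume Gibbs measures\<close>

definition config_space :: "nat list set \<Rightarrow> (nat list \<Rightarrow> nat) measure" where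
  "config_space V = (\<Pi>\<^sub>M i\<in>V. count_space {0, 1})"

definition potential ::
  "nat \<Rightarrow> real \<Rightarrow> (nat \<Rightarrow> real) \<Rightarrow> nat list \<Rightarrow> (nat list \<Rightarrow> nat) \<Rightarrow> ereal" where
  "potential \<Delta> lam \<theta> i \<omega> =
     (if \<omega> i = 1 \<and> (\<forall>j\<in>tree_nbrs \<Delta> i. \<omega> j = 0) then ereal (- ln lam)
      else if \<omega> i = 0 then ereal (- ln (\<theta> (card {j \<in> tree_nbrs \<Delta> i. \<omega> j = 1})))
      else \<infinity>)"

definition hamiltonian ::
  "nat \<Rightarrow> real \<Rightarrow> (nat \<Rightarrow> real) \<Rightarrow> nat list set \<Rightarrow> (nat list \<Rightarrow> nat) \<Rightarrow> ereal" where
  "hamiltonian \<Delta> lam \<theta> \<Lambda> \<omega> =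
     (\<Sum>i | i \<in> tree_nodes \<Delta> \<and> insert i (tree_nbrs \<Delta> i) \<inter> \<Lambda> \<noteq> {}. potential \<Delta> lam \<theta> i \<omega>)"

(* exp (- E), with exp (- \<infinity>) = 0; the energies occurring here are never - \<infinity>. *)
definition boltzmann :: "ereal \<Rightarrow> real" where
  "boltzmann E = (if E = \<infinity> then 0 else exp (- real_of_ereal E))"

(* Unnormalised weight of the spins \<eta> in \<Lambda>, given that the spins outside \<Lambda> are those of \<omega>. *)
definition gibbs_weight ::
  "nat \<Rightarrow> real \<Rightarrow> (nat \<Rightarrow> real) \<Rightarrow> nat list set \<Rightarrow> (nat list \<Rightarrow> nat) \<Rightarrow> (nat list \<Rightarrow> nat) \<Rightarrow> real" where
  "gibbs_weight \<Delta> lam \<theta> \<Lambda> \<omega> \<eta> =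
     boltzmann (hamiltonian \<Delta> lam \<theta> \<Lambda> (merge \<Lambda> (tree_nodes \<Delta> - \<Lambda>) (\<eta>, \<omega>)))"

(* The sigma-algebra on configurations generated by the spins outside \<Lambda>. *)
definition outside_algebra :: "nat \<Rightarrow> nat list set \<Rightarrow> (nat list \<Rightarrow> nat) measure" where
  "outside_algebra \<Delta> \<Lambda> =
     vimage_algebra (space (config_space (tree_nodes \<Delta>)))
       (\<lambda>\<omega>. restrict \<omega> (tree_nodes \<Delta> - \<Lambda>)) (config_space (tree_nodes \<Delta> - \<Lambda>))"

(* Where the normalising sum vanishes the quotients below are all 0, whereas the conditional
   probabilities of the finitely many \<eta> add up to 1 almost surely. So the condition also says that
   the normalising sum is positive almost surely. *)
definition gibbs_measure ::
  "nat \<Rightarrow> real \<Rightarrow> (nat \<Rightarrow> real) \<Rightarrow> (nat list \<Rightarrow> nat) measure \<Rightarrow> bool" where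
  "gibbs_measure \<Delta> lam \<theta> \<mu> \<longleftrightarrow>
     prob_space \<mu> \<and> sets \<mu> = sets (config_space (tree_nodes \<Delta>)) \<and>
     (\<forall>\<Lambda>. finite \<Lambda> \<and> \<Lambda> \<subseteq> tree_nodes \<Delta> \<longrightarrow>
        (\<forall>\<eta> \<in> \<Lambda> \<rightarrow>\<^sub>E {0, 1}. AE \<omega> in \<mu>.
           real_cond_exp \<mu> (outside_algebra \<Delta> \<Lambda>)
             (indicator {\<omega>' \<in> space \<mu>. restrict \<omega>' \<Lambda> = \<eta>}) \<omega> =
           gibbs_weight \<Delta> lam \<theta> \<Lambda> \<omega> \<eta> /
             (\<Sum>\<eta>' \<in> \<Lambda> \<rightarrow>\<^sub>E {0, 1}. gibbs_weight \<Delta> lam \<theta> \<Lambda> \<omega> \<eta>')))"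

definition uniqueness_regime :: "nat \<Rightarrow> real \<Rightarrow> (nat \<Rightarrow> real) \<Rightarrow> bool" where
  "uniqueness_regime \<Delta> lam \<theta> \<longleftrightarrow> (\<exists>!\<mu>. gibbs_measure \<Delta> lam \<theta> \<mu>)"

(* Valued in ereal so that the infimum of the empty set is \<infinity> rather than an unspecified real. *)
definition critical_activity :: "nat \<Rightarrow> (nat \<Rightarrow> real) \<Rightarrow> ereal" where
  "critical_activity \<Delta> \<theta> = Inf {ereal lam | lam. lam > 0 \<and> \<not> uniqueness_regime \<Delta> lam \<theta>}"

end

theory Submission
  imports Defs
begin

text \<open>Write \<open>m\<^sub>i(s, p)\<close> for the total weight of the subtree hanging at a node \<open>i\<close> when \<open>i\<close> has
  spin \<open>s\<close> and its parent has spin \<open>p\<close>. Up to scaling, such a message consists of the two ratios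
  \<open>a = m(1, 0) / m(0, 0)\<close> and \<open>b = m(0, 1) / m(0, 0)\<close>, and \<open>b\<close> always lies between the extreme
  ratios \<open>\<theta>\<^sub>k\<^sub>+\<^sub>1 / \<theta>\<^sub>k\<close>, that is, within \<open>O(c / \<Delta>)\<close> of 1. With activity \<open>K \<theta>\<^sub>0 / \<Delta>\<close> and \<open>K\<close> small, the
  recursion for \<open>(a, b)\<close> is a contraction in a weighted maximum norm (the new \<open>b\<close> depends on the
  \<open>a\<close>s only, with total slope at most \<open>4 c\<close>), so boundary conditions are forgotten and all Gibbs
  measures have the same marginals. With \<open>K\<close> large, the homogeneous recursion maps \<open>a \<ge> S / \<Delta>\<close> into
  \<open>a \<le> 1 / \<Delta>\<close> and back for some \<open>S > 1\<close>, so by Brouwer it has a cycle of length two;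
  assigning its two points to the even and to the odd nodes, in either order, gives two different
  Gibbs measures.\<close>

subsection \<open>Cylinder sets and consistent families on a countable product\<close>

text \<open>A potential involves a node and its neighbours, so the energy of a finite set couples it
  to spins up to distance two; conditioning on the outside of a ball therefore fixes two layers.
  Adjacent occupied nodes have weight 0, so m(1, 1) = 0 and exactly two ratios survive
  normalisation. An infeasible boundary condition makes all messages vanish and leaves no ratio to
  speak of; convergence is therefore argued for messages proportional to a pair
  \<open>(a, b)\<close>, with a factor that may be 0, and this factor is cancelled only where the
  normalising sum is nonzero.

  The slope 4 c has this origin: in each \<open>a\<close> separately, the new \<open>b\<close> is a
  quotient of affine functions built from \<theta> shifted by 0, 1 and 2. One shift changes such a
  sum by a factor between 1/r and r, where r = 1 + c/\<Delta>, so the slope is at most r^2 - r^(-2)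
  <= 4 c/\<Delta> for each child.

  For the upper bound on the critical activity, an infimum, a single activity without uniqueness
  suffices.\<close>

declare One_nat_def [simp del]

abbreviation spins :: "'i set \<Rightarrow> ('i \<Rightarrow> nat) set" where
  "spins A \<equiv> A \<rightarrow>\<^sub>E {0, 1}"

text \<open>Used in two ways: with \<open>V\<close> the whole tree this is an event, with
  \<open>V\<close> finite it is the finite set of extensions of \<zeta> over which weights are
  summed.\<close>

definition cyl :: "'i set \<Rightarrow> 'i set \<Rightarrow> ('i \<Rightarrow> nat) \<Rightarrow> ('i \<Rightarrow> nat) set" where
  "cyl V A \<zeta> = {\<omega> \<in> spins V. restrict \<omega> A = \<zeta>}"

lemma finite_spins: "finite A \<Longrightarrow> finite (spins A)"
  by (intro finite_PiE) auto

lemma finite_cyl: "finite B \<Longrightarrow> finite (cyl B A \<zeta>)"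
  unfolding cyl_def using finite_spins by fastforce

lemma restrict_spins: "\<omega> \<in> spins V \<Longrightarrow> A \<subseteq> V \<Longrightarrow> restrict \<omega> A \<in> spins A"
  by (auto simp: PiE_def Pi_def)

lemma space_PiM_spins: "space (\<Pi>\<^sub>M i\<in>V. count_space {0, 1::nat}) = spins V"
  by (simp add: space_PiM)

lemma cyl_empty: "cyl V {} (\<lambda>_. undefined) = spins V"
  by (auto simp: cyl_def restrict_def)

lemma sets_cyl:
  assumes "finite A" "A \<subseteq> V"
  shows "cyl V A \<zeta> \<in> sets (\<Pi>\<^sub>M i\<in>V. count_space {0, 1::nat})"
proof (cases "\<zeta> \<in> spins A")
  case True
  have "cyl V A \<zeta> = prod_emb V (\<lambda>_. count_space {0, 1::nat}) A (\<Pi>\<^sub>E i\<in>A. {\<zeta> i})"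
    using True assms(2)
  proof -
    have "restrict \<omega> A = \<zeta> \<longleftrightarrow> (\<forall>i\<in>A. \<omega> i = \<zeta> i)" for \<omega>
      using True by (auto simp: fun_eq_iff PiE_iff extensional_def)
    then show ?thesis
      unfolding cyl_def prod_emb_def space_count_space by (auto simp: PiE_iff extensional_def)
  qed
  moreover have "\<dots> \<in> sets (\<Pi>\<^sub>M i\<in>V. count_space {0, 1::nat})"
    using True assms by (intro sets_PiM_I) (auto simp: PiE_def Pi_def)
  ultimately show ?thesis by simp
next
  case False
  then have "cyl V A \<zeta> = {}"
    using restrict_spins[OF _ assms(2)] unfolding cyl_def by blast
  then show ?thesis by simp
qed

lemma cyl_disjoint: "\<zeta> \<noteq> \<zeta>' \<Longrightarrow> cyl V A \<zeta> \<inter> cyl V A \<zeta>' = {}"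
  by (auto simp: cyl_def)

lemma cyl_refine:
  assumes "A \<subseteq> B" "B \<subseteq> V"
  shows "cyl V A \<zeta> = (\<Union>\<eta>\<in>cyl B A \<zeta>. cyl V B \<eta>)"
  using assms restrict_spins[of _ V B] by (auto simp: cyl_def Int_absorb1)

lemma sum_cyl_refine:
  fixes f :: "_ \<Rightarrow> real"
  assumes "A \<subseteq> B" "B \<subseteq> C" "finite C"
  shows "sum f (cyl C A \<zeta>) = (\<Sum>\<eta>\<in>cyl B A \<zeta>. sum f (cyl C B \<eta>))"
  unfolding cyl_refine[OF assms(1,2)]
  using assms by (intro sum.UNION_disjoint ballI impI cyl_disjoint finite_cyl)
    (auto intro: finite_subset)

lemma sum_spins_refine:
  fixes f :: "_ \<Rightarrow> real"
  assumes "B \<subseteq> C" "finite C"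
  shows "sum f (spins C) = (\<Sum>\<eta>\<in>spins B. sum f (cyl C B \<eta>))"
  using sum_cyl_refine[of "{}" B C f "\<lambda>_. undefined"] assms by (simp add: cyl_empty)

lemma bij_betw_merge_cyl:
  assumes "A \<inter> S = {}" "\<zeta> \<in> spins A"
  shows "bij_betw (\<lambda>\<sigma>. merge A S (\<zeta>, \<sigma>)) (spins S) (cyl (A \<union> S) A \<zeta>)"
proof (rule bij_betwI[where g = "\<lambda>\<omega>. restrict \<omega> S"])
  show "(\<lambda>\<sigma>. merge A S (\<zeta>, \<sigma>)) \<in> spins S \<rightarrow> cyl (A \<union> S) A \<zeta>"
    using assms by (intro Pi_I) (auto simp: cyl_def PiE_iff merge_def extensional_def fun_eq_iff)
  show "(\<lambda>\<omega>. restrict \<omega> S) \<in> cyl (A \<union> S) A \<zeta> \<rightarrow> spins S"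
    by (auto simp: cyl_def PiE_iff)
qed (use assms in \<open>auto simp: cyl_def\<close>)

lemma sum_cyl_merge:
  fixes f :: "_ \<Rightarrow> real"
  assumes "A \<inter> S = {}" "\<zeta> \<in> spins A"
  shows "sum f (cyl (A \<union> S) A \<zeta>) = (\<Sum>\<sigma>\<in>spins S. f (merge A S (\<zeta>, \<sigma>)))"
  by (rule sum.reindex_bij_betw[OF bij_betw_merge_cyl[OF assms], symmetric])

lemma exhaust_finite:
  fixes C :: "nat \<Rightarrow> 'i set"
  assumes "finite J" "J \<subseteq> (\<Union>n. C n)" "incseq C"
  shows "\<exists>n\<ge>N. J \<subseteq> C n"
  using assms(1,2)
proof induction
  case (insert x J)
  then obtain n m where "n \<ge> N" "J \<subseteq> C n" "x \<in> C m" by auto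
  moreover have "C n \<subseteq> C (max n m)" "C m \<subseteq> C (max n m)"
    using assms(3) by (auto simp: incseq_def)
  ultimately show ?case by (intro exI[of _ "max n m"]) auto
qed auto

text \<open>Every finite rectangle depends only on the coordinates in some \<open>C n\<close>, hence
  is a finite disjoint union of cylinders over \<open>C n\<close>, and the rectangles determine a
  finite measure. The threshold \<open>N\<close> serves comparisons that hold only on balls well
  beyond a given finite set.\<close>

lemma measure_eqI_cyl:
  fixes C :: "nat \<Rightarrow> 'i set" and P Q :: "('i \<Rightarrow> nat) measure"
  assumes P: "sets P = sets (\<Pi>\<^sub>M i\<in>V. count_space {0, 1})"
    and Q: "sets Q = sets (\<Pi>\<^sub>M i\<in>V. count_space {0, 1})"
    and fin: "finite_measure P"
    and C: "incseq C" "\<And>n. finite (C n)" "V = (\<Union>n. C n)"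
    and eq: "\<And>n \<zeta>. n \<ge> N \<Longrightarrow> \<zeta> \<in> spins (C n) \<Longrightarrow>
      emeasure P (cyl V (C n) \<zeta>) = emeasure Q (cyl V (C n) \<zeta>)"
  shows "P = Q"
proof (rule measure_eqI_PiM_infinite[OF P Q _ fin])
  fix A and J :: "'i set"
  assume J: "finite J" "J \<subseteq> V"
  let ?X = "prod_emb V (\<lambda>_. count_space {0, 1::nat}) J (Pi\<^sub>E J A)"
  obtain n where n: "n \<ge> N" "J \<subseteq> C n"
    using exhaust_finite[of J C N] J C by auto
  define T where "T = {\<zeta> \<in> spins (C n). restrict \<zeta> J \<in> Pi\<^sub>E J A}"
  have CV: "C n \<subseteq> V" using C(3) by auto
  have finT: "finite T"
    unfolding T_def using finite_spins[OF C(2)] by auto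
  have X: "?X = (\<Union>\<zeta>\<in>T. cyl V (C n) \<zeta>)"
  proof -
    have "restrict (restrict x (C n)) J = restrict x J" for x :: "'i \<Rightarrow> nat"
      using n(2) by (simp add: Int_absorb1)
    then have "restrict x J \<in> Pi\<^sub>E J A \<longleftrightarrow> restrict (restrict x (C n)) J \<in> Pi\<^sub>E J A" for x
      by metis
    then have "?X = {\<omega> \<in> spins V. restrict \<omega> (C n) \<in> T}"
      using restrict_spins[OF _ CV] unfolding prod_emb_def T_def space_count_space
      by (intro set_eqI) (simp only: Int_iff mem_Collect_eq vimage_eq, metis)
    then show ?thesis unfolding cyl_def by auto
  qed
  have dis: "disjoint_family_on (cyl V (C n)) T"
    by (auto simp: disjoint_family_on_def cyl_def)
  have "emeasure M ?X = (\<Sum>\<zeta>\<in>T. emeasure M (cyl V (C n) \<zeta>))"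
    if "sets M = sets (\<Pi>\<^sub>M i\<in>V. count_space {0, 1::nat})" for M
    unfolding X
    by (rule sum_emeasure[symmetric])
       (use that sets_cyl[OF C(2) CV] dis finT in auto)
  then show "emeasure P ?X = emeasure Q ?X"
    using P Q eq n by (simp add: T_def)
qed

text \<open>The available extension theorem concerns Polish factors with their Borel sets. The
  finite distributions are therefore carried over to real coordinates, extended there, and the limit
  is pushed back to spins by \<open>g\<close>. The theorem also wants a marginal for every finite
  index set \<open>J\<close>; it is taken from the least \<open>B n\<close> containing
  \<open>J\<close>, and consistency makes the choice of \<open>n\<close> immaterial.\<close>

lemma kolmogorov_extension_spins:
  fixes B :: "nat \<Rightarrow> 'i set" and p :: "nat \<Rightarrow> ('i \<Rightarrow> nat) \<Rightarrow> real"
  assumes B: "incseq B" "\<And>n. finite (B n)" "V = (\<Union>n. B n)"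
    and nonneg: "\<And>n \<eta>. \<eta> \<in> spins (B n) \<Longrightarrow> p n \<eta> \<ge> 0"
    and total: "sum (p 0) (spins (B 0)) = 1"
    and consistent: "\<And>n \<eta>. \<eta> \<in> spins (B n) \<Longrightarrow> sum (p (Suc n)) (cyl (B (Suc n)) (B n) \<eta>) = p n \<eta>"
  shows "\<exists>\<mu>. prob_space \<mu> \<and> sets \<mu> = sets (\<Pi>\<^sub>M i\<in>V. count_space {0, 1}) \<and>
    (\<forall>n. \<forall>\<eta>\<in>spins (B n). measure \<mu> (cyl V (B n) \<eta>) = p n \<eta>)"
proof -
  have Bmono: "B m \<subseteq> B n" if "m \<le> n" for m n
    using B(1) that by (auto simp: incseq_def)
  have cons: "sum (p (m + k)) (cyl (B (m + k)) (B m) \<eta>) = p m \<eta>"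
    if "\<eta> \<in> spins (B m)" for m k \<eta>
  proof (induction k)
    case 0
    have "cyl (B m) (B m) \<eta> = {\<eta>}"
      using that by (auto simp: cyl_def)
    then show ?case by simp
  next
    case (Suc k)
    have "sum (p (m + Suc k)) (cyl (B (m + Suc k)) (B m) \<eta>)
        = (\<Sum>\<eta>'\<in>cyl (B (m + k)) (B m) \<eta>. sum (p (m + Suc k)) (cyl (B (m + Suc k)) (B (m + k)) \<eta>'))"
      by (rule sum_cyl_refine) (auto intro!: Bmono B simp del: subsetI)
    also have "\<dots> = sum (p (m + k)) (cyl (B (m + k)) (B m) \<eta>)"
      using consistent[of _ "m + k"] by (intro sum.cong) (auto simp: cyl_def)
    finally show ?case using Suc by simp
  qed
  define Q where "Q n = point_measure (spins (B n)) (\<lambda>\<eta>. ennreal (p n \<eta>))" for n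
  have em: "emeasure (Q n) X = ennreal (sum (p n) X)" if "X \<subseteq> spins (B n)" for n X
  proof -
    have "emeasure (Q n) X = (\<Sum>x\<in>X. ennreal (p n x))"
      unfolding Q_def using that finite_spins[OF B(2)] by (intro emeasure_point_measure_finite)
    also have "\<dots> = ennreal (sum (p n) X)"
      using that nonneg by (intro sum_ennreal) auto
    finally show ?thesis .
  qed
  have sQ: "sets (Q n) = Pow (spins (B n))" "space (Q n) = spins (B n)" for n
    by (auto simp: Q_def sets_point_measure space_point_measure)
  have tot: "sum (p n) (spins (B n)) = 1" for n
  proof -
    have "sum (p n) (spins (B n)) = (\<Sum>\<eta>\<in>spins (B 0). sum (p n) (cyl (B n) (B 0) \<eta>))"
      by (rule sum_spins_refine) (auto intro!: Bmono B simp del: subsetI)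
    also have "\<dots> = sum (p 0) (spins (B 0))"
      using cons[of _ 0 n] by (intro sum.cong) auto
    finally show ?thesis using total by metis
  qed
  have prQ: "prob_space (Q n)" for n
    by (rule prob_spaceI) (simp add: em sQ tot)
  have proj: "distr (Q (m + k)) (Q m) (\<lambda>\<eta>. restrict \<eta> (B m)) = Q m" for m k
  proof (rule measure_eqI)
    fix X assume "X \<in> sets (distr (Q (m + k)) (Q m) (\<lambda>\<eta>. restrict \<eta> (B m)))"
    then have X: "X \<subseteq> spins (B m)" by (simp add: sQ)
    have meas: "(\<lambda>\<eta>. restrict \<eta> (B m)) \<in> measurable (Q (m + k)) (Q m)"
      using restrict_spins[of _ "B (m + k)" "B m"] Bmono[of m "m + k"]
      by (auto simp: measurable_def sQ)
    have "emeasure (distr (Q (m + k)) (Q m) (\<lambda>\<eta>. restrict \<eta> (B m))) X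
        = emeasure (Q (m + k)) ((\<lambda>\<eta>. restrict \<eta> (B m)) -` X \<inter> spins (B (m + k)))"
      using X by (subst emeasure_distr[OF meas]) (auto simp: sQ)
    also have "(\<lambda>\<eta>. restrict \<eta> (B m)) -` X \<inter> spins (B (m + k)) = (\<Union>\<eta>\<in>X. cyl (B (m + k)) (B m) \<eta>)"
      by (auto simp: cyl_def)
    also have "emeasure (Q (m + k)) \<dots> = ennreal (sum (p (m + k)) (\<Union>\<eta>\<in>X. cyl (B (m + k)) (B m) \<eta>))"
      by (rule em) (auto simp: cyl_def)
    also have "sum (p (m + k)) (\<Union>\<eta>\<in>X. cyl (B (m + k)) (B m) \<eta>) = (\<Sum>\<eta>\<in>X. sum (p (m + k)) (cyl (B (m + k)) (B m) \<eta>))"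
      using X by (intro sum.UNION_disjoint ballI impI cyl_disjoint finite_cyl B)
        (auto intro: finite_subset[OF _ finite_spins[OF B(2)]])
    also have "\<dots> = sum (p m) X"
      using X cons by (intro sum.cong) auto
    also have "ennreal \<dots> = emeasure (Q m) X" using em[OF X] by simp
    finally show "emeasure (distr (Q (m + k)) (Q m) (\<lambda>\<eta>. restrict \<eta> (B m))) X = emeasure (Q m) X" .
  qed simp
  define R where "R n J = distr (Q n) (\<Pi>\<^sub>M i\<in>J. (borel :: real measure)) (\<lambda>\<eta>. \<lambda>i\<in>J. real (\<eta> i))" for n J
  have R_meas: "(\<lambda>\<eta>. \<lambda>i\<in>J. real (\<eta> i)) \<in> measurable (Q n) (\<Pi>\<^sub>M i\<in>J. (borel :: real measure))" for n J
    by (auto simp: measurable_def sQ space_PiM)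
  have R_indep: "R n J = R m J" if "J \<subseteq> B m" "m \<le> n" for m n J
  proof -
    obtain k where k: "n = m + k" using \<open>m \<le> n\<close> le_Suc_ex by blast
    have "R m J = distr (distr (Q (m + k)) (Q m) (\<lambda>\<eta>. restrict \<eta> (B m))) (\<Pi>\<^sub>M i\<in>J. borel) (\<lambda>\<eta>. \<lambda>i\<in>J. real (\<eta> i))"
      by (simp add: proj R_def)
    also have "\<dots> = distr (Q (m + k)) (\<Pi>\<^sub>M i\<in>J. borel) ((\<lambda>\<eta>. \<lambda>i\<in>J. real (\<eta> i)) \<circ> (\<lambda>\<eta>. restrict \<eta> (B m)))"
      using restrict_spins[of _ "B (m + k)" "B m"] Bmono[of m "m + k"]
      by (intro distr_distr R_meas) (auto simp: measurable_def sQ)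
    also have "(\<lambda>\<eta>. \<lambda>i\<in>J. real (\<eta> i)) \<circ> (\<lambda>\<eta>. restrict \<eta> (B m)) = (\<lambda>\<eta>. \<lambda>i\<in>J. real (\<eta> i))"
      using \<open>J \<subseteq> B m\<close> by (auto simp: fun_eq_iff)
    finally show ?thesis unfolding R_def k by (rule sym)
  qed
  define N where "N J = (LEAST n. J \<subseteq> B n)" for J
  have N: "J \<subseteq> B (N J)" if "finite J" "J \<subseteq> V" for J
    unfolding N_def using exhaust_finite[of J B 0] that B by (metis LeastI)
  have R_N: "R n J = R (N J) J" if "J \<subseteq> B n" for n J
    using R_indep[of J "N J" n] that unfolding N_def by (metis LeastI Least_le)
  interpret L: polish_projective V "\<lambda>J. R (N J) J"
  proof (intro polish_projective.intro projective_family.intro)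
    fix J H :: "'i set" assume JH: "J \<subseteq> H" "finite H" "H \<subseteq> V"
    have "R (N J) J = R (N H) J"
      using R_N[of J "N H"] N[of H] JH by auto
    also have "\<dots> = distr (R (N H) H) (\<Pi>\<^sub>M i\<in>J. borel) (\<lambda>f. restrict f J)"
      unfolding R_def using JH(1)
      by (subst distr_distr[OF _ R_meas])
        (auto intro!: distr_cong measurable_restrict_subset simp: fun_eq_iff)
    finally show "R (N J) J = distr (R (N H) H) (\<Pi>\<^sub>M i\<in>J. borel) (\<lambda>f. restrict f J)" .
  next
    fix J :: "'i set"
    show "prob_space (R (N J) J)"
      unfolding R_def by (intro prob_space.prob_space_distr prQ R_meas)
  qed
  define g :: "('i \<Rightarrow> real) \<Rightarrow> 'i \<Rightarrow> nat" where "g \<omega> = (\<lambda>i\<in>V. if \<omega> i = 1 then 1 else 0)" for \<omega>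
  have g_meas: "g \<in> measurable L.lim (\<Pi>\<^sub>M i\<in>V. count_space {0, 1})"
  proof -
    have "g \<in> measurable (\<Pi>\<^sub>M i\<in>V. borel) (\<Pi>\<^sub>M i\<in>V. count_space {0, 1})"
      unfolding g_def
    proof (rule measurable_restrict)
      fix i assume "i \<in> V"
      then have [measurable]: "(\<lambda>x. x i) \<in> borel_measurable (\<Pi>\<^sub>M i\<in>V. (borel::real measure))"
        by simp
      show "(\<lambda>x. if x i = 1 then 1 else 0) \<in> measurable (\<Pi>\<^sub>M i\<in>V. (borel::real measure)) (count_space {0, 1::nat})"
        by measurable
    qed
    then show ?thesis
      by (simp cong: measurable_cong_sets add: measurable_cong_sets[OF L.sets_lim])
  qed
  define \<mu> where "\<mu> = distr L.lim (\<Pi>\<^sub>M i\<in>V. count_space {0, 1::nat}) g"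
  have "measure \<mu> (cyl V (B n) \<eta>) = p n \<eta>" if \<eta>: "\<eta> \<in> spins (B n)" for n \<eta>
  proof -
    have BV: "B n \<subseteq> V" using B(3) by auto
    \<comment> \<open>\<open>g\<close> reads every real other than 1 as spin 0, so the preimage of a
      cylinder is a rectangle whose factors are {1} or its complement.\<close>
    let ?Y = "\<Pi>\<^sub>E i\<in>B n. {x::real. (if x = 1 then 1 else 0) = \<eta> i}"
    have Y: "?Y \<in> sets (\<Pi>\<^sub>M i\<in>B n. borel)"
      by (intro sets_PiM_I_finite B) (auto intro!: borel_closed simp: if_distrib)
    have pre: "g -` cyl V (B n) \<eta> \<inter> space L.lim = prod_emb V (\<lambda>_. borel) (B n) ?Y"
      using \<eta> BV
      by (auto simp: L.space_lim space_PiM prod_emb_def cyl_def g_def fun_eq_iff PiE_iff extensional_def restrict_def)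
        (metis subsetD)+
    have "measure \<mu> (cyl V (B n) \<eta>) = measure L.lim (prod_emb V (\<lambda>_. borel) (B n) ?Y)"
      unfolding \<mu>_def using measure_distr[OF g_meas sets_cyl[OF B(2) BV]] pre by simp
    also have "\<dots> = measure (R (N (B n)) (B n)) ?Y"
      by (rule L.measure_lim_emb[OF BV B(2) Y])
    also have "\<dots> = measure (R n (B n)) ?Y"
      using R_N[of "B n" n] by simp
    also have "\<dots> = measure (Q n) {\<eta>}"
      unfolding R_def using \<eta>
      by (subst measure_distr[OF R_meas Y])
        (auto intro!: arg_cong[where f="measure (Q n)"] simp: sQ PiE_iff fun_eq_iff extensional_def split: if_splits, metis)
    also have "\<dots> = p n \<eta>"
      using em[of "{\<eta>}" n] \<eta> nonneg[OF \<eta>] by (simp add: measure_def)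
    finally show ?thesis .
  qed
  moreover have "prob_space \<mu>"
    unfolding \<mu>_def by (intro L.P.prob_space_distr g_meas)
  ultimately show ?thesis
    by (intro exI[of _ \<mu>]) (auto simp: \<mu>_def)
qed

subsection \<open>Weights on balls of the tree\<close>

lemma sum_spins_Un:
  fixes f :: "_ \<Rightarrow> real"
  assumes "A \<inter> S = {}" "finite A" "finite S"
  shows "sum f (spins (A \<union> S)) = (\<Sum>\<alpha>\<in>spins A. \<Sum>\<beta>\<in>spins S. f (merge A S (\<alpha>, \<beta>)))"
  using sum_spins_refine[of A "A \<union> S" f] sum_cyl_merge[OF assms(1)] assms
  by (auto intro!: sum.cong)

text \<open>Distributivity over disjoint blocks of spins: this is how, given the spins above, the
  families of children of different nodes become independent.\<close>

lemma sum_spins_prod: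
  fixes f :: "'j \<Rightarrow> ('i \<Rightarrow> nat) \<Rightarrow> real"
  assumes "finite I" "\<And>i. i \<in> I \<Longrightarrow> finite (C i)" "disjoint_family_on C I"
    and "\<And>i \<sigma> \<tau>. i \<in> I \<Longrightarrow> (\<And>k. k \<in> C i \<Longrightarrow> \<sigma> k = \<tau> k) \<Longrightarrow> f i \<sigma> = f i \<tau>"
  shows "(\<Sum>\<sigma>\<in>spins (\<Union>i\<in>I. C i). \<Prod>i\<in>I. f i \<sigma>) = (\<Prod>i\<in>I. \<Sum>\<sigma>\<in>spins (C i). f i \<sigma>)"
  using assms
proof (induction I rule: finite_induct)
  case (insert x I)
  have dis: "C x \<inter> (\<Union>i\<in>I. C i) = {}"
  proof -
    have "C x \<inter> C i = {}" if "i \<in> I" for i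
      using disjoint_family_onD[OF insert.prems(2), of x i] insert.hyps(2) that by auto
    then show ?thesis by auto
  qed
  have IH: "(\<Sum>\<sigma>\<in>spins (\<Union>i\<in>I. C i). \<Prod>i\<in>I. f i \<sigma>) = (\<Prod>i\<in>I. \<Sum>\<sigma>\<in>spins (C i). f i \<sigma>)"
  proof (rule insert.IH)
    show "disjoint_family_on C I"
      using insert.prems(2) by (auto simp: disjoint_family_on_def)
    show "f i \<sigma> = f i \<tau>" if "i \<in> I" "\<And>k. k \<in> C i \<Longrightarrow> \<sigma> k = \<tau> k" for i \<sigma> \<tau>
      using that by (intro insert.prems(3)) auto
  qed (use insert.prems(1) in auto)
  let ?U = "\<Union>i\<in>I. C i"
  have m1: "f x (merge (C x) ?U (\<alpha>, \<beta>)) = f x \<alpha>" for \<alpha> \<beta>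
    by (rule insert.prems(3)) (auto simp: merge_def)
  have m2: "(\<Prod>i\<in>I. f i (merge (C x) ?U (\<alpha>, \<beta>))) = (\<Prod>i\<in>I. f i \<beta>)" for \<alpha> \<beta>
  proof (rule prod.cong[OF refl])
    fix i assume i: "i \<in> I"
    show "f i (merge (C x) ?U (\<alpha>, \<beta>)) = f i \<beta>"
      by (rule insert.prems(3)) (use i dis in \<open>auto simp: merge_def\<close>)
  qed
  have "(\<Sum>\<sigma>\<in>spins (\<Union>i\<in>insert x I. C i). \<Prod>i\<in>insert x I. f i \<sigma>)
      = (\<Sum>\<alpha>\<in>spins (C x). \<Sum>\<beta>\<in>spins ?U. f x \<alpha> * (\<Prod>i\<in>I. f i \<beta>))"
    using insert.hyps insert.prems(1) dis by (simp add: sum_spins_Un m1 m2)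
  also have "\<dots> = (\<Sum>\<alpha>\<in>spins (C x). f x \<alpha>) * (\<Sum>\<beta>\<in>spins ?U. \<Prod>i\<in>I. f i \<beta>)"
    by (simp add: sum_product)
  also have "\<dots> = (\<Prod>i\<in>insert x I. \<Sum>\<sigma>\<in>spins (C i). f i \<sigma>)"
    using insert.hyps IH by simp
  finally show ?case .
qed (simp add: PiE_empty_domain)

section \<open>Geometry of the rooted tree: balls, spheres, children and neighbourhoods\<close>

definition occ :: "('i \<Rightarrow> nat) \<Rightarrow> 'i set \<Rightarrow> nat" where
  "occ \<omega> A = card {j \<in> A. \<omega> j = 1}"

lemma occ_cong: "(\<And>k. k \<in> A \<Longrightarrow> \<omega> k = \<omega>' k) \<Longrightarrow> occ \<omega> A = occ \<omega>' A"
  unfolding occ_def by (rule arg_cong[where f=card]) auto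

lemma occ_le: "finite A \<Longrightarrow> occ \<omega> A \<le> card A"
  unfolding occ_def by (rule card_mono) auto

definition tree_ball :: "nat \<Rightarrow> nat \<Rightarrow> nat list set" where
  "tree_ball \<Delta> n = {w \<in> tree_nodes \<Delta>. length w \<le> n}"

definition tree_sphere :: "nat \<Rightarrow> nat \<Rightarrow> nat list set" where
  "tree_sphere \<Delta> n = {w \<in> tree_nodes \<Delta>. length w = n}"

text \<open>Letters are added at the head, so \<open>tl\<close> is the parent map. Since
  \<open>tl [] = []\<close>, the root has to be excluded, or it would be its own child.\<close>

definition children :: "nat \<Rightarrow> nat list \<Rightarrow> nat list set" where
  "children \<Delta> i = {k \<in> tree_nodes \<Delta>. k \<noteq> [] \<and> tl k = i}"

lemma finite_tree_ball: "finite (tree_ball \<Delta> n)"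
proof (rule finite_subset)
  show "tree_ball \<Delta> n \<subseteq> {w. set w \<subseteq> {..<\<Delta>} \<and> length w \<le> n}"
    by (auto simp: tree_ball_def tree_nodes_def)
qed (rule finite_lists_length_le, simp)

lemma tree_sphere_subset_ball: "tree_sphere \<Delta> n \<subseteq> tree_ball \<Delta> n"
  by (auto simp: tree_ball_def tree_sphere_def)

lemma finite_tree_sphere: "finite (tree_sphere \<Delta> n)"
  by (rule finite_subset[OF tree_sphere_subset_ball finite_tree_ball])

lemma tree_ball_Suc: "tree_ball \<Delta> (Suc n) = tree_ball \<Delta> n \<union> tree_sphere \<Delta> (Suc n)"
  by (auto simp: tree_ball_def tree_sphere_def)

lemma tree_ball_sphere_disjoint: "tree_ball \<Delta> n \<inter> tree_sphere \<Delta> (Suc n) = {}"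
  by (auto simp: tree_ball_def tree_sphere_def)

lemma incseq_tree_ball: "incseq (tree_ball \<Delta>)"
  by (auto simp: tree_ball_def incseq_def)

lemma UN_tree_ball: "(\<Union>n. tree_ball \<Delta> n) = tree_nodes \<Delta>"
  by (auto simp: tree_ball_def)

lemma UN_tree_ball_Suc: "(\<Union>n. tree_ball \<Delta> (Suc n)) = tree_nodes \<Delta>"
  by (auto simp: tree_ball_def intro: le_SucI)

lemma tree_ball_subset: "tree_ball \<Delta> n \<subseteq> tree_nodes \<Delta>"
  by (auto simp: tree_ball_def)

lemma tree_ball_mono: "m \<le> n \<Longrightarrow> tree_ball \<Delta> m \<subseteq> tree_ball \<Delta> n"
  by (auto simp: tree_ball_def)

lemma tl_tree_nodes: "i \<in> tree_nodes \<Delta> \<Longrightarrow> tl i \<in> tree_nodes \<Delta>"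
  by (cases i; cases "tl i") (auto simp: tree_nodes_def)

lemma tree_sphere_Suc: "tree_sphere \<Delta> (Suc n) = (\<Union>i\<in>tree_sphere \<Delta> n. children \<Delta> i)"
  using tl_tree_nodes by (auto simp: tree_sphere_def children_def)

lemma disjoint_children: "disjoint_family_on (children \<Delta>) I"
  by (auto simp: disjoint_family_on_def children_def)

lemma children_subset: "children \<Delta> i \<subseteq> tree_sphere \<Delta> (Suc (length i))"
  by (auto simp: tree_sphere_def children_def)

lemma finite_children: "finite (children \<Delta> i)"
  by (rule finite_subset[OF children_subset finite_tree_sphere])

lemma tree_nbrs_eq:
  assumes "i \<in> tree_nodes \<Delta>"
  shows "tree_nbrs \<Delta> i = children \<Delta> i \<union> (if i = [] then {} else {tl i})"
proof (intro set_eqI)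
  fix j
  have "(\<exists>x. i = x # j) \<longleftrightarrow> i \<noteq> [] \<and> j = tl i" by (cases i) auto
  moreover have "(\<exists>x. j = x # i) \<longleftrightarrow> j \<noteq> [] \<and> tl j = i" by (cases j) auto
  ultimately show "j \<in> tree_nbrs \<Delta> i \<longleftrightarrow> j \<in> children \<Delta> i \<union> (if i = [] then {} else {tl i})"
    using tl_tree_nodes[OF assms] by (auto simp: tree_nbrs_def children_def)
qed

lemma finite_tree_nbrs: "i \<in> tree_nodes \<Delta> \<Longrightarrow> finite (tree_nbrs \<Delta> i)"
  by (simp add: tree_nbrs_eq finite_children)

lemma tl_notin_children: "tl i \<notin> children \<Delta> i" if "i \<noteq> []"
proof
  assume "tl i \<in> children \<Delta> i"
  then have "length (tl i) = Suc (length i)" using children_subset[of \<Delta> i] by (auto simp: tree_sphere_def)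
  then show False by simp
qed

lemma card_children:
  assumes "i \<in> tree_nodes \<Delta>"
  shows "card (children \<Delta> i) = (if i = [] then \<Delta> else \<Delta> - 1)"
  using card_tree_nbrs[OF assms] tl_notin_children[of i \<Delta>]
  by (auto simp: tree_nbrs_eq[OF assms] finite_children)

text \<open>Spins are the numbers 0 and 1, so the parent's spin is itself its contribution to the
  count.\<close>

lemma occ_nbrs:
  assumes "i \<in> tree_nodes \<Delta>" "i \<noteq> []" "\<omega> (tl i) \<in> {0, 1}"
  shows "occ \<omega> (tree_nbrs \<Delta> i) = \<omega> (tl i) + occ \<omega> (children \<Delta> i)"
proof (cases "\<omega> (tl i) = 1")
  case True
  then have "{j \<in> insert (tl i) (children \<Delta> i). \<omega> j = 1} = insert (tl i) {j \<in> children \<Delta> i. \<omega> j = 1}"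
    by auto
  then show ?thesis
    using True assms tl_notin_children[OF assms(2), of \<Delta>] finite_children[of \<Delta> i]
    by (simp add: tree_nbrs_eq occ_def)
next
  case False
  then have "{j \<in> insert (tl i) (children \<Delta> i). \<omega> j = 1} = {j \<in> children \<Delta> i. \<omega> j = 1}"
    by auto
  then show ?thesis
    using False assms by (simp add: tree_nbrs_eq occ_def)
qed

lemma tree_nbrs_ball: "i \<in> tree_ball \<Delta> n \<Longrightarrow> insert i (tree_nbrs \<Delta> i) \<subseteq> tree_ball \<Delta> (Suc n)"
  by (auto simp: tree_ball_def tree_nbrs_def)

definition nbhd :: "nat \<Rightarrow> nat list set \<Rightarrow> nat list set" where
  "nbhd \<Delta> \<Lambda> = {i \<in> tree_nodes \<Delta>. insert i (tree_nbrs \<Delta> i) \<inter> \<Lambda> \<noteq> {}}"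

lemma nbhd_subset_tree_ball: "\<Lambda> \<subseteq> tree_ball \<Delta> n \<Longrightarrow> nbhd \<Delta> \<Lambda> \<subseteq> tree_ball \<Delta> (Suc n)"
  by (fastforce simp: nbhd_def tree_ball_def tree_nbrs_def)

lemma nbhd_tree_ball: "nbhd \<Delta> (tree_ball \<Delta> n) = tree_ball \<Delta> (Suc n)"
proof
  show "tree_ball \<Delta> (Suc n) \<subseteq> nbhd \<Delta> (tree_ball \<Delta> n)"
  proof
    fix i assume i: "i \<in> tree_ball \<Delta> (Suc n)"
    show "i \<in> nbhd \<Delta> (tree_ball \<Delta> n)"
    proof (cases "i = []")
      case False
      then have "tl i \<in> tree_nbrs \<Delta> i \<inter> tree_ball \<Delta> n"
        using i tl_tree_nodes by (auto simp: tree_ball_def tree_nbrs_eq)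
      then show ?thesis using i by (auto simp: nbhd_def tree_ball_def)
    qed (use i in \<open>auto simp: nbhd_def tree_ball_def\<close>)
  qed
qed (rule nbhd_subset_tree_ball, simp)

section \<open>Product form of the weights, and summing out the outermost layer of a ball\<close>

locale tree_model =
  fixes \<Delta> :: nat and lam :: real and \<theta> :: "nat \<Rightarrow> real"
  assumes lam_pos: "lam > 0" and \<theta>_pos: "\<And>k. k \<le> \<Delta> \<Longrightarrow> \<theta> k > 0"
begin

text \<open>The Boltzmann factor of one potential, which sees a configuration only through the
  node's spin \<open>s\<close> and its number \<open>k\<close> of occupied neighbours; the hard-core
  constraint is the value 0 at \<open>s = 1\<close>, \<open>k > 0\<close>.\<close>

definition spin_weight :: "nat \<Rightarrow> nat \<Rightarrow> real" where
  "spin_weight s k = (if s = 1 \<and> k = 0 then lam else if s = 0 then \<theta> k else 0)"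

definition site_weight :: "nat list \<Rightarrow> (nat list \<Rightarrow> nat) \<Rightarrow> real" where
  "site_weight i \<omega> = spin_weight (\<omega> i) (occ \<omega> (tree_nbrs \<Delta> i))"

lemma spin_weight_nonneg: "k \<le> \<Delta> \<Longrightarrow> spin_weight s k \<ge> 0"
  using lam_pos \<theta>_pos[of k] by (auto simp: spin_weight_def)

lemma site_weight_nonneg: "i \<in> tree_nodes \<Delta> \<Longrightarrow> site_weight i \<omega> \<ge> 0"
  unfolding site_weight_def
  using occ_le[OF finite_tree_nbrs] card_tree_nbrs by (metis spin_weight_nonneg)

lemma site_weight_cong:
  "(\<And>j. j \<in> insert i (tree_nbrs \<Delta> i) \<Longrightarrow> \<omega> j = \<omega>' j) \<Longrightarrow> site_weight i \<omega> = site_weight i \<omega>'"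
  unfolding site_weight_def using occ_cong[of "tree_nbrs \<Delta> i" \<omega> \<omega>'] by simp

lemma boltzmann_sum:
  assumes "finite A" "\<And>i. i \<in> A \<Longrightarrow> f i \<noteq> -\<infinity>"
  shows "boltzmann (\<Sum>i\<in>A. f i) = (\<Prod>i\<in>A. boltzmann (f i))"
  using assms
proof (induction A rule: finite_induct)
  case (insert x A)
  have "sum f A \<noteq> -\<infinity>"
    using insert.hyps(1) insert.prems by (induction A rule: finite_induct) auto
  moreover have "f x \<noteq> -\<infinity>" using insert by simp
  ultimately have "boltzmann (f x + sum f A) = boltzmann (f x) * boltzmann (sum f A)"
    by (cases "f x"; cases "sum f A") (auto simp: boltzmann_def exp_add[symmetric])
  then show ?case using insert by simp
qed (simp add: boltzmann_def)

lemma boltzmann_potential: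
  assumes i: "i \<in> tree_nodes \<Delta>" and \<omega>: "\<omega> \<in> spins (tree_nodes \<Delta>)"
  shows "boltzmann (potential \<Delta> lam \<theta> i \<omega>) = site_weight i \<omega>"
proof -
  have k: "occ \<omega> (tree_nbrs \<Delta> i) \<le> \<Delta>"
    using occ_le[OF finite_tree_nbrs[OF i]] card_tree_nbrs[OF i] by metis
  have "(\<forall>j\<in>tree_nbrs \<Delta> i. \<omega> j = 0) \<longleftrightarrow> {j \<in> tree_nbrs \<Delta> i. \<omega> j = 1} = {}"
    using \<omega> by (fastforce simp: PiE_iff tree_nbrs_def)
  then have "(\<forall>j\<in>tree_nbrs \<Delta> i. \<omega> j = 0) \<longleftrightarrow> occ \<omega> (tree_nbrs \<Delta> i) = 0"
    unfolding occ_def using finite_tree_nbrs[OF i] by simp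
  then show ?thesis
    using lam_pos \<theta>_pos[OF k]
    by (auto simp: potential_def boltzmann_def site_weight_def spin_weight_def occ_def)
qed

lemma gibbs_weight_eq:
  assumes "finite \<Lambda>" "\<Lambda> \<subseteq> tree_nodes \<Delta>" "\<omega> \<in> spins (tree_nodes \<Delta>)" "\<eta> \<in> spins \<Lambda>"
  shows "gibbs_weight \<Delta> lam \<theta> \<Lambda> \<omega> \<eta> =
    (\<Prod>i\<in>nbhd \<Delta> \<Lambda>. site_weight i (merge \<Lambda> (tree_nodes \<Delta> - \<Lambda>) (\<eta>, \<omega>)))"
proof -
  let ?\<omega> = "merge \<Lambda> (tree_nodes \<Delta> - \<Lambda>) (\<eta>, \<omega>)"
  have sp: "?\<omega> \<in> spins (tree_nodes \<Delta>)"
    using assms by (auto simp: PiE_iff merge_def extensional_def)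
  obtain n where "\<Lambda> \<subseteq> tree_ball \<Delta> n"
    using exhaust_finite[OF assms(1) _ incseq_tree_ball] assms(2) UN_tree_ball by metis
  then have "finite (nbhd \<Delta> \<Lambda>)"
    using nbhd_subset_tree_ball finite_tree_ball by (metis finite_subset)
  then have "gibbs_weight \<Delta> lam \<theta> \<Lambda> \<omega> \<eta> = (\<Prod>i\<in>nbhd \<Delta> \<Lambda>. boltzmann (potential \<Delta> lam \<theta> i ?\<omega>))"
    unfolding gibbs_weight_def hamiltonian_def nbhd_def
    by (intro boltzmann_sum) (auto simp: potential_def)
  also have "\<dots> = (\<Prod>i\<in>nbhd \<Delta> \<Lambda>. site_weight i ?\<omega>)"
    using sp by (intro prod.cong refl boltzmann_potential) (auto simp: nbhd_def)
  finally show ?thesis .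
qed

text \<open>A message \<^term>\<open>m i s p\<close> depends on the spin \<^term>\<open>s\<close> of the node \<^term>\<open>i\<close> and
  the spin \<^term>\<open>p\<close> of its parent.\<close>

definition ball_weight ::
  "nat \<Rightarrow> (nat list \<Rightarrow> nat \<Rightarrow> nat \<Rightarrow> real) \<Rightarrow> (nat list \<Rightarrow> nat) \<Rightarrow> real" where
  "ball_weight n m \<omega> =
     (\<Prod>i\<in>tree_ball \<Delta> n. site_weight i \<omega>) * (\<Prod>i\<in>tree_sphere \<Delta> (Suc n). m i (\<omega> i) (\<omega> (tl i)))"

text \<open>One summand of the recursion, with the spins of the children frozen to \<sigma>. Taking
  \<sigma> from a boundary condition instead of summing over it turns that condition into a
  message.\<close>

definition step_at ::
  "(nat list \<Rightarrow> nat) \<Rightarrow> (nat list \<Rightarrow> nat \<Rightarrow> nat \<Rightarrow> real) \<Rightarrow> nat list \<Rightarrow> nat \<Rightarrow> nat \<Rightarrow> real" where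
  "step_at \<sigma> m i s p =
     spin_weight s (p + occ \<sigma> (children \<Delta> i)) * (\<Prod>k\<in>children \<Delta> i. m k (\<sigma> k) s)"

definition step ::
  "(nat list \<Rightarrow> nat \<Rightarrow> nat \<Rightarrow> real) \<Rightarrow> nat list \<Rightarrow> nat \<Rightarrow> nat \<Rightarrow> real" where
  "step m i s p = (\<Sum>\<sigma>\<in>spins (children \<Delta> i). step_at \<sigma> m i s p)"

lemma step_at_cong:
  "(\<And>k. k \<in> children \<Delta> i \<Longrightarrow> \<sigma> k = \<tau> k) \<Longrightarrow> (\<And>k s. k \<in> children \<Delta> i \<Longrightarrow> m k (\<tau> k) s = m' k (\<tau> k) s) \<Longrightarrow>
   step_at \<sigma> m i s p = step_at \<tau> m' i s p"
  unfolding step_at_def using occ_cong[of "children \<Delta> i" \<sigma> \<tau>] by (auto intro!: prod.cong)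

lemma ball_weight_cong:
  assumes "\<And>j. j \<in> tree_ball \<Delta> (Suc n) \<Longrightarrow> \<omega> j = \<omega>' j"
    and "\<And>i. i \<in> tree_sphere \<Delta> (Suc n) \<Longrightarrow> m i (\<omega>' i) (\<omega>' (tl i)) = m' i (\<omega>' i) (\<omega>' (tl i))"
  shows "ball_weight n m \<omega> = ball_weight n m' \<omega>'"
proof -
  have "site_weight i \<omega> = site_weight i \<omega>'" if "i \<in> tree_ball \<Delta> n" for i
    using tree_nbrs_ball[OF that] assms(1) by (intro site_weight_cong) auto
  moreover have "\<omega> i = \<omega>' i" "\<omega> (tl i) = \<omega>' (tl i)" if "i \<in> tree_sphere \<Delta> (Suc n)" for i
    using that tl_tree_nodes[of i \<Delta>] by (auto intro!: assms(1) simp: tree_ball_def tree_sphere_def)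
  ultimately show ?thesis
    unfolding ball_weight_def using assms(2) by (simp cong: prod.cong)
qed

text \<open>The factors of the new layer are regrouped by parent: the weight of a node on the sphere
  of radius \<open>n + 1\<close> together with the messages of its children is
  \<open>step_at\<close>. The spins inside must be 0 or 1 because the parent's spin is used as a
  number.\<close>

lemma ball_weight_Suc:
  assumes "\<And>j. j \<in> tree_ball \<Delta> (Suc n) \<Longrightarrow> \<omega> j \<in> {0, 1}"
  shows "ball_weight (Suc n) m \<omega> = ball_weight n (step_at \<omega> m) \<omega>"
proof -
  have "(\<Prod>k\<in>tree_sphere \<Delta> (Suc (Suc n)). m k (\<omega> k) (\<omega> (tl k)))
      = (\<Prod>i\<in>tree_sphere \<Delta> (Suc n). \<Prod>k\<in>children \<Delta> i. m k (\<omega> k) (\<omega> (tl k)))"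
    unfolding tree_sphere_Suc[of \<Delta> "Suc n"]
    by (intro prod.UNION_disjoint finite_tree_sphere ballI finite_children)
      (auto simp: children_def)
  also have "\<dots> = (\<Prod>i\<in>tree_sphere \<Delta> (Suc n). \<Prod>k\<in>children \<Delta> i. m k (\<omega> k) (\<omega> i))"
    by (intro prod.cong refl) (auto simp: children_def)
  finally have 1: "(\<Prod>k\<in>tree_sphere \<Delta> (Suc (Suc n)). m k (\<omega> k) (\<omega> (tl k))) = \<dots>" .
  have 2: "site_weight i \<omega> = spin_weight (\<omega> i) (\<omega> (tl i) + occ \<omega> (children \<Delta> i))"
    if "i \<in> tree_sphere \<Delta> (Suc n)" for i
  proof -
    have "tl i \<in> tree_ball \<Delta> (Suc n)"
      using that tl_tree_nodes by (auto simp: tree_ball_def tree_sphere_def)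
    then have "\<omega> (tl i) \<in> {0, 1}" by (rule assms)
    then show ?thesis
      unfolding site_weight_def using that by (subst occ_nbrs) (auto simp: tree_sphere_def)
  qed
  have "(\<Prod>i\<in>tree_ball \<Delta> (Suc n). site_weight i \<omega>)
      = (\<Prod>i\<in>tree_ball \<Delta> n. site_weight i \<omega>) * (\<Prod>i\<in>tree_sphere \<Delta> (Suc n). site_weight i \<omega>)"
    unfolding tree_ball_Suc by (intro prod.union_disjoint finite_tree_ball finite_tree_sphere tree_ball_sphere_disjoint)
  then show ?thesis
    unfolding ball_weight_def 1 step_at_def using 2 by (simp add: prod.distrib)
qed

text \<open>Once \<eta> is fixed, the spins on the outer sphere enter only through products over
  families of siblings, so the sum of products factorises into a product of sums, one application of
  \<open>step\<close> for each parent.\<close>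

lemma sum_ball_weight_Suc:
  assumes \<eta>: "\<eta> \<in> spins (tree_ball \<Delta> (Suc n))"
  shows "sum (ball_weight (Suc n) m) (cyl (tree_ball \<Delta> (Suc (Suc n))) (tree_ball \<Delta> (Suc n)) \<eta>)
    = ball_weight n (step m) \<eta>"
proof -
  let ?B = "tree_ball \<Delta> (Suc n)" and ?S = "tree_sphere \<Delta> (Suc (Suc n))"
  have eq: "ball_weight (Suc n) m (merge ?B ?S (\<eta>, \<sigma>)) =
      (\<Prod>i\<in>tree_ball \<Delta> n. site_weight i \<eta>) * (\<Prod>i\<in>tree_sphere \<Delta> (Suc n). step_at \<sigma> m i (\<eta> i) (\<eta> (tl i)))"
    if \<sigma>: "\<sigma> \<in> spins ?S" for \<sigma>
  proof -
    let ?\<omega> = "merge ?B ?S (\<eta>, \<sigma>)"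
    have "?\<omega> j \<in> {0, 1}" if "j \<in> ?B" for j
      using \<eta> that by (auto simp: merge_def PiE_iff)
    then have "ball_weight (Suc n) m ?\<omega> = ball_weight n (step_at ?\<omega> m) ?\<omega>"
      by (rule ball_weight_Suc)
    also have "\<dots> = ball_weight n (step_at \<sigma> m) \<eta>"
    proof (rule ball_weight_cong)
      fix i assume "i \<in> tree_sphere \<Delta> (Suc n)"
      then have "children \<Delta> i \<subseteq> ?S" by (auto simp: tree_sphere_Suc[of \<Delta> "Suc n"])
      then show "step_at ?\<omega> m i (\<eta> i) (\<eta> (tl i)) = step_at \<sigma> m i (\<eta> i) (\<eta> (tl i))"
        using tree_ball_sphere_disjoint[of \<Delta> "Suc n"]
        by (intro step_at_cong) (auto simp: merge_def)
    qed (simp add: merge_def)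
    finally show ?thesis by (simp add: ball_weight_def)
  qed
  have "sum (ball_weight (Suc n) m) (cyl (?B \<union> ?S) ?B \<eta>) =
     (\<Sum>\<sigma>\<in>spins ?S. ball_weight (Suc n) m (merge ?B ?S (\<eta>, \<sigma>)))"
    by (rule sum_cyl_merge[OF tree_ball_sphere_disjoint \<eta>])
  also have "\<dots> = (\<Prod>i\<in>tree_ball \<Delta> n. site_weight i \<eta>) *
     (\<Sum>\<sigma>\<in>spins ?S. \<Prod>i\<in>tree_sphere \<Delta> (Suc n). step_at \<sigma> m i (\<eta> i) (\<eta> (tl i)))"
    by (simp add: eq sum_distrib_left)
  also have "(\<Sum>\<sigma>\<in>spins ?S. \<Prod>i\<in>tree_sphere \<Delta> (Suc n). step_at \<sigma> m i (\<eta> i) (\<eta> (tl i))) =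
     (\<Prod>i\<in>tree_sphere \<Delta> (Suc n). step m i (\<eta> i) (\<eta> (tl i)))"
    unfolding step_def tree_sphere_Suc[of \<Delta> "Suc n"]
    by (intro sum_spins_prod finite_tree_sphere finite_children disjoint_children step_at_cong) auto
  finally show ?thesis
    by (simp add: ball_weight_def tree_ball_Suc[of \<Delta> "Suc n", symmetric])
qed

lemma sum_ball_weight:
  assumes \<eta>: "\<eta> \<in> spins (tree_ball \<Delta> (Suc n))"
  shows "sum (ball_weight (n + k) m) (cyl (tree_ball \<Delta> (Suc (n + k))) (tree_ball \<Delta> (Suc n)) \<eta>)
    = ball_weight n ((step ^^ k) m) \<eta>"
proof (induction k arbitrary: m)
  case 0
  have "cyl (tree_ball \<Delta> (Suc n)) (tree_ball \<Delta> (Suc n)) \<eta> = {\<eta>}"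
    using \<eta> by (auto simp: cyl_def)
  then show ?case by simp
next
  case (Suc k)
  let ?b = "\<lambda>j. tree_ball \<Delta> (Suc (n + j))"
  have "sum (ball_weight (n + Suc k) m) (cyl (?b (Suc k)) (?b 0) \<eta>)
     = (\<Sum>\<zeta>\<in>cyl (?b k) (?b 0) \<eta>. sum (ball_weight (n + Suc k) m) (cyl (?b (Suc k)) (?b k) \<zeta>))"
    by (rule sum_cyl_refine) (auto intro!: tree_ball_mono finite_tree_ball simp del: subsetI)
  also have "\<dots> = sum (ball_weight (n + k) (step m)) (cyl (?b k) (?b 0) \<eta>)"
    using sum_ball_weight_Suc[of _ "n + k" m] by (intro sum.cong) (auto simp: cyl_def)
  also have "\<dots> = ball_weight n ((step ^^ k) (step m)) \<eta>"
    using Suc.IH[of "step m"] by simp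
  finally show ?case by (simp add: funpow_swap1)
qed

end

subsection \<open>Gibbs measures from marginals on balls\<close>

lemma space_outside_algebra: "space (outside_algebra \<Delta> \<Lambda>) = spins (tree_nodes \<Delta>)"
  by (simp add: outside_algebra_def config_space_def space_PiM_spins)

lemma restrict_outside_measurable:
  "(\<lambda>\<omega>. restrict \<omega> (tree_nodes \<Delta> - \<Lambda>)) \<in> measurable (config_space (tree_nodes \<Delta>)) (config_space (tree_nodes \<Delta> - \<Lambda>))"
  unfolding config_space_def by (rule measurable_restrict_subset) auto

lemma sets_outside_algebra:
  "sets (outside_algebra \<Delta> \<Lambda>) =
    {(\<lambda>\<omega>. restrict \<omega> (tree_nodes \<Delta> - \<Lambda>)) -` A \<inter> spins (tree_nodes \<Delta>) | A. A \<in> sets (config_space (tree_nodes \<Delta> - \<Lambda>))}"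
  unfolding outside_algebra_def
  using measurable_space[OF restrict_outside_measurable[of \<Delta> \<Lambda>]]
  by (subst sets_vimage_algebra2) (auto simp: config_space_def space_PiM_spins)

lemma subalgebra_outside_algebra:
  assumes "sets \<mu> = sets (config_space (tree_nodes \<Delta>))"
  shows "subalgebra \<mu> (outside_algebra \<Delta> \<Lambda>)"
proof -
  have sp: "space \<mu> = space (config_space (tree_nodes \<Delta>))"
    using assms by (rule sets_eq_imp_space_eq)
  have "(\<lambda>\<omega>. restrict \<omega> (tree_nodes \<Delta> - \<Lambda>)) \<in> measurable \<mu> (config_space (tree_nodes \<Delta> - \<Lambda>))"
    using restrict_outside_measurable[of \<Delta> \<Lambda>] by (simp add: measurable_cong_sets[OF assms])
  then show ?thesis
    unfolding subalgebra_def outside_algebra_def using sp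
    by (simp add: sets_image_in_sets)
qed

lemma cyl_outside_algebra:
  assumes "finite C" "C \<subseteq> tree_nodes \<Delta> - \<Lambda>"
  shows "cyl (tree_nodes \<Delta>) C \<zeta> \<in> sets (outside_algebra \<Delta> \<Lambda>)"
proof -
  let ?X = "tree_nodes \<Delta> - \<Lambda>"
  have "restrict (restrict \<omega> ?X) C = restrict \<omega> C" for \<omega> :: "nat list \<Rightarrow> nat"
    using assms(2) by (simp add: Int_absorb1)
  moreover have "restrict \<omega> ?X \<in> spins ?X" if "\<omega> \<in> spins (tree_nodes \<Delta>)" for \<omega>
    using that by (rule restrict_spins) auto
  ultimately have "cyl (tree_nodes \<Delta>) C \<zeta> = (\<lambda>\<omega>. restrict \<omega> ?X) -` cyl ?X C \<zeta> \<inter> spins (tree_nodes \<Delta>)"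
    unfolding cyl_def by (intro set_eqI) (simp only: Int_iff mem_Collect_eq vimage_eq, metis)
  moreover have "cyl ?X C \<zeta> \<in> sets (config_space ?X)"
    unfolding config_space_def using assms by (rule sets_cyl)
  ultimately show ?thesis unfolding sets_outside_algebra by blast
qed

text \<open>A function of finitely many outside spins is constant on each of finitely many
  cylinders, so every preimage is a finite union of cylinders.\<close>

lemma measurable_outside_algebra:
  fixes f :: "(nat list \<Rightarrow> nat) \<Rightarrow> real"
  assumes C: "finite C" "C \<subseteq> tree_nodes \<Delta> - \<Lambda>"
    and f: "\<And>\<omega> \<omega>'. \<omega> \<in> spins (tree_nodes \<Delta>) \<Longrightarrow> \<omega>' \<in> spins (tree_nodes \<Delta>) \<Longrightarrow>
      restrict \<omega> C = restrict \<omega>' C \<Longrightarrow> f \<omega> = f \<omega>'"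
  shows "f \<in> borel_measurable (outside_algebra \<Delta> \<Lambda>)"
proof (rule measurableI)
  fix S :: "real set"
  let ?Y = "f -` S \<inter> spins (tree_nodes \<Delta>)"
  have eq: "?Y = (\<Union>\<zeta>\<in>(\<lambda>\<omega>. restrict \<omega> C) ` ?Y. cyl (tree_nodes \<Delta>) C \<zeta>)"
    using f by (auto simp: cyl_def)
  have "finite ((\<lambda>\<omega>. restrict \<omega> C) ` ?Y)"
  proof (rule finite_subset[OF _ finite_spins[OF C(1)]])
    show "(\<lambda>\<omega>. restrict \<omega> C) ` ?Y \<subseteq> spins C"
    proof (rule image_subsetI)
      fix \<omega> assume "\<omega> \<in> ?Y"
      then show "restrict \<omega> C \<in> spins C"
        using C(2) by (intro restrict_spins[of \<omega> "tree_nodes \<Delta>"]) auto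
    qed
  qed
  then have "(\<Union>\<zeta>\<in>(\<lambda>\<omega>. restrict \<omega> C) ` ?Y. cyl (tree_nodes \<Delta>) C \<zeta>) \<in> sets (outside_algebra \<Delta> \<Lambda>)"
    by (intro sets.finite_UN cyl_outside_algebra[OF C])
  then show "f -` S \<inter> space (outside_algebra \<Delta> \<Lambda>) \<in> sets (outside_algebra \<Delta> \<Lambda>)"
    unfolding space_outside_algebra using eq by (rule ssubst[rotated])
qed auto

section \<open>Finite-volume kernels, and a criterion for being a Gibbs measure\<close>

context tree_model
begin

definition gibbs_kernel :: "nat list set \<Rightarrow> (nat list \<Rightarrow> nat) \<Rightarrow> (nat list \<Rightarrow> nat) \<Rightarrow> real" where
  "gibbs_kernel \<Lambda> \<eta> \<omega> =
     gibbs_weight \<Delta> lam \<theta> \<Lambda> \<omega> \<eta> / (\<Sum>\<eta>'\<in>spins \<Lambda>. gibbs_weight \<Delta> lam \<theta> \<Lambda> \<omega> \<eta>')"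

lemma gibbs_weight_nonneg: "gibbs_weight \<Delta> lam \<theta> \<Lambda> \<omega> \<eta> \<ge> 0"
  by (simp add: gibbs_weight_def boltzmann_def)

lemma gibbs_kernel_nonneg: "gibbs_kernel \<Lambda> \<eta> \<omega> \<ge> 0"
  by (simp add: gibbs_kernel_def gibbs_weight_nonneg sum_nonneg)

lemma gibbs_kernel_le_1:
  assumes "finite \<Lambda>" "\<eta> \<in> spins \<Lambda>"
  shows "gibbs_kernel \<Lambda> \<eta> \<omega> \<le> 1"
proof -
  have "gibbs_weight \<Delta> lam \<theta> \<Lambda> \<omega> \<eta> \<le> (\<Sum>\<eta>'\<in>spins \<Lambda>. gibbs_weight \<Delta> lam \<theta> \<Lambda> \<omega> \<eta>')"
    using assms gibbs_weight_nonneg finite_spins by (intro member_le_sum) auto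
  then show ?thesis
    unfolding gibbs_kernel_def using gibbs_weight_nonneg[of \<Lambda> \<omega> \<eta>]
    by (auto simp: divide_le_eq_1)
qed

text \<open>Nodes interacting with \<Lambda> lie within radius \<open>n + 1\<close>, and their
  neighbours within radius \<open>n + 2\<close>.\<close>

lemma gibbs_weight_local:
  assumes \<Lambda>: "\<Lambda> \<subseteq> tree_ball \<Delta> n" and \<eta>: "\<eta> \<in> spins \<Lambda>"
    and \<omega>: "\<omega> \<in> spins (tree_nodes \<Delta>)" "\<omega>' \<in> spins (tree_nodes \<Delta>)"
    and eq: "restrict \<omega> (tree_ball \<Delta> (Suc (Suc n)) - \<Lambda>) = restrict \<omega>' (tree_ball \<Delta> (Suc (Suc n)) - \<Lambda>)"
  shows "gibbs_weight \<Delta> lam \<theta> \<Lambda> \<omega> \<eta> = gibbs_weight \<Delta> lam \<theta> \<Lambda> \<omega>' \<eta>"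
proof -
  have fin: "finite \<Lambda>" "\<Lambda> \<subseteq> tree_nodes \<Delta>"
    using \<Lambda> finite_tree_ball tree_ball_subset finite_subset by blast+
  have "\<omega> j = \<omega>' j" if "j \<in> tree_ball \<Delta> (Suc (Suc n)) - \<Lambda>" for j
    using fun_cong[OF eq, of j] that by simp
  moreover have "insert i (tree_nbrs \<Delta> i) \<subseteq> tree_ball \<Delta> (Suc (Suc n))" if "i \<in> nbhd \<Delta> \<Lambda>" for i
    using tree_nbrs_ball nbhd_subset_tree_ball[OF \<Lambda>] that by blast
  ultimately show ?thesis
    unfolding gibbs_weight_eq[OF fin \<omega>(1) \<eta>] gibbs_weight_eq[OF fin \<omega>(2) \<eta>]
    by (intro prod.cong refl site_weight_cong) (auto simp: merge_def)
qed

lemma gibbs_kernel_measurable: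
  assumes "finite \<Lambda>" "\<Lambda> \<subseteq> tree_nodes \<Delta>" "\<eta> \<in> spins \<Lambda>"
  shows "gibbs_kernel \<Lambda> \<eta> \<in> borel_measurable (outside_algebra \<Delta> \<Lambda>)"
proof -
  obtain n where n: "\<Lambda> \<subseteq> tree_ball \<Delta> n"
    using exhaust_finite[OF assms(1) _ incseq_tree_ball] assms(2) UN_tree_ball by metis
  show ?thesis
  proof (rule measurable_outside_algebra)
    show "finite (tree_ball \<Delta> (Suc (Suc n)) - \<Lambda>)" by (simp add: finite_tree_ball)
    show "tree_ball \<Delta> (Suc (Suc n)) - \<Lambda> \<subseteq> tree_nodes \<Delta> - \<Lambda>"
      using tree_ball_subset by auto
    fix \<omega> \<omega>' assume *: "\<omega> \<in> spins (tree_nodes \<Delta>)" "\<omega>' \<in> spins (tree_nodes \<Delta>)"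
      "restrict \<omega> (tree_ball \<Delta> (Suc (Suc n)) - \<Lambda>) = restrict \<omega>' (tree_ball \<Delta> (Suc (Suc n)) - \<Lambda>)"
    have "gibbs_weight \<Delta> lam \<theta> \<Lambda> \<omega> \<eta>' = gibbs_weight \<Delta> lam \<theta> \<Lambda> \<omega>' \<eta>'" if "\<eta>' \<in> spins \<Lambda>" for \<eta>'
      by (rule gibbs_weight_local[OF n that *])
    then show "gibbs_kernel \<Lambda> \<eta> \<omega> = gibbs_kernel \<Lambda> \<eta> \<omega>'"
      unfolding gibbs_kernel_def using assms(3) by (metis (no_types, lifting) sum.cong)
  qed
qed

lemma gibbs_measure_alt:
  "gibbs_measure \<Delta> lam \<theta> \<mu> \<longleftrightarrow>
     prob_space \<mu> \<and> sets \<mu> = sets (config_space (tree_nodes \<Delta>)) \<and>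
     (\<forall>\<Lambda>. finite \<Lambda> \<and> \<Lambda> \<subseteq> tree_nodes \<Delta> \<longrightarrow>
        (\<forall>\<eta> \<in> spins \<Lambda>. AE \<omega> in \<mu>.
           real_cond_exp \<mu> (outside_algebra \<Delta> \<Lambda>) (indicator (cyl (tree_nodes \<Delta>) \<Lambda> \<eta>)) \<omega> = gibbs_kernel \<Lambda> \<eta> \<omega>))"
proof -
  have "{\<omega>' \<in> space \<mu>. restrict \<omega>' \<Lambda> = \<eta>} = cyl (tree_nodes \<Delta>) \<Lambda> \<eta>"
    if "sets \<mu> = sets (config_space (tree_nodes \<Delta>))" for \<Lambda> \<eta>
    using sets_eq_imp_space_eq[OF that] by (simp add: cyl_def config_space_def space_PiM_spins)
  then show ?thesis
    unfolding gibbs_measure_def gibbs_kernel_def by (auto simp only:)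
qed

text \<open>Both sides vanish if the normalising sum does, because then every weight is 0.\<close>

lemma gibbs_kernel_cyl:
  assumes \<Lambda>: "\<Lambda> \<subseteq> tree_ball \<Delta> n0" and n: "n \<ge> Suc n0"
    and \<eta>: "\<eta> \<in> spins \<Lambda>"
    and \<omega>: "\<omega> \<in> spins (tree_nodes \<Delta>)"
  defines "C \<equiv> tree_ball \<Delta> (Suc n) - \<Lambda>"
  shows "ball_weight n m (merge \<Lambda> C (\<eta>, \<omega>)) =
     gibbs_kernel \<Lambda> \<eta> \<omega> * (\<Sum>\<eta>'\<in>spins \<Lambda>. ball_weight n m (merge \<Lambda> C (\<eta>', \<omega>)))"
proof -
  have fin: "finite \<Lambda>" "\<Lambda> \<subseteq> tree_nodes \<Delta>"
    using \<Lambda> finite_tree_ball tree_ball_subset finite_subset by blast+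
  have nb: "nbhd \<Delta> \<Lambda> \<subseteq> tree_ball \<Delta> n"
    using nbhd_subset_tree_ball[OF \<Lambda>] tree_ball_mono[OF n] by blast
  \<comment> \<open>All factors that do not see the spins in \<Lambda>. The condition
    \<open>n \<ge> Suc n0\<close> puts the nodes interacting with \<Lambda> inside the ball of
    radius \<open>n\<close> and keeps the outer sphere, and the parents of its nodes, away from
    \<Lambda>.\<close>
  define R where "R = (\<Prod>i\<in>tree_ball \<Delta> n - nbhd \<Delta> \<Lambda>. site_weight i \<omega>) *
     (\<Prod>i\<in>tree_sphere \<Delta> (Suc n). m i (\<omega> i) (\<omega> (tl i)))"
  have W: "ball_weight n m (merge \<Lambda> C (\<eta>', \<omega>)) = gibbs_weight \<Delta> lam \<theta> \<Lambda> \<omega> \<eta>' * R"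
    if \<eta>': "\<eta>' \<in> spins \<Lambda>" for \<eta>'
  proof -
    let ?\<omega> = "merge \<Lambda> (tree_nodes \<Delta> - \<Lambda>) (\<eta>', \<omega>)"
    have "ball_weight n m (merge \<Lambda> C (\<eta>', \<omega>)) = ball_weight n m ?\<omega>"
      using tree_ball_subset[of \<Delta> "Suc n"] tree_sphere_subset_ball[of \<Delta> "Suc n"] tl_tree_nodes
      by (intro ball_weight_cong) (auto simp: merge_def C_def tree_ball_def tree_sphere_def)
    also have "\<dots> = (\<Prod>i\<in>nbhd \<Delta> \<Lambda>. site_weight i ?\<omega>) * (\<Prod>i\<in>tree_ball \<Delta> n - nbhd \<Delta> \<Lambda>. site_weight i ?\<omega>) *
        (\<Prod>i\<in>tree_sphere \<Delta> (Suc n). m i (?\<omega> i) (?\<omega> (tl i)))"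
      unfolding ball_weight_def by (simp add: prod.subset_diff[OF nb finite_tree_ball] mult.commute)
    also have "(\<Prod>i\<in>tree_ball \<Delta> n - nbhd \<Delta> \<Lambda>. site_weight i ?\<omega>) = (\<Prod>i\<in>tree_ball \<Delta> n - nbhd \<Delta> \<Lambda>. site_weight i \<omega>)"
      by (intro prod.cong refl site_weight_cong)
        (auto simp: merge_def nbhd_def tree_ball_def tree_nbrs_def)
    also have "(\<Prod>i\<in>tree_sphere \<Delta> (Suc n). m i (?\<omega> i) (?\<omega> (tl i))) = (\<Prod>i\<in>tree_sphere \<Delta> (Suc n). m i (\<omega> i) (\<omega> (tl i)))"
    proof (intro prod.cong refl)
      fix i assume i: "i \<in> tree_sphere \<Delta> (Suc n)"
      have "i \<in> tree_nodes \<Delta> - \<Lambda>" "tl i \<in> tree_nodes \<Delta> - \<Lambda>"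
        using i \<Lambda> n tl_tree_nodes[of i \<Delta>] by (auto simp: tree_ball_def tree_sphere_def)
      then show "m i (?\<omega> i) (?\<omega> (tl i)) = m i (\<omega> i) (\<omega> (tl i))"
        by (simp add: merge_def)
    qed
    finally show ?thesis
      by (simp add: R_def gibbs_weight_eq[OF fin \<omega> \<eta>'])
  qed
  let ?Z = "\<Sum>\<eta>'\<in>spins \<Lambda>. gibbs_weight \<Delta> lam \<theta> \<Lambda> \<omega> \<eta>'"
  have sum: "(\<Sum>\<eta>'\<in>spins \<Lambda>. ball_weight n m (merge \<Lambda> C (\<eta>', \<omega>))) = ?Z * R"
    by (simp add: W sum_distrib_right)
  show ?thesis
  proof (cases "?Z = 0")
    case True
    then have "gibbs_weight \<Delta> lam \<theta> \<Lambda> \<omega> \<eta> = 0"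
      using \<eta> finite_spins[OF fin(1)] gibbs_weight_nonneg
      by (subst (asm) sum_nonneg_eq_0_iff) auto
    then show ?thesis unfolding sum W[OF \<eta>] by (simp add: True)
  next
    case False
    then show ?thesis unfolding sum W[OF \<eta>] gibbs_kernel_def by simp
  qed
qed

text \<open>The characterisation of the conditional probability is an equality of two measures on
  the spins outside \<Lambda>. On a cylinder over a large ball minus \<Lambda> the kernel is
  constant, and its value is the proportion of ball weights by \<open>gibbs_kernel_cyl\<close>; the
  normalisation \<kappa> cancels there. Such cylinders determine the measures.\<close>

lemma gibbs_measure_of_marginals:
  assumes prob: "prob_space \<mu>" and sets: "sets \<mu> = sets (config_space (tree_nodes \<Delta>))"
    and marg: "\<And>n \<eta>. \<eta> \<in> spins (tree_ball \<Delta> (Suc n)) \<Longrightarrow>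
      measure \<mu> (cyl (tree_nodes \<Delta>) (tree_ball \<Delta> (Suc n)) \<eta>) = \<kappa> n * ball_weight n m \<eta>"
  shows "gibbs_measure \<Delta> lam \<theta> \<mu>"
  unfolding gibbs_measure_alt
proof (intro conjI prob sets allI impI ballI)
  fix \<Lambda> \<eta> assume "finite \<Lambda> \<and> \<Lambda> \<subseteq> tree_nodes \<Delta>" and \<eta>: "\<eta> \<in> spins \<Lambda>"
  then have fin: "finite \<Lambda>" "\<Lambda> \<subseteq> tree_nodes \<Delta>" by auto
  obtain n0 where n0: "\<Lambda> \<subseteq> tree_ball \<Delta> n0"
    using exhaust_finite[OF fin(1) _ incseq_tree_ball] fin(2) UN_tree_ball by metis
  interpret prob_space \<mu> by (rule prob)
  let ?V = "tree_nodes \<Delta>" and ?X = "tree_nodes \<Delta> - \<Lambda>" and ?F = "outside_algebra \<Delta> \<Lambda>"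
  let ?E = "cyl ?V \<Lambda> \<eta>" and ?\<gamma> = "gibbs_kernel \<Lambda> \<eta>" and ?r = "\<lambda>\<omega>::nat list \<Rightarrow> nat. restrict \<omega> (tree_nodes \<Delta> - \<Lambda>)"
  have sp: "space \<mu> = spins ?V"
    using sets_eq_imp_space_eq[OF sets] by (simp add: config_space_def space_PiM_spins)
  have sub: "subalgebra \<mu> ?F" by (rule subalgebra_outside_algebra[OF sets])
  have sub': "finite_measure_subalgebra \<mu> ?F" using sub by unfold_locales
  interpret F: finite_measure_subalgebra \<mu> ?F by (rule sub')
  have cylm: "cyl ?V A \<zeta> \<in> sets \<mu>" if "finite A" "A \<subseteq> ?V" for A \<zeta>
    using sets_cyl[OF that] sets by (simp add: config_space_def)
  have E[measurable]: "?E \<in> sets \<mu>" by (rule cylm[OF fin])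
  have \<gamma>F: "?\<gamma> \<in> borel_measurable ?F" by (rule gibbs_kernel_measurable[OF fin \<eta>])
  have \<gamma>[measurable]: "?\<gamma> \<in> borel_measurable \<mu>" by (rule measurable_from_subalg[OF sub \<gamma>F])
  have r[measurable]: "?r \<in> measurable \<mu> (config_space ?X)"
    using restrict_outside_measurable[of \<Delta> \<Lambda>] by (simp add: measurable_cong_sets[OF sets])
  \<comment> \<open>Both measures live on the outside spins: the first restricts \<mu> to the event
    \<open>?E\<close>, the second weights \<mu> by the kernel.\<close>
  define \<nu>1 where "\<nu>1 = distr (density \<mu> (indicator ?E)) (config_space ?X) ?r"
  define \<nu>2 where "\<nu>2 = distr (density \<mu> (\<lambda>\<omega>. ennreal (?\<gamma> \<omega>))) (config_space ?X) ?r"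
  have em1: "emeasure \<nu>1 A = (\<integral>\<^sup>+\<omega>. indicator ?E \<omega> * indicator (?r -` A \<inter> spins ?V) \<omega> \<partial>\<mu>)"
    if "A \<in> sets (config_space ?X)" for A
    using that measurable_sets[OF r that] unfolding \<nu>1_def
    by (subst emeasure_distr) (auto simp: emeasure_density sp)
  have em2: "emeasure \<nu>2 A = (\<integral>\<^sup>+\<omega>. ennreal (?\<gamma> \<omega>) * indicator (?r -` A \<inter> spins ?V) \<omega> \<partial>\<mu>)"
    if "A \<in> sets (config_space ?X)" for A
    using that measurable_sets[OF r that] unfolding \<nu>2_def
    by (subst emeasure_distr) (auto simp: emeasure_density sp)
  have "\<nu>1 = \<nu>2"
  proof (rule measure_eqI_cyl[where C="\<lambda>n. tree_ball \<Delta> (Suc n) - \<Lambda>" and V="?X" and N="Suc n0"])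
    show "finite_measure \<nu>1"
    proof (rule finite_measureI)
      have "emeasure \<nu>1 (space \<nu>1) \<le> (\<integral>\<^sup>+\<omega>. 1 \<partial>\<mu>)"
        unfolding \<nu>1_def[THEN arg_cong[where f=space]] space_distr em1[OF sets.top]
        by (rule nn_integral_mono) (auto split: split_indicator)
      then show "emeasure \<nu>1 (space \<nu>1) \<noteq> \<infinity>"
        by (auto simp: emeasure_space_1 top_unique)
    qed
    show "incseq (\<lambda>n. tree_ball \<Delta> (Suc n) - \<Lambda>)"
      by (auto simp: incseq_def tree_ball_def)
    show "?X = (\<Union>n. tree_ball \<Delta> (Suc n) - \<Lambda>)"
      using UN_tree_ball_Suc[of \<Delta>] by auto
  next
    fix n \<zeta> assume n: "n \<ge> Suc n0"
    let ?C = "tree_ball \<Delta> (Suc n) - \<Lambda>"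
    assume \<zeta>: "\<zeta> \<in> spins ?C"
    have C: "finite ?C" "?C \<subseteq> ?X" "?C \<subseteq> ?V"
      using finite_tree_ball tree_ball_subset[of \<Delta> "Suc n"] by auto
    have B: "\<Lambda> \<union> ?C = tree_ball \<Delta> (Suc n)"
      using n0 n tree_ball_mono[of n0 "Suc n" \<Delta>] by auto
    have cylX: "cyl ?X ?C \<zeta> \<in> sets (config_space ?X)"
      unfolding config_space_def by (rule sets_cyl[OF C(1,2)])
    have "restrict (?r \<omega>) ?C = restrict \<omega> ?C" for \<omega>
      using C(2) by (simp add: Int_absorb1)
    moreover have "?r \<omega> \<in> spins ?X" if "\<omega> \<in> spins ?V" for \<omega>
      using that by (rule restrict_spins) auto
    ultimately have pre: "?r -` cyl ?X ?C \<zeta> \<inter> spins ?V = cyl ?V ?C \<zeta>"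
      unfolding cyl_def by (intro set_eqI) (simp only: Int_iff mem_Collect_eq vimage_eq, metis)
    have joint: "cyl ?V \<Lambda> \<eta>' \<inter> cyl ?V ?C \<zeta> = cyl ?V (\<Lambda> \<union> ?C) (merge \<Lambda> ?C (\<eta>', \<zeta>))"
      if "\<eta>' \<in> spins \<Lambda>" for \<eta>'
      using that \<zeta> unfolding cyl_def
      by (auto simp: fun_eq_iff merge_def PiE_iff extensional_def restrict_def)
    have marg': "measure \<mu> (cyl ?V \<Lambda> \<eta>' \<inter> cyl ?V ?C \<zeta>) = \<kappa> n * ball_weight n m (merge \<Lambda> ?C (\<eta>', \<zeta>))"
      if "\<eta>' \<in> spins \<Lambda>" for \<eta>'
    proof -
      have "merge \<Lambda> ?C (\<eta>', \<zeta>) \<in> spins (\<Lambda> \<union> ?C)"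
        using that \<zeta> by (auto simp: PiE_iff merge_def extensional_def)
      then show ?thesis
        unfolding joint[OF that] B by (rule marg)
    qed
    \<comment> \<open>The kernel takes full configurations. This is an arbitrary completion of
      \<zeta>; on the cylinder of \<zeta> the kernel has the same value everywhere.\<close>
    define \<omega>0 where "\<omega>0 = merge ?C (?V - ?C) (\<zeta>, \<lambda>_. 0)"
    have \<omega>0: "\<omega>0 \<in> cyl ?V ?C \<zeta>"
      using \<zeta> C(3) by (auto simp: \<omega>0_def cyl_def PiE_iff merge_def extensional_def fun_eq_iff)
    have mrg: "merge \<Lambda> ?C (\<eta>', \<omega>0) = merge \<Lambda> ?C (\<eta>', \<zeta>)" for \<eta>'
      by (auto simp: merge_def \<omega>0_def)
    have \<gamma>0: "?\<gamma> \<omega> = ?\<gamma> \<omega>0" if "\<omega> \<in> cyl ?V ?C \<zeta>" for \<omega>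
    proof -
      have sub: "tree_ball \<Delta> (Suc (Suc n0)) - \<Lambda> \<subseteq> ?C"
        using tree_ball_mono[of "Suc (Suc n0)" "Suc n" \<Delta>] n by auto
      have "restrict \<omega> ?C = restrict \<omega>0 ?C" using that \<omega>0 by (simp add: cyl_def)
      then have "restrict (restrict \<omega> ?C) (tree_ball \<Delta> (Suc (Suc n0)) - \<Lambda>) = restrict (restrict \<omega>0 ?C) (tree_ball \<Delta> (Suc (Suc n0)) - \<Lambda>)"
        by (rule arg_cong)
      then have "restrict \<omega> (tree_ball \<Delta> (Suc (Suc n0)) - \<Lambda>) = restrict \<omega>0 (tree_ball \<Delta> (Suc (Suc n0)) - \<Lambda>)"
        using sub by (simp add: Int_absorb1)
      then have "gibbs_weight \<Delta> lam \<theta> \<Lambda> \<omega> \<eta>' = gibbs_weight \<Delta> lam \<theta> \<Lambda> \<omega>0 \<eta>'" if "\<eta>' \<in> spins \<Lambda>" for \<eta>'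
        using that \<omega>0 \<open>\<omega> \<in> cyl ?V ?C \<zeta>\<close> by (intro gibbs_weight_local[OF n0]) (auto simp: cyl_def)
      then show ?thesis using \<eta> by (simp add: gibbs_kernel_def)
    qed
    have mC: "measure \<mu> (cyl ?V ?C \<zeta>) = (\<Sum>\<eta>'\<in>spins \<Lambda>. measure \<mu> (cyl ?V \<Lambda> \<eta>' \<inter> cyl ?V ?C \<zeta>))"
    proof -
      have "cyl ?V ?C \<zeta> = (\<Union>\<eta>'\<in>spins \<Lambda>. cyl ?V \<Lambda> \<eta>' \<inter> cyl ?V ?C \<zeta>)"
        using restrict_spins[OF _ fin(2)] unfolding cyl_def by blast
      then have "measure \<mu> (cyl ?V ?C \<zeta>) = measure \<mu> (\<Union>\<eta>'\<in>spins \<Lambda>. cyl ?V \<Lambda> \<eta>' \<inter> cyl ?V ?C \<zeta>)"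
        by (rule arg_cong)
      also have "\<dots> = (\<Sum>\<eta>'\<in>spins \<Lambda>. measure \<mu> (cyl ?V \<Lambda> \<eta>' \<inter> cyl ?V ?C \<zeta>))"
        by (rule finite_measure_finite_Union[OF finite_spins[OF fin(1)]])
          (use cylm[OF fin] cylm[OF C(1,3)] cyl_disjoint[of _ _ ?V \<Lambda>] in \<open>auto simp: disjoint_family_on_def, blast\<close>)
      finally show ?thesis .
    qed
    have "measure \<mu> (?E \<inter> cyl ?V ?C \<zeta>) = ?\<gamma> \<omega>0 * measure \<mu> (cyl ?V ?C \<zeta>)"
    proof -
      have "\<omega>0 \<in> spins ?V" using \<omega>0 by (simp add: cyl_def)
      from gibbs_kernel_cyl[OF n0 n \<eta> this, of m] show ?thesis
        using \<eta> by (simp add: mC marg' mrg sum_distrib_left[symmetric])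
    qed
    moreover have "emeasure \<nu>1 (cyl ?X ?C \<zeta>) = emeasure \<mu> (?E \<inter> cyl ?V ?C \<zeta>)"
      unfolding em1[OF cylX] pre using cylm[OF C(1,3)]
      by (simp add: indicator_inter_arith[symmetric])
    moreover have "emeasure \<nu>2 (cyl ?X ?C \<zeta>) = ennreal (?\<gamma> \<omega>0) * emeasure \<mu> (cyl ?V ?C \<zeta>)"
    proof -
      have "emeasure \<nu>2 (cyl ?X ?C \<zeta>) = (\<integral>\<^sup>+\<omega>. ennreal (?\<gamma> \<omega>0) * indicator (cyl ?V ?C \<zeta>) \<omega> \<partial>\<mu>)"
        unfolding em2[OF cylX] pre
        by (rule nn_integral_cong) (use \<gamma>0 in \<open>auto split: split_indicator\<close>)
      then show ?thesis using cylm[OF C(1,3)] by (simp add: nn_integral_cmult_indicator)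
    qed
    ultimately show "emeasure \<nu>1 (cyl ?X ?C \<zeta>) = emeasure \<nu>2 (cyl ?X ?C \<zeta>)"
      by (simp add: emeasure_eq_measure ennreal_mult gibbs_kernel_nonneg)
  qed (auto simp: \<nu>1_def \<nu>2_def config_space_def finite_tree_ball)
  note eq = this
  have \<gamma>_int: "integrable \<mu> ?\<gamma>"
    using gibbs_kernel_nonneg gibbs_kernel_le_1[OF fin(1) \<eta>]
    by (intro integrable_const_bound[where B=1]) auto
  show "AE \<omega> in \<mu>. real_cond_exp \<mu> ?F (indicator ?E) \<omega> = ?\<gamma> \<omega>"
  proof (rule F.real_cond_exp_charact)
    show "integrable \<mu> (indicator ?E :: _ \<Rightarrow> real)"
      by (simp add: emeasure_eq_measure)
    fix A assume A: "A \<in> sets ?F"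
    then obtain A' where A': "A = ?r -` A' \<inter> spins ?V" "A' \<in> sets (config_space ?X)"
      unfolding sets_outside_algebra by auto
    have [measurable]: "A \<in> sets \<mu>" using A sub by (auto simp: subalgebra_def)
    have "(\<integral>\<omega>\<in>A. indicator ?E \<omega> \<partial>\<mu>) = enn2real (\<integral>\<^sup>+\<omega>. ennreal (indicator A \<omega> *\<^sub>R indicator ?E \<omega>) \<partial>\<mu>)"
      unfolding set_lebesgue_integral_def by (rule integral_eq_nn_integral) auto
    also have "(\<integral>\<^sup>+\<omega>. ennreal (indicator A \<omega> *\<^sub>R indicator ?E \<omega>) \<partial>\<mu>) = emeasure \<nu>1 A'"
      unfolding em1[OF A'(2)] A'(1)[symmetric]
      by (rule nn_integral_cong) (auto split: split_indicator)
    also have "\<dots> = emeasure \<nu>2 A'" by (simp add: eq)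
    also have "\<dots> = (\<integral>\<^sup>+\<omega>. ennreal (indicator A \<omega> *\<^sub>R ?\<gamma> \<omega>) \<partial>\<mu>)"
      unfolding em2[OF A'(2)] A'(1)[symmetric]
      by (rule nn_integral_cong) (auto split: split_indicator)
    also have "enn2real \<dots> = (\<integral>\<omega>\<in>A. ?\<gamma> \<omega> \<partial>\<mu>)"
      unfolding set_lebesgue_integral_def
      by (rule integral_eq_nn_integral[symmetric]) (auto simp: gibbs_kernel_nonneg)
    finally show "(\<integral>\<omega>\<in>A. indicator ?E \<omega> \<partial>\<mu>) = (\<integral>\<omega>\<in>A. ?\<gamma> \<omega> \<partial>\<mu>)" .
  qed (auto simp: \<gamma>_int \<gamma>F)
qed

end

subsection \<open>Multi-affine polynomials of subsets\<close>

text \<open>\<open>S\<close> stands for the set of occupied children. With \<open>t\<close> equal to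
  \<theta> this is, up to scaling, the weight below an empty node whose parent is empty; shifting
  \<theta> by one accounts for an occupied parent.\<close>

definition subset_poly :: "(nat \<Rightarrow> real) \<Rightarrow> 'i set \<Rightarrow> ('i \<Rightarrow> real) \<Rightarrow> real" where
  "subset_poly t I a = (\<Sum>S\<in>Pow I. t (card S) * (\<Prod>k\<in>S. a k))"

lemma subset_poly_empty [simp]: "subset_poly t {} a = t 0"
  by (simp add: subset_poly_def)

text \<open>Split on whether \<open>x\<close> belongs to the subset. The polynomial is affine in
  each variable, and the slope is the same polynomial for the shifted coefficients.\<close>

lemma subset_poly_insert:
  assumes "finite I" "x \<notin> I"
  shows "subset_poly t (insert x I) a = subset_poly t I a + a x * subset_poly (\<lambda>j. t (Suc j)) I a"
proof -
  have "subset_poly t (insert x I) a = subset_poly t I a + (\<Sum>S\<in>insert x ` Pow I. t (card S) * (\<Prod>k\<in>S. a k))"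
    unfolding subset_poly_def Pow_insert using assms by (intro sum.union_disjoint) auto
  also have "(\<Sum>S\<in>insert x ` Pow I. t (card S) * (\<Prod>k\<in>S. a k))
      = (\<Sum>S\<in>Pow I. t (card (insert x S)) * (\<Prod>k\<in>insert x S. a k))"
    using assms by (intro sum.reindex_cong[of "insert x"]) (auto simp: inj_on_def)
  also have "\<dots> = (\<Sum>S\<in>Pow I. a x * (t (Suc (card S)) * (\<Prod>k\<in>S. a k)))"
  proof (rule sum.cong[OF refl])
    fix S assume "S \<in> Pow I"
    then have "finite S" "x \<notin> S" using assms finite_subset by auto
    then show "t (card (insert x S)) * (\<Prod>k\<in>insert x S. a k) = a x * (t (Suc (card S)) * (\<Prod>k\<in>S. a k))"
      by simp
  qed
  also have "\<dots> = a x * subset_poly (\<lambda>j. t (Suc j)) I a"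
    by (simp add: subset_poly_def sum_distrib_left)
  finally show ?thesis .
qed

lemma subset_poly_cong: "(\<And>k. k \<in> I \<Longrightarrow> a k = a' k) \<Longrightarrow> subset_poly t I a = subset_poly t I a'"
  unfolding subset_poly_def by (intro sum.cong refl arg_cong2[where f="(*)"] prod.cong) auto

lemma prod_subset_nonneg:
  assumes "\<And>k. k \<in> I \<Longrightarrow> a k \<ge> 0" "S \<in> Pow I"
  shows "(\<Prod>k\<in>S. a k) \<ge> (0::real)"
  using assms by (intro prod_nonneg) auto

lemma subset_poly_ge:
  assumes "finite I" "\<And>k. k \<in> I \<Longrightarrow> a k \<ge> 0" "\<And>k. k \<le> card I \<Longrightarrow> t k \<ge> 0"
  shows "t 0 \<le> subset_poly t I a"
proof -
  let ?f = "\<lambda>S. t (card S) * (\<Prod>k\<in>S. a k)"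
  have "?f S \<ge> 0" if "S \<in> Pow I" for S
    using that assms by (intro mult_nonneg_nonneg prod_nonneg) (auto intro: card_mono)
  then have "sum ?f {{}} \<le> sum ?f (Pow I)"
    using assms(1) by (intro sum_mono2) auto
  then show ?thesis by (simp add: subset_poly_def)
qed

lemma subset_poly_mult_le:
  assumes "finite I" "\<And>k. k \<in> I \<Longrightarrow> a k \<ge> 0" "\<And>k. k \<le> card I \<Longrightarrow> t k \<le> c * u k"
  shows "subset_poly t I a \<le> c * subset_poly u I a"
  unfolding subset_poly_def sum_distrib_left
proof (rule sum_mono)
  fix S assume S: "S \<in> Pow I"
  have "t (card S) * (\<Prod>k\<in>S. a k) \<le> (c * u (card S)) * (\<Prod>k\<in>S. a k)"
    using S assms by (intro mult_right_mono prod_subset_nonneg[where I=I]) (auto intro: card_mono)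
  then show "t (card S) * (\<Prod>k\<in>S. a k) \<le> c * (u (card S) * (\<Prod>k\<in>S. a k))" by simp
qed

lemma subset_poly_mult_ge:
  assumes "finite I" "\<And>k. k \<in> I \<Longrightarrow> a k \<ge> 0" "\<And>k. k \<le> card I \<Longrightarrow> c * u k \<le> t k"
  shows "c * subset_poly u I a \<le> subset_poly t I a"
  unfolding subset_poly_def sum_distrib_left
proof (rule sum_mono)
  fix S assume S: "S \<in> Pow I"
  have "(c * u (card S)) * (\<Prod>k\<in>S. a k) \<le> t (card S) * (\<Prod>k\<in>S. a k)"
    using S assms by (intro mult_right_mono prod_subset_nonneg[where I=I]) (auto intro: card_mono)
  then show "c * (u (card S) * (\<Prod>k\<in>S. a k)) \<le> t (card S) * (\<Prod>k\<in>S. a k)" by simp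
qed

lemma sum_spins_subset_poly:
  assumes "finite I"
  shows "(\<Sum>\<sigma>\<in>spins I. t (occ \<sigma> I) * (\<Prod>k\<in>I. if \<sigma> k = 1 then a k else 1)) = subset_poly t I a"
proof -
  have "bij_betw (\<lambda>S. \<lambda>k\<in>I. if k \<in> S then 1 else 0) (Pow I) (spins I)"
    by (rule bij_betwI[where g="\<lambda>\<sigma>. {k \<in> I. \<sigma> k = 1}"]) (auto simp: PiE_iff extensional_def fun_eq_iff)
  then have "(\<Sum>\<sigma>\<in>spins I. t (occ \<sigma> I) * (\<Prod>k\<in>I. if \<sigma> k = 1 then a k else 1)) =
      (\<Sum>S\<in>Pow I. t (occ (\<lambda>k\<in>I. if k \<in> S then 1 else 0) I) *
        (\<Prod>k\<in>I. if (\<lambda>k\<in>I. if k \<in> S then 1 else (0::nat)) k = 1 then a k else 1))"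
    by (rule sum.reindex_bij_betw[symmetric])
  also have "\<dots> = subset_poly t I a"
    unfolding subset_poly_def
  proof (rule sum.cong[OF refl])
    fix S assume S: "S \<in> Pow I"
    have "{j \<in> I. (\<lambda>k\<in>I. if k \<in> S then 1 else (0::nat)) j = 1} = S"
      using S by auto
    moreover have "(\<Prod>k\<in>I. if (\<lambda>k\<in>I. if k \<in> S then 1 else (0::nat)) k = 1 then a k else 1) = (\<Prod>k\<in>S. a k)"
      using S assms by (intro prod.mono_neutral_cong_right) auto
    ultimately show "t (occ (\<lambda>k\<in>I. if k \<in> S then 1 else 0) I) *
        (\<Prod>k\<in>I. if (\<lambda>k\<in>I. if k \<in> S then 1 else (0::nat)) k = 1 then a k else 1)
        = t (card S) * (\<Prod>k\<in>S. a k)"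
      by (simp add: occ_def)
  qed
  finally show ?thesis .
qed

text \<open>Telescoping: the coordinates of \<open>a\<close> are replaced by those of
  \<open>a'\<close> one at a time, and all intermediate points keep their coordinates in
  \<open>X\<close>.\<close>

lemma lipschitz_coordinatewise:
  fixes f :: "('i \<Rightarrow> real) \<Rightarrow> real"
  assumes "finite I"
    and lip: "\<And>k c x y. k \<in> I \<Longrightarrow> (\<And>i. i \<in> I \<Longrightarrow> c i \<in> X) \<Longrightarrow> x \<in> X \<Longrightarrow> y \<in> X \<Longrightarrow>
      \<bar>f (c(k := x)) - f (c(k := y))\<bar> \<le> L * \<bar>x - y\<bar>"
    and cong: "\<And>c c'. (\<And>i. i \<in> I \<Longrightarrow> c i = c' i) \<Longrightarrow> f c = f c'"
    and a: "\<And>i. i \<in> I \<Longrightarrow> a i \<in> X" and a': "\<And>i. i \<in> I \<Longrightarrow> a' i \<in> X"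
  shows "\<bar>f a - f a'\<bar> \<le> L * (\<Sum>k\<in>I. \<bar>a k - a' k\<bar>)"
proof -
  have "\<bar>f a - f (override_on a a' J)\<bar> \<le> L * (\<Sum>k\<in>J. \<bar>a k - a' k\<bar>)" if "J \<subseteq> I" for J
    using finite_subset[OF that \<open>finite I\<close>] that
  proof (induction J rule: finite_induct)
    case (insert k J)
    let ?c = "override_on a a' J"
    have 1: "?c(k := a k) = ?c" using insert.hyps by (auto simp: override_on_def)
    have 2: "?c(k := a' k) = override_on a a' (insert k J)" by (auto simp: override_on_def)
    have "\<bar>f (?c(k := a k)) - f (?c(k := a' k))\<bar> \<le> L * \<bar>a k - a' k\<bar>"
      using insert.prems a a' by (intro lip) (auto simp: override_on_def)
    then have "\<bar>f ?c - f (override_on a a' (insert k J))\<bar> \<le> L * \<bar>a k - a' k\<bar>"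
      unfolding 1 2 .
    moreover have "\<bar>f a - f ?c\<bar> \<le> L * (\<Sum>k\<in>J. \<bar>a k - a' k\<bar>)"
      using insert by auto
    ultimately show ?case
      using insert.hyps by (simp add: distrib_left)
  qed simp
  from this[of I] have "\<bar>f a - f (override_on a a' I)\<bar> \<le> L * (\<Sum>k\<in>I. \<bar>a k - a' k\<bar>)" by simp
  moreover have "f (override_on a a' I) = f a'" by (rule cong) simp
  ultimately show ?thesis by simp
qed

lemma subset_poly_fun_upd:
  assumes "finite I" "k \<in> I"
  shows "subset_poly t I (c(k := x)) = subset_poly t (I - {k}) c + x * subset_poly (\<lambda>j. t (Suc j)) (I - {k}) c"
proof -
  have "subset_poly t (insert k (I - {k})) (c(k := x)) =
      subset_poly t (I - {k}) (c(k := x)) + (c(k := x)) k * subset_poly (\<lambda>j. t (Suc j)) (I - {k}) (c(k := x))"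
    using assms by (intro subset_poly_insert) auto
  moreover have "subset_poly u (I - {k}) (c(k := x)) = subset_poly u (I - {k}) c" for u
    by (rule subset_poly_cong) auto
  ultimately show ?thesis using assms(2) by (simp add: insert_absorb)
qed

text \<open>The difference equals (x - y)(A C - B^2) over the product of the denominators. Both A C
  and B^2 lie between l^2 A^2 and r^2 A^2, so the near-cancellation of the two yields r^2 - l^2
  rather than r^2; the denominators are at least A.\<close>

lemma mobius_lipschitz:
  fixes A B C x y l r :: real
  assumes "A > 0" "0 \<le> x" "0 \<le> y" "0 \<le> l" "l * A \<le> B" "B \<le> r * A" "l * B \<le> C" "C \<le> r * B"
  shows "\<bar>(B + x * C) / (A + x * B) - (B + y * C) / (A + y * B)\<bar> \<le> (r\<^sup>2 - l\<^sup>2) * \<bar>x - y\<bar>"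
proof -
  have B: "B \<ge> 0" using assms by (meson mult_nonneg_nonneg less_imp_le order_trans)
  have r: "r \<ge> 0" using assms B by (smt (verit) mult_neg_pos)
  have den: "A \<le> A + x * B" "A \<le> A + y * B" using assms B by auto
  have "l\<^sup>2 * A\<^sup>2 \<le> B\<^sup>2"
    using power_mono[OF assms(5), of 2] assms by (simp add: power_mult_distrib)
  moreover have "B\<^sup>2 \<le> r\<^sup>2 * A\<^sup>2"
    using power_mono[OF assms(6) B, of 2] by (simp add: power_mult_distrib)
  moreover have "C * A \<le> r\<^sup>2 * A\<^sup>2"
  proof -
    have "C * A \<le> r * B * A" using assms by (intro mult_right_mono) auto
    also have "\<dots> \<le> r * (r * A) * A" using assms r by (intro mult_right_mono mult_left_mono) auto
    finally show ?thesis by (simp add: power2_eq_square mult_ac)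
  qed
  moreover have "l\<^sup>2 * A\<^sup>2 \<le> C * A"
  proof -
    have "l * (l * A) * A \<le> l * B * A" using assms by (intro mult_right_mono mult_left_mono) auto
    also have "\<dots> \<le> C * A" using assms by (intro mult_right_mono) auto
    finally show ?thesis by (simp add: power2_eq_square mult_ac)
  qed
  ultimately have num: "\<bar>C * A - B\<^sup>2\<bar> \<le> (r\<^sup>2 - l\<^sup>2) * A\<^sup>2"
    by (simp add: abs_le_iff left_diff_distrib)
  have "(B + x * C) / (A + x * B) - (B + y * C) / (A + y * B)
      = (x - y) * (C * A - B\<^sup>2) / ((A + x * B) * (A + y * B))"
    using den assms(1) by (simp add: field_simps power2_eq_square)
  then have "\<bar>(B + x * C) / (A + x * B) - (B + y * C) / (A + y * B)\<bar>
      = \<bar>x - y\<bar> * \<bar>C * A - B\<^sup>2\<bar> / ((A + x * B) * (A + y * B))"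
    using den assms(1) by (simp add: abs_mult)
  also have "\<dots> \<le> \<bar>x - y\<bar> * ((r\<^sup>2 - l\<^sup>2) * A\<^sup>2) / A\<^sup>2"
    unfolding power2_eq_square[of A]
    using den assms(1) num[unfolded power2_eq_square[of A]]
    by (intro frac_le mult_mono mult_left_mono) auto
  also have "\<dots> = (r\<^sup>2 - l\<^sup>2) * \<bar>x - y\<bar>" using assms(1) by simp
  finally show ?thesis .
qed

lemma inverse_affine_lipschitz:
  fixes A B x y r :: real
  assumes "A > 0" "0 \<le> x" "0 \<le> y" "0 \<le> B" "B \<le> r * A"
  shows "\<bar>1 / (A + x * B) - 1 / (A + y * B)\<bar> \<le> r / A * \<bar>x - y\<bar>"
proof -
  have den: "A \<le> A + x * B" "A \<le> A + y * B" using assms by auto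
  have "1 / (A + x * B) - 1 / (A + y * B) = (y - x) * B / ((A + x * B) * (A + y * B))"
    using den assms(1) by (simp add: field_simps)
  then have "\<bar>1 / (A + x * B) - 1 / (A + y * B)\<bar> = \<bar>x - y\<bar> * B / ((A + x * B) * (A + y * B))"
    using den assms by (simp add: abs_mult abs_minus_commute)
  also have "\<dots> \<le> \<bar>x - y\<bar> * (r * A) / (A * A)"
    using den assms by (intro frac_le mult_mono mult_left_mono) auto
  also have "\<dots> = r / A * \<bar>x - y\<bar>" using assms(1) by (simp add: field_simps)
  finally show ?thesis .
qed

text \<open>The value of \<open>subset_poly\<close> at \<open>d\<close> equal arguments, that is,
  the sum of the terms (d choose j) t_j a^j; the recursion adds one variable at a time.\<close>

primrec hpoly :: "nat \<Rightarrow> (nat \<Rightarrow> real) \<Rightarrow> real \<Rightarrow> real" where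
  "hpoly 0 t a = t 0"
| "hpoly (Suc d) t a = hpoly d t a + a * hpoly d (\<lambda>j. t (Suc j)) a"

lemma subset_poly_const: "finite I \<Longrightarrow> subset_poly t I (\<lambda>_. a) = hpoly (card I) t a"
proof (induction I arbitrary: t rule: finite_induct)
  case (insert x I)
  then show ?case by (simp add: subset_poly_insert)
qed simp

lemma continuous_on_hpoly [continuous_intros]:
  "continuous_on S f \<Longrightarrow> continuous_on S (\<lambda>x. hpoly d t (f x))"
  by (induction d arbitrary: t) (auto intro!: continuous_intros)

lemma hpoly_eq_subset_poly: "hpoly d t a = subset_poly t {..<d} (\<lambda>_. a)"
  using subset_poly_const[of "{..<d}" t a] by simp

text \<open>Each further variable multiplies the polynomial by at most 1 + r a, since the shifted
  polynomial is at most r times the unshifted one.\<close>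

lemma hpoly_le:
  assumes "a \<ge> 0" "r \<ge> 0" "\<And>k. k \<le> d \<Longrightarrow> t k \<ge> 0" "\<And>k. k < d \<Longrightarrow> t (Suc k) \<le> r * t k"
  shows "hpoly d t a \<le> t 0 * (1 + r * a) ^ d"
  using assms(3,4)
proof (induction d)
  case (Suc d)
  have "hpoly d (\<lambda>j. t (Suc j)) a \<le> r * hpoly d t a"
    unfolding hpoly_eq_subset_poly using assms(1) Suc.prems by (intro subset_poly_mult_le) auto
  then have "hpoly (Suc d) t a \<le> (1 + r * a) * hpoly d t a"
    using mult_left_mono[of "hpoly d (\<lambda>j. t (Suc j)) a" "r * hpoly d t a" a] assms(1)
    by (simp add: algebra_simps)
  also have "\<dots> \<le> (1 + r * a) * (t 0 * (1 + r * a) ^ d)"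
    using Suc assms(1,2) by (intro mult_left_mono) auto
  finally show ?case by (simp add: mult_ac)
qed simp

lemma hpoly_ge:
  assumes "a \<ge> 0" "l \<ge> 0" "\<And>k. k \<le> d \<Longrightarrow> t k \<ge> 0" "\<And>k. k < d \<Longrightarrow> l * t k \<le> t (Suc k)"
  shows "t 0 * (1 + l * a) ^ d \<le> hpoly d t a"
  using assms(3,4)
proof (induction d)
  case (Suc d)
  have "l * hpoly d t a \<le> hpoly d (\<lambda>j. t (Suc j)) a"
    unfolding hpoly_eq_subset_poly using assms(1) Suc.prems by (intro subset_poly_mult_ge) auto
  then have "(1 + l * a) * hpoly d t a \<le> hpoly (Suc d) t a"
    using mult_left_mono[of "l * hpoly d t a" "hpoly d (\<lambda>j. t (Suc j)) a" a] assms(1)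
    by (simp add: algebra_simps)
  moreover have "(1 + l * a) * (t 0 * (1 + l * a) ^ d) \<le> (1 + l * a) * hpoly d t a"
    using Suc assms(1,2) by (intro mult_left_mono) auto
  ultimately show ?case by (simp add: mult_ac)
qed simp

subsection \<open>Messages as pairs of ratios\<close>

text \<open>The representative of a message with value 1 at (0, 0). Its value at (1, 1) is 0 because
  a node and its parent cannot both be occupied.\<close>

definition msg :: "real \<Rightarrow> real \<Rightarrow> nat \<Rightarrow> nat \<Rightarrow> real" where
  "msg a b s p = (if s = 1 then (if p = 0 then a else 0) else if p = 0 then 1 else b)"

context tree_model
begin

text \<open>An occupied node forces all its children to be empty, and each of them then contributes
  its \<open>b\<close>; the denominator is the total for an empty node with empty parent.\<close>

definition next_a :: "(nat list \<Rightarrow> real) \<Rightarrow> (nat list \<Rightarrow> real) \<Rightarrow> nat list \<Rightarrow> real" where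
  "next_a a b i = lam * (\<Prod>k\<in>children \<Delta> i. b k) / subset_poly \<theta> (children \<Delta> i) a"

definition next_b :: "(nat list \<Rightarrow> real) \<Rightarrow> nat list \<Rightarrow> real" where
  "next_b a i = subset_poly (\<lambda>j. \<theta> (Suc j)) (children \<Delta> i) a / subset_poly \<theta> (children \<Delta> i) a"

lemma card_children_le: "i \<in> tree_nodes \<Delta> \<Longrightarrow> card (children \<Delta> i) \<le> \<Delta>"
  by (simp add: card_children)

lemma subset_poly_children_ge:
  assumes "i \<in> tree_nodes \<Delta>" "\<And>k. k \<in> children \<Delta> i \<Longrightarrow> a k \<ge> 0"
  shows "\<theta> 0 \<le> subset_poly \<theta> (children \<Delta> i) a"
  using card_children_le[OF assms(1)] \<theta>_pos assms(2)
  by (intro subset_poly_ge finite_children) (auto intro: less_imp_le)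

lemma subset_poly_children_pos:
  assumes "i \<in> tree_nodes \<Delta>" "\<And>k. k \<in> children \<Delta> i \<Longrightarrow> a k \<ge> 0"
  shows "0 < subset_poly \<theta> (children \<Delta> i) a"
  using subset_poly_children_ge[of i a] assms \<theta>_pos[of 0] by fastforce

text \<open>For spin 0 the sum over the children's spins is a \<open>subset_poly\<close>; for spin 1
  only the empty configuration of the children survives. The scaling factors of the children
  multiply, and nothing prevents them from being 0.\<close>

lemma step_msg:
  assumes i: "i \<in> tree_nodes \<Delta>"
    and a: "\<And>k. k \<in> children \<Delta> i \<Longrightarrow> a k \<ge> 0"
    and m: "\<And>k s p. k \<in> children \<Delta> i \<Longrightarrow> s \<in> {0, 1} \<Longrightarrow> p \<in> {0, 1} \<Longrightarrow> m k s p = \<kappa> k * msg (a k) (b k) s p"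
    and sp: "s \<in> {0, 1}" "p \<in> {0, 1}"
  shows "step m i s p = (\<Prod>k\<in>children \<Delta> i. \<kappa> k) * subset_poly \<theta> (children \<Delta> i) a * msg (next_a a b i) (next_b a i) s p"
proof -
  let ?C = "children \<Delta> i"
  have pos: "subset_poly \<theta> ?C a > 0" by (rule subset_poly_children_pos[OF i a])
  show ?thesis
  proof (cases "s = 0")
    case True
    have "step m i s p = (\<Sum>\<sigma>\<in>spins ?C. (\<Prod>k\<in>?C. \<kappa> k) * (\<theta> (p + occ \<sigma> ?C) * (\<Prod>k\<in>?C. if \<sigma> k = 1 then a k else 1)))"
      unfolding step_def
    proof (rule sum.cong[OF refl])
      fix \<sigma> assume \<sigma>: "\<sigma> \<in> spins ?C"
      have "(\<Prod>k\<in>?C. m k (\<sigma> k) 0) = (\<Prod>k\<in>?C. \<kappa> k * (if \<sigma> k = 1 then a k else 1))"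
      proof (rule prod.cong[OF refl])
        fix k assume k: "k \<in> ?C"
        then have "\<sigma> k \<in> {0, 1}" using \<sigma> by auto
        then show "m k (\<sigma> k) 0 = \<kappa> k * (if \<sigma> k = 1 then a k else 1)"
          using m[OF k, of "\<sigma> k" 0] by (simp add: msg_def)
      qed
      then show "step_at \<sigma> m i s p = (\<Prod>k\<in>?C. \<kappa> k) * (\<theta> (p + occ \<sigma> ?C) * (\<Prod>k\<in>?C. if \<sigma> k = 1 then a k else 1))"
        by (simp add: step_at_def True spin_weight_def prod.distrib)
    qed
    also have "\<dots> = (\<Prod>k\<in>?C. \<kappa> k) * subset_poly (\<lambda>j. \<theta> (p + j)) ?C a"
      using sum_spins_subset_poly[OF finite_children, of "\<lambda>j. \<theta> (p + j)" \<Delta> i a]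
      by (simp add: sum_distrib_left[symmetric])
    finally show ?thesis
      using sp(2) pos True by (auto simp: msg_def next_b_def plus_1_eq_Suc)
  next
    case False
    then have s: "s = 1" using sp by auto
    let ?z = "\<lambda>k\<in>?C. 0::nat"
    have occ0: "\<sigma> = ?z" if "\<sigma> \<in> spins ?C" "occ \<sigma> ?C = 0" for \<sigma>
      using that finite_children[of \<Delta> i]
      by (fastforce simp: occ_def fun_eq_iff PiE_iff extensional_def)
    have "step m i s p = (\<Sum>\<sigma>\<in>{?z}. step_at \<sigma> m i s p)"
      unfolding step_def
    proof (rule sum.mono_neutral_right)
      show "\<forall>\<sigma>\<in>spins ?C - {?z}. step_at \<sigma> m i s p = 0"
        using occ0 by (auto simp: step_at_def spin_weight_def s)
    qed (auto intro!: finite_spins finite_children)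
    also have "\<dots> = (if p = 0 then lam else 0) * (\<Prod>k\<in>?C. m k 0 1)"
      by (simp add: step_at_def s spin_weight_def occ_def)
    also have "(\<Prod>k\<in>?C. m k 0 1) = (\<Prod>k\<in>?C. \<kappa> k) * (\<Prod>k\<in>?C. b k)"
      using m[of _ 0 1] by (simp add: msg_def prod.distrib)
    finally show ?thesis
      using pos by (simp add: s msg_def next_a_def)
  qed
qed

lemma ball_weight_scale:
  assumes \<eta>: "\<eta> \<in> spins (tree_ball \<Delta> (Suc n))"
    and m: "\<And>i s p. i \<in> tree_sphere \<Delta> (Suc n) \<Longrightarrow> s \<in> {0, 1} \<Longrightarrow> p \<in> {0, 1} \<Longrightarrow> m i s p = \<kappa> i * m' i s p"
  shows "ball_weight n m \<eta> = (\<Prod>i\<in>tree_sphere \<Delta> (Suc n). \<kappa> i) * ball_weight n m' \<eta>"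
proof -
  have "m i (\<eta> i) (\<eta> (tl i)) = \<kappa> i * m' i (\<eta> i) (\<eta> (tl i))" if i: "i \<in> tree_sphere \<Delta> (Suc n)" for i
  proof (rule m[OF i])
    have "i \<in> tree_ball \<Delta> (Suc n)" "tl i \<in> tree_ball \<Delta> (Suc n)"
      using i tl_tree_nodes[of i \<Delta>] by (auto simp: tree_ball_def tree_sphere_def)
    then show "\<eta> i \<in> {0, 1}" "\<eta> (tl i) \<in> {0, 1}" using \<eta> by auto
  qed
  then show ?thesis
    by (simp add: ball_weight_def prod.distrib)
qed

lemma ball_weight_nonneg:
  assumes "\<eta> \<in> spins (tree_ball \<Delta> (Suc n))" "\<And>i s p. i \<in> tree_sphere \<Delta> (Suc n) \<Longrightarrow> m i s p \<ge> 0"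
  shows "ball_weight n m \<eta> \<ge> 0"
  unfolding ball_weight_def using assms
  by (intro mult_nonneg_nonneg prod_nonneg ballI site_weight_nonneg) (auto simp: tree_ball_def)

definition zero_config :: "nat list set \<Rightarrow> nat list \<Rightarrow> nat" where
  "zero_config A = (\<lambda>k\<in>A. 0)"

lemma zero_config_spins: "zero_config A \<in> spins A"
  by (auto simp: zero_config_def)

text \<open>The empty configuration has positive weight whatever the ratios are, which keeps the
  normalisers away from 0.\<close>

lemma ball_weight_zero_config:
  "ball_weight n (\<lambda>i. msg (a i) (b i)) (zero_config (tree_ball \<Delta> (Suc n))) = \<theta> 0 ^ card (tree_ball \<Delta> n)"
proof -
  let ?z = "zero_config (tree_ball \<Delta> (Suc n))"
  have z: "?z j = 0" if "j \<in> tree_ball \<Delta> (Suc n)" for j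
    using that by (simp add: zero_config_def)
  have "site_weight i ?z = \<theta> 0" if "i \<in> tree_ball \<Delta> n" for i
  proof -
    have "{j \<in> tree_nbrs \<Delta> i. ?z j = 1} = {}" "?z i = 0"
      using tree_nbrs_ball[OF that] z by auto
    then show ?thesis unfolding site_weight_def spin_weight_def occ_def by (simp only: card.empty) simp
  qed
  moreover have "msg (a i) (b i) (?z i) (?z (tl i)) = 1" if "i \<in> tree_sphere \<Delta> (Suc n)" for i
  proof -
    have "i \<in> tree_ball \<Delta> (Suc n)" "tl i \<in> tree_ball \<Delta> (Suc n)"
      using that tl_tree_nodes[of i \<Delta>] by (auto simp: tree_ball_def tree_sphere_def)
    then have "?z i = 0" "?z (tl i) = 0" by (auto intro: z)
    then show ?thesis by (simp add: msg_def)
  qed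
  ultimately show ?thesis by (simp add: ball_weight_def)
qed

definition normalizer :: "nat \<Rightarrow> (nat list \<Rightarrow> nat \<Rightarrow> nat \<Rightarrow> real) \<Rightarrow> real" where
  "normalizer n m = sum (ball_weight n m) (spins (tree_ball \<Delta> (Suc n)))"

lemma normalizer_pos:
  assumes "\<And>i. i \<in> tree_sphere \<Delta> (Suc n) \<Longrightarrow> a i \<ge> 0 \<and> b i \<ge> 0"
  shows "normalizer n (\<lambda>i. msg (a i) (b i)) > 0"
proof -
  let ?z = "zero_config (tree_ball \<Delta> (Suc n))"
  have "0 < ball_weight n (\<lambda>i. msg (a i) (b i)) ?z"
    unfolding ball_weight_zero_config using \<theta>_pos[of 0] by simp
  also have "\<dots> \<le> normalizer n (\<lambda>i. msg (a i) (b i))"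
    unfolding normalizer_def using assms
    by (intro member_le_sum zero_config_spins finite_spins finite_tree_ball ball_weight_nonneg)
      (auto simp: msg_def)
  finally show ?thesis .
qed

text \<open>If the messages are reproduced by the recursion, summing out one more layer multiplies
  the ball weight by a factor \<open>D n\<close> that does not depend on \<eta>. The normalised
  weights are thus a consistent family and extend to the tree. The root has no parent and never lies
  on a sphere \<open>Suc n\<close>, so no message is sent from it.\<close>

lemma gibbs_measure_of_fixed_messages:
  assumes ab: "\<And>i. i \<in> tree_nodes \<Delta> \<Longrightarrow> a i \<ge> 0 \<and> b i \<ge> 0"
    and a: "\<And>i. i \<in> tree_nodes \<Delta> \<Longrightarrow> i \<noteq> [] \<Longrightarrow> next_a a b i = a i"
    and b: "\<And>i. i \<in> tree_nodes \<Delta> \<Longrightarrow> i \<noteq> [] \<Longrightarrow> next_b a i = b i"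
  shows "\<exists>\<mu>. gibbs_measure \<Delta> lam \<theta> \<mu> \<and> (\<forall>n. \<forall>\<eta>\<in>spins (tree_ball \<Delta> (Suc n)).
    measure \<mu> (cyl (tree_nodes \<Delta>) (tree_ball \<Delta> (Suc n)) \<eta>)
      = ball_weight n (\<lambda>i. msg (a i) (b i)) \<eta> / normalizer n (\<lambda>i. msg (a i) (b i)))"
proof -
  let ?m = "\<lambda>i. msg (a i) (b i)" and ?B = "\<lambda>n. tree_ball \<Delta> (Suc n)"
  have ab': "a i \<ge> 0 \<and> b i \<ge> 0" if "i \<in> tree_sphere \<Delta> n" for i n
    using that ab by (auto simp: tree_sphere_def)
  have Z: "normalizer n ?m > 0" for n
    by (rule normalizer_pos[OF ab'])
  define D where "D n = (\<Prod>i\<in>tree_sphere \<Delta> (Suc n). subset_poly \<theta> (children \<Delta> i) a)" for n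
  have layer: "sum (ball_weight (Suc n) ?m) (cyl (?B (Suc n)) (?B n) \<eta>) = D n * ball_weight n ?m \<eta>"
    if \<eta>: "\<eta> \<in> spins (?B n)" for n \<eta>
  proof -
    have "sum (ball_weight (Suc n) ?m) (cyl (?B (Suc n)) (?B n) \<eta>) = ball_weight n (step ?m) \<eta>"
      by (rule sum_ball_weight_Suc[OF \<eta>])
    also have "\<dots> = D n * ball_weight n ?m \<eta>"
      unfolding D_def
    proof (rule ball_weight_scale[OF \<eta>])
      fix i s p assume i: "i \<in> tree_sphere \<Delta> (Suc n)" and sp: "s \<in> {0, 1::nat}" "p \<in> {0, 1::nat}"
      have i': "i \<in> tree_nodes \<Delta>" "i \<noteq> []" using i by (auto simp: tree_sphere_def)
      have "step ?m i s p = (\<Prod>k\<in>children \<Delta> i. 1) * subset_poly \<theta> (children \<Delta> i) a * msg (next_a a b i) (next_b a i) s p"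
        using ab by (intro step_msg i' sp) (auto simp: children_def)
      then show "step ?m i s p = subset_poly \<theta> (children \<Delta> i) a * msg (a i) (b i) s p"
        using a[OF i'] b[OF i'] by simp
    qed
    finally show ?thesis .
  qed
  have ZSuc: "normalizer (Suc n) ?m = D n * normalizer n ?m" for n
  proof -
    have "normalizer (Suc n) ?m = (\<Sum>\<eta>\<in>spins (?B n). sum (ball_weight (Suc n) ?m) (cyl (?B (Suc n)) (?B n) \<eta>))"
      unfolding normalizer_def by (rule sum_spins_refine) (auto intro!: tree_ball_mono finite_tree_ball simp del: subsetI)
    then show ?thesis by (simp add: layer normalizer_def sum_distrib_left)
  qed
  have D: "D n \<noteq> 0" for n using ZSuc[of n] Z[of "Suc n"] by auto
  have "\<exists>\<mu>. prob_space \<mu> \<and> sets \<mu> = sets (\<Pi>\<^sub>M i\<in>tree_nodes \<Delta>. count_space {0, 1}) \<and>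
    (\<forall>n. \<forall>\<eta>\<in>spins (?B n). measure \<mu> (cyl (tree_nodes \<Delta>) (?B n) \<eta>) = ball_weight n ?m \<eta> / normalizer n ?m)"
  proof (rule kolmogorov_extension_spins)
    show "incseq ?B" by (auto simp: incseq_def tree_ball_def)
    show "tree_nodes \<Delta> = (\<Union>n. ?B n)" by (rule UN_tree_ball_Suc[symmetric])
    show "ball_weight n ?m \<eta> / normalizer n ?m \<ge> 0" if "\<eta> \<in> spins (?B n)" for n \<eta>
      using Z[of n] ab' by (intro divide_nonneg_pos ball_weight_nonneg that) (auto simp: msg_def)
    show "(\<Sum>\<eta>\<in>spins (?B 0). ball_weight 0 ?m \<eta> / normalizer 0 ?m) = 1"
      using Z[of 0] by (simp add: sum_divide_distrib[symmetric] normalizer_def)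
    show "(\<Sum>\<zeta>\<in>cyl (?B (Suc n)) (?B n) \<eta>. ball_weight (Suc n) ?m \<zeta> / normalizer (Suc n) ?m) =
      ball_weight n ?m \<eta> / normalizer n ?m" if "\<eta> \<in> spins (?B n)" for n \<eta>
      using layer[OF that] D[of n] by (simp add: sum_divide_distrib[symmetric] ZSuc)
  qed (rule finite_tree_ball)
  then obtain \<mu> where \<mu>: "prob_space \<mu>" "sets \<mu> = sets (config_space (tree_nodes \<Delta>))"
    "\<And>n \<eta>. \<eta> \<in> spins (?B n) \<Longrightarrow> measure \<mu> (cyl (tree_nodes \<Delta>) (?B n) \<eta>) = ball_weight n ?m \<eta> / normalizer n ?m"
    unfolding config_space_def by auto
  have "gibbs_measure \<Delta> lam \<theta> \<mu>"
    by (rule gibbs_measure_of_marginals[OF \<mu>(1,2), of "\<lambda>n. 1 / normalizer n ?m" ?m]) (simp add: \<mu>(3))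
  then show ?thesis using \<mu>(3) by blast
qed

end

subsection \<open>Lipschitz bounds and the homogeneous recursion\<close>

text \<open>The instance used in the end is r = 1 + c/\<Delta> and l = 1/r.\<close>

locale tree_ratio = tree_model +
  fixes l r :: real
  assumes \<Delta>_ge: "\<Delta> \<ge> 2" and l_pos: "l > 0" and r_ge: "r \<ge> 1"
    and ratio_ge: "\<And>k. k < \<Delta> \<Longrightarrow> l * \<theta> k \<le> \<theta> (Suc k)"
    and ratio_le: "\<And>k. k < \<Delta> \<Longrightarrow> \<theta> (Suc k) \<le> r * \<theta> k"
begin

lemma card_children_nonroot: "i \<in> tree_nodes \<Delta> \<Longrightarrow> i \<noteq> [] \<Longrightarrow> card (children \<Delta> i) < \<Delta>"
  using card_children[of i \<Delta>] \<Delta>_ge by simp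

lemma \<theta>_nonneg: "k \<le> \<Delta> \<Longrightarrow> \<theta> k \<ge> 0"
  using \<theta>_pos[of k] by simp

text \<open>Numerator and denominator are compared coefficient by coefficient. A node other than the
  root has \<Delta> - 1 children, so the shifted index never exceeds \<Delta>.\<close>

lemma next_b_bounds:
  assumes i: "i \<in> tree_nodes \<Delta>" "i \<noteq> []" and a: "\<And>k. k \<in> children \<Delta> i \<Longrightarrow> a k \<ge> 0"
  shows "l \<le> next_b a i" "next_b a i \<le> r"
proof -
  let ?P = "\<lambda>t. subset_poly t (children \<Delta> i) a"
  have pos: "?P \<theta> > 0" by (rule subset_poly_children_pos[OF i(1) a])
  have "l * ?P \<theta> \<le> ?P (\<lambda>j. \<theta> (Suc j))"
    using card_children_nonroot[OF i] by (intro subset_poly_mult_ge finite_children a ratio_ge) auto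
  moreover have "?P (\<lambda>j. \<theta> (Suc j)) \<le> r * ?P \<theta>"
    using card_children_nonroot[OF i] by (intro subset_poly_mult_le finite_children a ratio_le) auto
  ultimately show "l \<le> next_b a i" "next_b a i \<le> r"
    unfolding next_b_def using pos by (simp_all add: field_simps)
qed

lemma prod_children_le:
  assumes i: "i \<in> tree_nodes \<Delta>" and J: "J \<subseteq> children \<Delta> i"
    and b: "\<And>k. k \<in> J \<Longrightarrow> 0 \<le> b k \<and> b k \<le> r"
  shows "(\<Prod>k\<in>J. b k) \<le> r ^ \<Delta>"
proof -
  have "(\<Prod>k\<in>J. b k) \<le> (\<Prod>k\<in>J. r)" using b by (intro prod_mono) auto
  also have "\<dots> \<le> r ^ \<Delta>"
    using card_mono[OF finite_children J] card_children_le[OF i] r_ge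
    by (auto intro!: power_increasing)
  finally show ?thesis .
qed

lemma next_a_nonneg:
  assumes "i \<in> tree_nodes \<Delta>" "\<And>k. k \<in> children \<Delta> i \<Longrightarrow> a k \<ge> 0 \<and> b k \<ge> 0"
  shows "0 \<le> next_a a b i"
  unfolding next_a_def using assms lam_pos subset_poly_children_pos[of i a]
  by (intro divide_nonneg_pos mult_nonneg_nonneg prod_nonneg) auto

text \<open>As a function of one \<open>a k\<close>, \<open>next_b\<close> is the quotient in
  \<open>mobius_lipschitz\<close>, with A, B, C the polynomials of the other children for \<theta>
  shifted by 0, 1 and 2. At most \<Delta> - 2 other children remain, which leaves room for two
  shifts.\<close>

lemma next_b_lipschitz:
  assumes i: "i \<in> tree_nodes \<Delta>" "i \<noteq> []"
    and a: "\<And>k. k \<in> children \<Delta> i \<Longrightarrow> a k \<ge> 0" and a': "\<And>k. k \<in> children \<Delta> i \<Longrightarrow> a' k \<ge> 0"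
  shows "\<bar>next_b a i - next_b a' i\<bar> \<le> (r\<^sup>2 - l\<^sup>2) * (\<Sum>k\<in>children \<Delta> i. \<bar>a k - a' k\<bar>)"
proof (rule lipschitz_coordinatewise[where X="{0..}"])
  let ?C = "children \<Delta> i"
  fix k and c :: "nat list \<Rightarrow> real" and x y :: real
  assume k: "k \<in> ?C" and c: "\<And>i'. i' \<in> ?C \<Longrightarrow> c i' \<in> {0..}" and xy: "x \<in> {0..}" "y \<in> {0..}"
  have fin: "finite (?C - {k})" using finite_children by blast
  have card: "Suc (card (?C - {k})) = card ?C"
    using k finite_children by (simp add: card_Suc_Diff1 del: card_Diff_insert)
  then have card': "Suc (card (?C - {k})) < \<Delta>" using card_children_nonroot[OF i] by simp
  let ?P = "\<lambda>t. subset_poly t (?C - {k}) c"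
  have c': "c j \<ge> 0" if "j \<in> ?C - {k}" for j using c that by auto
  have "\<theta> 0 \<le> ?P \<theta>"
    using fin c' card' by (intro subset_poly_ge \<theta>_nonneg) auto
  then have pos: "?P \<theta> > 0" using \<theta>_pos[of 0] by simp
  have "l * ?P \<theta> \<le> ?P (\<lambda>j. \<theta> (Suc j))"
    using fin c' card' by (intro subset_poly_mult_ge ratio_ge) auto
  moreover have "?P (\<lambda>j. \<theta> (Suc j)) \<le> r * ?P \<theta>"
    using fin c' card' by (intro subset_poly_mult_le ratio_le) auto
  moreover have "l * ?P (\<lambda>j. \<theta> (Suc j)) \<le> ?P (\<lambda>j. \<theta> (Suc (Suc j)))"
    using fin c' card' by (intro subset_poly_mult_ge ratio_ge) auto
  moreover have "?P (\<lambda>j. \<theta> (Suc (Suc j))) \<le> r * ?P (\<lambda>j. \<theta> (Suc j))"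
    using fin c' card' by (intro subset_poly_mult_le ratio_le) auto
  ultimately show "\<bar>next_b (c(k := x)) i - next_b (c(k := y)) i\<bar> \<le> (r\<^sup>2 - l\<^sup>2) * \<bar>x - y\<bar>"
    unfolding next_b_def subset_poly_fun_upd[OF finite_children k]
    using pos xy l_pos by (intro mobius_lipschitz) auto
next
  show "next_b c i = next_b c' i" if "\<And>k. k \<in> children \<Delta> i \<Longrightarrow> c k = c' k" for c c'
    unfolding next_b_def using that subset_poly_cong[of "children \<Delta> i" c c'] by metis
qed (use a a' finite_children in auto)

lemma prod_lipschitz:
  assumes i: "i \<in> tree_nodes \<Delta>"
    and b: "\<And>k. k \<in> children \<Delta> i \<Longrightarrow> b k \<in> {0..r}" and b': "\<And>k. k \<in> children \<Delta> i \<Longrightarrow> b' k \<in> {0..r}"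
  shows "\<bar>(\<Prod>k\<in>children \<Delta> i. b k) - (\<Prod>k\<in>children \<Delta> i. b' k)\<bar> \<le> r ^ \<Delta> * (\<Sum>k\<in>children \<Delta> i. \<bar>b k - b' k\<bar>)"
proof (rule lipschitz_coordinatewise[where X="{0..r}" and f="\<lambda>b. \<Prod>k\<in>children \<Delta> i. b k"])
  let ?C = "children \<Delta> i"
  fix k and c :: "nat list \<Rightarrow> real" and x y :: real
  assume k: "k \<in> ?C" and c: "\<And>i'. i' \<in> ?C \<Longrightarrow> c i' \<in> {0..r}" and xy: "x \<in> {0..r}" "y \<in> {0..r}"
  have upd: "(\<Prod>j\<in>?C. (c(k := z)) j) = z * (\<Prod>j\<in>?C - {k}. c j)" for z
    using prod.remove[OF finite_children k, of "c(k := z)"] by simp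
  have nn: "(\<Prod>j\<in>?C - {k}. c j) \<ge> 0" using c by (intro prod_nonneg) auto
  have "(\<Prod>j\<in>?C - {k}. c j) \<le> r ^ \<Delta>" using c by (intro prod_children_le[OF i]) auto
  then have "\<bar>x - y\<bar> * (\<Prod>j\<in>?C - {k}. c j) \<le> \<bar>x - y\<bar> * r ^ \<Delta>" by (rule mult_left_mono) simp
  then show "\<bar>(\<Prod>j\<in>?C. (c(k := x)) j) - (\<Prod>j\<in>?C. (c(k := y)) j)\<bar> \<le> r ^ \<Delta> * \<bar>x - y\<bar>"
    unfolding upd left_diff_distrib[symmetric] abs_mult using nn by (simp add: mult.commute)
qed (use b b' finite_children in \<open>auto intro: prod.cong\<close>)

lemma inverse_subset_poly_lipschitz:
  assumes i: "i \<in> tree_nodes \<Delta>"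
    and a: "\<And>k. k \<in> children \<Delta> i \<Longrightarrow> a k \<ge> 0" and a': "\<And>k. k \<in> children \<Delta> i \<Longrightarrow> a' k \<ge> 0"
  shows "\<bar>1 / subset_poly \<theta> (children \<Delta> i) a - 1 / subset_poly \<theta> (children \<Delta> i) a'\<bar>
    \<le> r / \<theta> 0 * (\<Sum>k\<in>children \<Delta> i. \<bar>a k - a' k\<bar>)"
proof (rule lipschitz_coordinatewise[where X="{0..}" and f="\<lambda>a. 1 / subset_poly \<theta> (children \<Delta> i) a"])
  let ?C = "children \<Delta> i"
  fix k and c :: "nat list \<Rightarrow> real" and x y :: real
  assume k: "k \<in> ?C" and c: "\<And>i'. i' \<in> ?C \<Longrightarrow> c i' \<in> {0..}" and xy: "x \<in> {0..}" "y \<in> {0..}"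
  have fin: "finite (?C - {k})" using finite_children by blast
  have card: "Suc (card (?C - {k})) = card ?C"
    using k finite_children by (simp add: card_Suc_Diff1 del: card_Diff_insert)
  then have card': "Suc (card (?C - {k})) \<le> \<Delta>" using card_children_le[OF i] by simp
  let ?P = "\<lambda>t. subset_poly t (?C - {k}) c"
  have c': "c j \<ge> 0" if "j \<in> ?C - {k}" for j using c that by auto
  have ge: "\<theta> 0 \<le> ?P \<theta>"
    using fin c' card' by (intro subset_poly_ge \<theta>_nonneg) auto
  have pos: "?P \<theta> > 0" using ge \<theta>_pos[of 0] by simp
  have le: "?P (\<lambda>j. \<theta> (Suc j)) \<le> r * ?P \<theta>"
    using fin c' card' by (intro subset_poly_mult_le ratio_le) auto
  have "\<theta> (Suc 0) \<le> ?P (\<lambda>j. \<theta> (Suc j))"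
    using fin c' card' by (intro subset_poly_ge[where t="\<lambda>j. \<theta> (Suc j)"] \<theta>_nonneg) auto
  then have nn: "0 \<le> ?P (\<lambda>j. \<theta> (Suc j))" using \<theta>_nonneg[of "Suc 0"] \<Delta>_ge by simp
  have "\<bar>1 / (?P \<theta> + x * ?P (\<lambda>j. \<theta> (Suc j))) - 1 / (?P \<theta> + y * ?P (\<lambda>j. \<theta> (Suc j)))\<bar> \<le> r / ?P \<theta> * \<bar>x - y\<bar>"
    using pos le nn xy by (intro inverse_affine_lipschitz) auto
  also have "\<dots> \<le> r / \<theta> 0 * \<bar>x - y\<bar>"
    using ge pos \<theta>_pos[of 0] r_ge by (intro mult_right_mono divide_left_mono) auto
  finally show "\<bar>1 / subset_poly \<theta> ?C (c(k := x)) - 1 / subset_poly \<theta> ?C (c(k := y))\<bar> \<le> r / \<theta> 0 * \<bar>x - y\<bar>"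
    unfolding subset_poly_fun_upd[OF finite_children k] .
next
  show "1 / subset_poly \<theta> (children \<Delta> i) c = 1 / subset_poly \<theta> (children \<Delta> i) c'"
    if "\<And>k. k \<in> children \<Delta> i \<Longrightarrow> c k = c' k" for c c'
    using that subset_poly_cong[of "children \<Delta> i" c c'] by metis
qed (use a a' finite_children in auto)

text \<open>Product rule for P Q with P the product of the \<open>b\<close>s, at most r^\<Delta>,
  and Q the inverse polynomial, at most 1/\<theta>_0. The extra factor r in the constant comes from
  the Lipschitz bound for Q and is spent on both sums alike.\<close>

lemma next_a_lipschitz:
  assumes i: "i \<in> tree_nodes \<Delta>"
    and a: "\<And>k. k \<in> children \<Delta> i \<Longrightarrow> a k \<ge> 0" "\<And>k. k \<in> children \<Delta> i \<Longrightarrow> a' k \<ge> 0"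
    and b: "\<And>k. k \<in> children \<Delta> i \<Longrightarrow> b k \<in> {0..r}" "\<And>k. k \<in> children \<Delta> i \<Longrightarrow> b' k \<in> {0..r}"
  shows "\<bar>next_a a b i - next_a a' b' i\<bar> \<le> lam * r ^ Suc \<Delta> / \<theta> 0 *
    ((\<Sum>k\<in>children \<Delta> i. \<bar>a k - a' k\<bar>) + (\<Sum>k\<in>children \<Delta> i. \<bar>b k - b' k\<bar>))"
proof -
  let ?C = "children \<Delta> i"
  define P where "P = (\<Prod>k\<in>?C. b k)"
  define P' where "P' = (\<Prod>k\<in>?C. b' k)"
  define Q where "Q = 1 / subset_poly \<theta> ?C a"
  define Q' where "Q' = 1 / subset_poly \<theta> ?C a'"
  define A where "A = (\<Sum>k\<in>?C. \<bar>a k - a' k\<bar>)"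
  define B where "B = (\<Sum>k\<in>?C. \<bar>b k - b' k\<bar>)"
  have nn: "A \<ge> 0" "B \<ge> 0" by (auto simp: A_def B_def intro: sum_nonneg)
  have \<theta>0: "\<theta> 0 > 0" using \<theta>_pos by simp
  have dP: "\<bar>P - P'\<bar> \<le> r ^ \<Delta> * B" unfolding P_def P'_def B_def by (rule prod_lipschitz[OF i b])
  have dQ: "\<bar>Q - Q'\<bar> \<le> r / \<theta> 0 * A" unfolding Q_def Q'_def A_def by (rule inverse_subset_poly_lipschitz[OF i a])
  have Q: "0 \<le> Q" "Q \<le> 1 / \<theta> 0"
    unfolding Q_def using subset_poly_children_ge[of i a] i a(1) \<theta>0 by (auto simp: field_simps)
  have P': "0 \<le> P'" "P' \<le> r ^ \<Delta>"
    unfolding P'_def using b(2) by (auto intro!: prod_nonneg prod_children_le[OF i])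
  have r: "r ^ \<Delta> \<le> r ^ Suc \<Delta>" using r_ge by (intro power_increasing) auto
  have "P * Q - P' * Q' = (P - P') * Q + P' * (Q - Q')" by (simp add: algebra_simps)
  then have "\<bar>P * Q - P' * Q'\<bar> \<le> \<bar>P - P'\<bar> * Q + P' * \<bar>Q - Q'\<bar>"
    using Q(1) P'(1) by (metis abs_mult abs_of_nonneg abs_triangle_ineq)
  also have "\<dots> \<le> (r ^ \<Delta> * B) * (1 / \<theta> 0) + r ^ \<Delta> * (r / \<theta> 0 * A)"
    using dP dQ Q P' nn r_ge \<theta>0 by (intro add_mono mult_mono) auto
  also have "\<dots> \<le> (r ^ Suc \<Delta> * B) * (1 / \<theta> 0) + r ^ Suc \<Delta> / \<theta> 0 * A"
    using r nn \<theta>0 by (intro add_mono mult_right_mono) (auto simp: mult_ac)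
  also have "\<dots> = r ^ Suc \<Delta> / \<theta> 0 * (A + B)" unfolding distrib_left by (simp add: mult_ac)
  finally have "lam * \<bar>P * Q - P' * Q'\<bar> \<le> lam * (r ^ Suc \<Delta> / \<theta> 0 * (A + B))"
    using lam_pos by (intro mult_left_mono) auto
  moreover have "next_a a b i - next_a a' b' i = lam * (P * Q - P' * Q')"
    by (simp add: next_a_def P_def P'_def Q_def Q'_def algebra_simps)
  ultimately show ?thesis
    using lam_pos unfolding A_def B_def by (simp add: abs_mult)
qed

text \<open>One step of the recursion at a node other than the root, when all its \<Delta> - 1
  children carry the same pair.\<close>

definition hmap :: "real \<times> real \<Rightarrow> real \<times> real" where
  "hmap = (\<lambda>(a, b). (lam * b ^ (\<Delta> - 1) / hpoly (\<Delta> - 1) \<theta> a,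
      hpoly (\<Delta> - 1) (\<lambda>j. \<theta> (Suc j)) a / hpoly (\<Delta> - 1) \<theta> a))"

lemma hmap_eq_next:
  assumes "i \<in> tree_nodes \<Delta>" "i \<noteq> []"
  shows "hmap (a, b) = (next_a (\<lambda>_. a) (\<lambda>_. b) i, next_b (\<lambda>_. a) i)"
  using assms by (simp add: hmap_def next_a_def next_b_def subset_poly_const[OF finite_children] card_children)

lemma hpoly_lower: "a \<ge> 0 \<Longrightarrow> \<theta> 0 * (1 + l * a) ^ (\<Delta> - 1) \<le> hpoly (\<Delta> - 1) \<theta> a"
  using l_pos \<Delta>_ge by (intro hpoly_ge \<theta>_nonneg ratio_ge) auto

lemma hpoly_upper: "a \<ge> 0 \<Longrightarrow> hpoly (\<Delta> - 1) \<theta> a \<le> \<theta> 0 * (1 + r * a) ^ (\<Delta> - 1)"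
  using r_ge \<Delta>_ge by (intro hpoly_le \<theta>_nonneg ratio_le) auto

lemma hpoly_pos: "a \<ge> 0 \<Longrightarrow> hpoly (\<Delta> - 1) \<theta> a > 0"
proof -
  assume a: "a \<ge> 0"
  have "0 < \<theta> 0 * (1 + l * a) ^ (\<Delta> - 1)"
    using a l_pos \<theta>_pos[of 0] by (intro mult_pos_pos zero_less_power add_pos_nonneg mult_nonneg_nonneg) auto
  then show ?thesis using hpoly_lower[OF a] by linarith
qed

lemma nonroot_exists: "\<exists>i. i \<in> tree_nodes \<Delta> \<and> i \<noteq> []"
  using \<Delta>_ge by (intro exI[of _ "[0]"]) (auto simp: tree_nodes_def)

lemma snd_hmap_bounds:
  assumes "fst x \<ge> 0"
  shows "snd (hmap x) \<in> {l..r}"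
proof -
  obtain i where i: "i \<in> tree_nodes \<Delta>" "i \<noteq> []" using nonroot_exists by blast
  show ?thesis
    using hmap_eq_next[OF i, of "fst x" "snd x"] next_b_bounds[OF i, of "\<lambda>_. fst x"] assms by simp
qed

lemma fst_hmap_le:
  assumes "a \<ge> 0" "b \<in> {l..r}"
  shows "fst (hmap (a, b)) \<le> lam * r ^ (\<Delta> - 1) / (\<theta> 0 * (1 + l * a) ^ (\<Delta> - 1))"
proof -
  have "b ^ (\<Delta> - 1) \<le> r ^ (\<Delta> - 1)" using assms l_pos by (intro power_mono) auto
  moreover have "0 < \<theta> 0 * (1 + l * a) ^ (\<Delta> - 1)"
    using assms(1) l_pos \<theta>_pos[of 0] by (intro mult_pos_pos zero_less_power add_pos_nonneg mult_nonneg_nonneg) auto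
  ultimately have "lam * b ^ (\<Delta> - 1) / hpoly (\<Delta> - 1) \<theta> a \<le> lam * r ^ (\<Delta> - 1) / (\<theta> 0 * (1 + l * a) ^ (\<Delta> - 1))"
    using hpoly_lower[OF assms(1)] lam_pos r_ge by (intro frac_le mult_left_mono mult_nonneg_nonneg) auto
  then show ?thesis by (simp add: hmap_def)
qed

lemma fst_hmap_ge:
  assumes "a \<ge> 0" "b \<in> {l..r}"
  shows "lam * l ^ (\<Delta> - 1) / (\<theta> 0 * (1 + r * a) ^ (\<Delta> - 1)) \<le> fst (hmap (a, b))"
proof -
  have "l ^ (\<Delta> - 1) \<le> b ^ (\<Delta> - 1)" using assms l_pos by (intro power_mono) auto
  moreover have "0 \<le> b" using assms(2) l_pos by simp
  ultimately have "lam * l ^ (\<Delta> - 1) / (\<theta> 0 * (1 + r * a) ^ (\<Delta> - 1)) \<le> lam * b ^ (\<Delta> - 1) / hpoly (\<Delta> - 1) \<theta> a"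
    using hpoly_upper[OF assms(1)] hpoly_pos[OF assms(1)] lam_pos by (intro frac_le mult_left_mono mult_nonneg_nonneg) auto
  then show ?thesis by (simp add: hmap_def)
qed

lemma fst_hmap_nonneg: "a \<ge> 0 \<Longrightarrow> b \<in> {l..r} \<Longrightarrow> 0 \<le> fst (hmap (a, b))"
  using hpoly_pos[of a] lam_pos l_pos by (auto simp: hmap_def)

lemma continuous_on_hmap: "continuous_on ({0..} \<times> UNIV) hmap"
proof -
  have nz: "\<forall>x\<in>{0..} \<times> (UNIV :: real set). hpoly (\<Delta> - 1) \<theta> (fst x) \<noteq> 0"
  proof
    fix x :: "real \<times> real" assume "x \<in> {0..} \<times> UNIV"
    then show "hpoly (\<Delta> - 1) \<theta> (fst x) \<noteq> 0" using hpoly_pos[of "fst x"] by auto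
  qed
  show ?thesis
    unfolding hmap_def case_prod_beta by (intro continuous_intros nz)
qed

lemma l_le_r: "l \<le> r"
  using ratio_ge[of 0] ratio_le[of 0] \<Delta>_ge \<theta>_pos[of 0]
  by (metis Suc_le_lessD less_le_trans mult_le_cancel_right_pos order_trans pos2 zero_le)

text \<open>Brouwer on a box: the second component always lands in [l, r], and the first is at most
  lam r^(\<Delta> - 1)/\<theta>_0 because the polynomial in the denominator is at least
  \<theta>_0.\<close>

lemma hmap_fixed_point: "\<exists>a b. 0 \<le> a \<and> b \<in> {l..r} \<and> hmap (a, b) = (a, b)"
proof -
  let ?A = "lam * r ^ (\<Delta> - 1) / \<theta> 0"
  let ?S = "{0..?A} \<times> {l..r}"
  have A: "?A \<ge> 0" using lam_pos r_ge \<theta>_pos[of 0] by simp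
  have "\<exists>x\<in>?S. hmap x = x"
  proof (rule brouwer)
    show "compact ?S" by (intro compact_Times) auto
    show "convex ?S" by (intro convex_Times) auto
    show "continuous_on ?S hmap"
      by (rule continuous_on_subset[OF continuous_on_hmap]) auto
    show "hmap \<in> ?S \<rightarrow> ?S"
    proof
      fix x assume "x \<in> ?S"
      then obtain a b where x: "x = (a, b)" "0 \<le> a" "b \<in> {l..r}" by auto
      have "\<theta> 0 * 1 \<le> \<theta> 0 * (1 + l * a) ^ (\<Delta> - 1)"
        using x l_pos \<theta>_pos[of 0] by (intro mult_left_mono one_le_power) auto
      then have "lam * r ^ (\<Delta> - 1) / (\<theta> 0 * (1 + l * a) ^ (\<Delta> - 1)) \<le> ?A"
        using lam_pos r_ge \<theta>_pos[of 0] by (intro divide_left_mono mult_pos_pos) auto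
      then have "fst (hmap x) \<le> ?A" using fst_hmap_le[OF x(2,3)] x(1) by simp
      then show "hmap x \<in> ?S"
        using fst_hmap_nonneg[OF x(2,3)] snd_hmap_bounds[of x] x by (simp add: mem_Times_iff)
    qed
  qed (use A l_le_r in auto)
  then obtain a b where "(a, b) \<in> ?S" "hmap (a, b) = (a, b)" by (metis surj_pair)
  then show ?thesis by (intro exI[of _ a] exI[of _ b]) auto
qed

lemma hmap_two_cycle:
  assumes "0 \<le> \<alpha>" "\<alpha> \<le> \<beta>" "0 \<le> \<alpha>'"
    and "\<And>x. x \<in> {\<alpha>..\<beta>} \<times> {l..r} \<Longrightarrow> hmap x \<in> {\<alpha>'..\<beta>'} \<times> {l..r}"
    and "\<And>x. x \<in> {\<alpha>'..\<beta>'} \<times> {l..r} \<Longrightarrow> hmap x \<in> {\<alpha>..\<beta>} \<times> {l..r}"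
  shows "\<exists>x\<in>{\<alpha>..\<beta>} \<times> {l..r}. hmap (hmap x) = x"
proof (rule brouwer)
  show "compact ({\<alpha>..\<beta>} \<times> {l..r})" by (intro compact_Times) auto
  show "convex ({\<alpha>..\<beta>} \<times> {l..r})" by (intro convex_Times) auto
  show "continuous_on ({\<alpha>..\<beta>} \<times> {l..r}) (\<lambda>x. hmap (hmap x))"
  proof (rule continuous_on_compose2[OF continuous_on_hmap])
    show "continuous_on ({\<alpha>..\<beta>} \<times> {l..r}) hmap"
      by (rule continuous_on_subset[OF continuous_on_hmap]) (use assms(1) in auto)
    show "hmap ` ({\<alpha>..\<beta>} \<times> {l..r}) \<subseteq> {0..} \<times> UNIV"
    proof (rule image_subsetI)
      fix x assume "x \<in> {\<alpha>..\<beta>} \<times> {l..r}"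
      from assms(4)[OF this] show "hmap x \<in> {0..} \<times> UNIV"
        using assms(3) by (cases "hmap x") auto
    qed
  qed
  show "(\<lambda>x. hmap (hmap x)) \<in> {\<alpha>..\<beta>} \<times> {l..r} \<rightarrow> {\<alpha>..\<beta>} \<times> {l..r}"
    using assms(4,5) by blast
qed (use assms(2) l_le_r in auto)

text \<open>Neighbouring nodes have depths of opposite parity, so a cycle of length two of the
  homogeneous recursion is a fixed point of the recursion on the tree.\<close>

lemma gibbs_measure_of_two_cycle:
  assumes x: "hmap (a 0, b 0) = (a 1, b 1)" "hmap (a 1, b 1) = (a 0, b 0)"
    and nonneg: "\<And>j. a j \<ge> 0 \<and> b j \<ge> 0"
  defines "m \<equiv> \<lambda>i. msg (a (length i mod 2)) (b (length i mod 2))"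
  shows "\<exists>\<mu>. gibbs_measure \<Delta> lam \<theta> \<mu> \<and> (\<forall>n. \<forall>\<eta>\<in>spins (tree_ball \<Delta> (Suc n)).
    measure \<mu> (cyl (tree_nodes \<Delta>) (tree_ball \<Delta> (Suc n)) \<eta>) = ball_weight n m \<eta> / normalizer n m)"
  unfolding m_def
proof (rule gibbs_measure_of_fixed_messages)
  fix i assume i: "i \<in> tree_nodes \<Delta>" "i \<noteq> []"
  let ?j = "length i mod 2" and ?k = "Suc (length i) mod 2"
  have child: "length k mod 2 = ?k" if "k \<in> children \<Delta> i" for k
    using that by (cases k) (auto simp: children_def)
  have c1: "(\<Prod>k\<in>children \<Delta> i. b (length k mod 2)) = (\<Prod>k\<in>children \<Delta> i. b ?k)"
    by (rule prod.cong) (auto simp: child)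
  have c2: "subset_poly t (children \<Delta> i) (\<lambda>k. a (length k mod 2)) = subset_poly t (children \<Delta> i) (\<lambda>_. a ?k)" for t
    by (rule subset_poly_cong) (simp add: child)
  have "hmap (a ?k, b ?k) = (a ?j, b ?j)"
    using x by (cases "even (length i)") (auto simp: mod2_eq_if)
  moreover have "hmap (a ?k, b ?k) = (next_a (\<lambda>k. a (length k mod 2)) (\<lambda>k. b (length k mod 2)) i,
      next_b (\<lambda>k. a (length k mod 2)) i)"
    unfolding hmap_eq_next[OF i] next_a_def next_b_def c1 c2 by simp
  ultimately show "next_a (\<lambda>k. a (length k mod 2)) (\<lambda>k. b (length k mod 2)) i = a ?j"
    "next_b (\<lambda>k. a (length k mod 2)) i = b ?j" by auto
qed (use nonneg in auto)

end

subsection \<open>Uniqueness from contraction\<close>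

context tree_model
begin

text \<open>The weight of a ball given the spins outside involves the two layers around it; the two
  steps below absorb these layers into messages on the outermost sphere of the ball.\<close>

definition boundary_msg :: "(nat list \<Rightarrow> nat) \<Rightarrow> nat list \<Rightarrow> nat \<Rightarrow> nat \<Rightarrow> real" where
  "boundary_msg \<omega> = step_at \<omega> (step_at \<omega> (\<lambda>_ _ _. 1))"

lemma gibbs_weight_ball:
  assumes \<omega>: "\<omega> \<in> spins (tree_nodes \<Delta>)" and \<eta>: "\<eta> \<in> spins (tree_ball \<Delta> (Suc n))"
  shows "gibbs_weight \<Delta> lam \<theta> (tree_ball \<Delta> (Suc n)) \<omega> \<eta> = ball_weight n (boundary_msg \<omega>) \<eta>"
proof -
  let ?B = "tree_ball \<Delta> (Suc n)" and ?one = "\<lambda>_ _ _. 1::real"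
  let ?\<omega> = "merge ?B (tree_nodes \<Delta> - ?B) (\<eta>, \<omega>)"
  have 01: "?\<omega> j \<in> {0, 1}" if "j \<in> tree_nodes \<Delta>" for j
    using that \<omega> \<eta> by (auto simp: merge_def PiE_iff)
  \<comment> \<open>The nodes interacting with the ball of radius \<open>n + 1\<close> form the ball
    of radius \<open>n + 2\<close>, so the Gibbs weight is a ball weight with trivial messages
    beyond it.\<close>
  have "gibbs_weight \<Delta> lam \<theta> ?B \<omega> \<eta> = ball_weight (Suc (Suc n)) ?one ?\<omega>"
    using gibbs_weight_eq[OF finite_tree_ball tree_ball_subset \<omega> \<eta>]
    by (simp add: nbhd_tree_ball ball_weight_def)
  also have "\<dots> = ball_weight (Suc n) (step_at ?\<omega> ?one) ?\<omega>"
    by (rule ball_weight_Suc, rule 01) (auto simp: tree_ball_def)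
  also have "\<dots> = ball_weight n (step_at ?\<omega> (step_at ?\<omega> ?one)) ?\<omega>"
    by (rule ball_weight_Suc, rule 01) (auto simp: tree_ball_def)
  also have "\<dots> = ball_weight n (boundary_msg \<omega>) \<eta>"
    unfolding boundary_msg_def
  proof (rule ball_weight_cong)
    fix i assume i: "i \<in> tree_sphere \<Delta> (Suc n)"
    have out: "?\<omega> k = \<omega> k" if "k \<in> tree_nodes \<Delta>" "length k > Suc n" for k
      using that by (auto simp: merge_def tree_ball_def)
    have len: "length k = Suc (length j)" "k \<in> tree_nodes \<Delta>" if "k \<in> children \<Delta> j" for k j
      using that by (auto simp: children_def)
    show "step_at ?\<omega> (step_at ?\<omega> ?one) i (\<eta> i) (\<eta> (tl i)) = step_at \<omega> (step_at \<omega> ?one) i (\<eta> i) (\<eta> (tl i))"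
      using i len by (intro step_at_cong out) (auto simp: tree_sphere_def)
  qed (simp add: merge_def)
  finally show ?thesis .
qed

text \<open>A conditional probability integrates to the probability, so the conditional laws express
  every cylinder probability as an average over boundary conditions.\<close>

lemma gibbs_measure_cyl:
  assumes \<mu>: "gibbs_measure \<Delta> lam \<theta> \<mu>" and fin: "finite \<Lambda>" "\<Lambda> \<subseteq> tree_nodes \<Delta>" and \<eta>: "\<eta> \<in> spins \<Lambda>"
  shows "integrable \<mu> (gibbs_kernel \<Lambda> \<eta>)" (is ?int)
    and "measure \<mu> (cyl (tree_nodes \<Delta>) \<Lambda> \<eta>) = (\<integral>\<omega>. gibbs_kernel \<Lambda> \<eta> \<omega> \<partial>\<mu>)" (is ?eq)
proof -
  let ?E = "cyl (tree_nodes \<Delta>) \<Lambda> \<eta>" and ?F = "outside_algebra \<Delta> \<Lambda>"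
  have prob: "prob_space \<mu>" and sets: "sets \<mu> = sets (config_space (tree_nodes \<Delta>))"
    and ce: "AE \<omega> in \<mu>. real_cond_exp \<mu> ?F (indicator ?E) \<omega> = gibbs_kernel \<Lambda> \<eta> \<omega>"
    using \<mu> fin \<eta> unfolding gibbs_measure_alt by auto
  interpret prob_space \<mu> by (rule prob)
  have sub: "subalgebra \<mu> ?F" by (rule subalgebra_outside_algebra[OF sets])
  have sub': "finite_measure_subalgebra \<mu> ?F" using sub by unfold_locales
  interpret F: finite_measure_subalgebra \<mu> ?F by (rule sub')
  have E[measurable]: "?E \<in> sets \<mu>" using sets_cyl[OF fin] sets by (simp add: config_space_def)
  have [measurable]: "gibbs_kernel \<Lambda> \<eta> \<in> borel_measurable \<mu>"
    by (rule measurable_from_subalg[OF sub gibbs_kernel_measurable[OF fin \<eta>]])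
  show ?int
    using gibbs_kernel_nonneg gibbs_kernel_le_1[OF fin(1) \<eta>]
    by (intro integrable_const_bound[where B=1]) auto
  have intE: "integrable \<mu> (indicator ?E :: _ \<Rightarrow> real)" by (simp add: emeasure_eq_measure)
  have "measure \<mu> ?E = (\<integral>\<omega>. indicator ?E \<omega> \<partial>\<mu>)" by simp
  also have "\<dots> = (\<integral>\<omega>. real_cond_exp \<mu> ?F (indicator ?E) \<omega> \<partial>\<mu>)"
    by (rule F.real_cond_exp_int(2)[OF intE, symmetric])
  also have "\<dots> = (\<integral>\<omega>. gibbs_kernel \<Lambda> \<eta> \<omega> \<partial>\<mu>)"
    by (rule integral_cong_AE) (use ce in auto)
  finally show ?eq .
qed

lemma sum_gibbs_kernel:
  assumes "finite \<Lambda>"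
  shows "(\<Sum>\<eta>\<in>spins \<Lambda>. gibbs_kernel \<Lambda> \<eta> \<omega>) =
    (if (\<Sum>\<eta>\<in>spins \<Lambda>. gibbs_weight \<Delta> lam \<theta> \<Lambda> \<omega> \<eta>) = 0 then 0 else 1)"
  unfolding gibbs_kernel_def by (simp add: sum_divide_distrib[symmetric])

text \<open>The kernels of \<Lambda> add up to 1 or to 0, the latter exactly where the normaliser
  vanishes. Their integrals are the probabilities of disjoint cylinders that cover the space and add
  up to 1, so the nonnegative defect has integral 0.\<close>

lemma gibbs_measure_normalizer_nonzero:
  assumes \<mu>: "gibbs_measure \<Delta> lam \<theta> \<mu>" and fin: "finite \<Lambda>" "\<Lambda> \<subseteq> tree_nodes \<Delta>"
  shows "AE \<omega> in \<mu>. (\<Sum>\<eta>\<in>spins \<Lambda>. gibbs_weight \<Delta> lam \<theta> \<Lambda> \<omega> \<eta>) \<noteq> 0"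
proof -
  let ?T = "\<lambda>\<omega>. \<Sum>\<eta>\<in>spins \<Lambda>. gibbs_kernel \<Lambda> \<eta> \<omega>" and ?V = "tree_nodes \<Delta>"
  have prob: "prob_space \<mu>" and sets: "sets \<mu> = sets (config_space (tree_nodes \<Delta>))"
    using \<mu> unfolding gibbs_measure_alt by auto
  interpret prob_space \<mu> by (rule prob)
  have sp: "space \<mu> = spins ?V"
    using sets_eq_imp_space_eq[OF sets] by (simp add: config_space_def space_PiM_spins)
  have int: "integrable \<mu> ?T"
    by (intro Bochner_Integration.integrable_sum gibbs_measure_cyl(1)[OF \<mu> fin])
  have "spins ?V = (\<Union>\<eta>\<in>spins \<Lambda>. cyl ?V \<Lambda> \<eta>)"
    using restrict_spins[OF _ fin(2)] by (auto simp: cyl_def simp del: restrict_PiE_iff)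
  then have "1 = measure \<mu> (\<Union>\<eta>\<in>spins \<Lambda>. cyl ?V \<Lambda> \<eta>)"
    using prob_space sp by simp
  also have "\<dots> = (\<Sum>\<eta>\<in>spins \<Lambda>. measure \<mu> (cyl ?V \<Lambda> \<eta>))"
    using sets_cyl[OF fin] sets cyl_disjoint[of _ _ ?V \<Lambda>]
    by (intro finite_measure_finite_Union[OF finite_spins[OF fin(1)]])
      (auto simp: config_space_def disjoint_family_on_def)
  also have "\<dots> = (\<integral>\<omega>. ?T \<omega> \<partial>\<mu>)"
    using gibbs_measure_cyl[OF \<mu> fin] by (simp add: Bochner_Integration.integral_sum)
  finally have "(\<integral>\<omega>. 1 - ?T \<omega> \<partial>\<mu>) = 0"
    using int prob_space by (simp add: Bochner_Integration.integral_diff)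
  moreover have "integrable \<mu> (\<lambda>\<omega>. 1 - ?T \<omega>)" using int by simp
  moreover have "AE \<omega> in \<mu>. 0 \<le> 1 - ?T \<omega>"
    by (simp add: sum_gibbs_kernel[OF fin(1)])
  ultimately have "AE \<omega> in \<mu>. 1 - ?T \<omega> = 0"
    using integral_nonneg_eq_0_iff_AE by blast
  then show ?thesis
    by (rule AE_mp) (auto simp: sum_gibbs_kernel[OF fin(1)])
qed

text \<open>The conditional law of the inner ball, given the spins outside a ball with
  \<open>k\<close> more layers, is determined by the boundary messages after \<open>k\<close> rounds
  of the recursion.\<close>

lemma sum_cyl_gibbs_kernel_ball:
  fixes k :: nat
  assumes \<omega>: "\<omega> \<in> spins (tree_nodes \<Delta>)" and \<xi>: "\<xi> \<in> spins (tree_ball \<Delta> (Suc n))"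
  defines "m \<equiv> (step ^^ k) (boundary_msg \<omega>)"
  shows "(\<Sum>\<eta>\<in>spins (tree_ball \<Delta> (Suc (n + k))). gibbs_weight \<Delta> lam \<theta> (tree_ball \<Delta> (Suc (n + k))) \<omega> \<eta>) = normalizer n m" (is ?th1)
    and "(\<Sum>\<eta>\<in>cyl (tree_ball \<Delta> (Suc (n + k))) (tree_ball \<Delta> (Suc n)) \<xi>.
      gibbs_kernel (tree_ball \<Delta> (Suc (n + k))) \<eta> \<omega>) = ball_weight n m \<xi> / normalizer n m" (is ?th2)
proof -
  let ?B = "tree_ball \<Delta> (Suc n)" and ?B' = "tree_ball \<Delta> (Suc (n + k))"
  have cyl: "(\<Sum>\<eta>\<in>cyl ?B' ?B \<zeta>. gibbs_weight \<Delta> lam \<theta> ?B' \<omega> \<eta>) = ball_weight n m \<zeta>"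
    if \<zeta>: "\<zeta> \<in> spins ?B" for \<zeta>
  proof -
    have "(\<Sum>\<eta>\<in>cyl ?B' ?B \<zeta>. gibbs_weight \<Delta> lam \<theta> ?B' \<omega> \<eta>)
        = sum (ball_weight (n + k) (boundary_msg \<omega>)) (cyl ?B' ?B \<zeta>)"
      by (intro sum.cong refl gibbs_weight_ball[OF \<omega>]) (simp add: cyl_def)
    then show ?thesis using sum_ball_weight[OF \<zeta>] by (simp add: m_def)
  qed
  have "(\<Sum>\<eta>\<in>spins ?B'. gibbs_weight \<Delta> lam \<theta> ?B' \<omega> \<eta>)
      = (\<Sum>\<zeta>\<in>spins ?B. \<Sum>\<eta>\<in>cyl ?B' ?B \<zeta>. gibbs_weight \<Delta> lam \<theta> ?B' \<omega> \<eta>)"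
    by (intro sum_spins_refine tree_ball_mono finite_tree_ball) simp
  then show th1: ?th1 by (simp add: cyl normalizer_def)
  show ?th2
    unfolding gibbs_kernel_def th1 sum_divide_distrib[symmetric] cyl[OF \<xi>] ..
qed

end

locale tree_contraction = tree_ratio +
  fixes a0 b0 \<beta> :: real
  assumes fixpoint: "hmap (a0, b0) = (a0, b0)" and a0: "a0 \<ge> 0" and b0: "b0 \<in> {l..r}"
    and \<beta>: "\<beta> \<ge> 0"
    and contr_a: "lam * r ^ Suc \<Delta> / \<theta> 0 * (real \<Delta> * (1 + \<beta>)) \<le> 1 / 2"
    and contr_b: "(r\<^sup>2 - l\<^sup>2) * real \<Delta> \<le> \<beta> / 2"
begin

text \<open>The scaling factor may vanish, which happens for infeasible boundary conditions.\<close>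

definition near_msg :: "real \<Rightarrow> (nat \<Rightarrow> nat \<Rightarrow> real) \<Rightarrow> bool" where
  "near_msg e m \<longleftrightarrow> (\<exists>\<kappa> a b. 0 \<le> a \<and> b \<in> {l..r} \<and> \<bar>a - a0\<bar> \<le> e \<and> \<bar>b - b0\<bar> \<le> \<beta> * e \<and>
     (\<forall>s\<in>{0, 1}. \<forall>p\<in>{0, 1}. m s p = \<kappa> * msg a b s p))"

lemma step_near_msg:
  assumes i: "i \<in> tree_nodes \<Delta>" "i \<noteq> []" and near: "\<And>k. k \<in> children \<Delta> i \<Longrightarrow> near_msg e (m k)"
    and e: "e \<ge> 0"
  shows "near_msg (e / 2) (step m i)"
proof -
  let ?C = "children \<Delta> i"
  obtain \<kappa> a b where m: "\<And>k. k \<in> ?C \<Longrightarrow> 0 \<le> a k \<and> b k \<in> {l..r} \<and> \<bar>a k - a0\<bar> \<le> e \<and> \<bar>b k - b0\<bar> \<le> \<beta> * e \<and>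
     (\<forall>s\<in>{0, 1}. \<forall>p\<in>{0, 1}. m k s p = \<kappa> k * msg (a k) (b k) s p)"
    using near unfolding near_msg_def by metis
  have card: "real (card ?C) \<le> real \<Delta>" using card_children_le[OF i(1)] by simp
  have a: "(\<Sum>k\<in>?C. \<bar>a k - a0\<bar>) \<le> real \<Delta> * e"
  proof -
    have "(\<Sum>k\<in>?C. \<bar>a k - a0\<bar>) \<le> real (card ?C) * e" using m by (intro sum_bounded_above) auto
    also have "\<dots> \<le> real \<Delta> * e" using card e by (rule mult_right_mono)
    finally show ?thesis .
  qed
  have b: "(\<Sum>k\<in>?C. \<bar>b k - b0\<bar>) \<le> real \<Delta> * (\<beta> * e)"
  proof -
    have "(\<Sum>k\<in>?C. \<bar>b k - b0\<bar>) \<le> real (card ?C) * (\<beta> * e)" using m by (intro sum_bounded_above) auto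
    also have "\<dots> \<le> real \<Delta> * (\<beta> * e)" using card e \<beta> by (intro mult_right_mono) auto
    finally show ?thesis .
  qed
  \<comment> \<open>The constant pair \<open>(a0, b0)\<close> is reproduced at \<open>i\<close>, so
    deviations from it are differences of two values of the recursion.\<close>
  have hom: "next_a (\<lambda>_. a0) (\<lambda>_. b0) i = a0" "next_b (\<lambda>_. a0) i = b0"
    using hmap_eq_next[OF i, of a0 b0] fixpoint by auto
  have lr: "x \<in> {0..r}" if "x \<in> {l..r}" for x using that l_pos by auto
  have "\<bar>next_a a b i - next_a (\<lambda>_. a0) (\<lambda>_. b0) i\<bar> \<le> lam * r ^ Suc \<Delta> / \<theta> 0 *
      ((\<Sum>k\<in>?C. \<bar>a k - a0\<bar>) + (\<Sum>k\<in>?C. \<bar>b k - b0\<bar>))"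
    using m a0 lr[OF b0] lr by (intro next_a_lipschitz i) blast+
  also have "\<dots> \<le> lam * r ^ Suc \<Delta> / \<theta> 0 * (real \<Delta> * e + real \<Delta> * (\<beta> * e))"
    using a b lam_pos r_ge \<theta>_pos[of 0] by (intro mult_left_mono add_mono) auto
  also have "\<dots> = lam * r ^ Suc \<Delta> / \<theta> 0 * (real \<Delta> * (1 + \<beta>)) * e"
    by (simp add: algebra_simps add_divide_distrib)
  also have "\<dots> \<le> 1 / 2 * e" by (rule mult_right_mono[OF contr_a e])
  finally have A: "\<bar>next_a a b i - a0\<bar> \<le> e / 2" by (simp add: hom)
  have "\<bar>next_b a i - next_b (\<lambda>_. a0) i\<bar> \<le> (r\<^sup>2 - l\<^sup>2) * (\<Sum>k\<in>?C. \<bar>a k - a0\<bar>)"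
    using m a0 by (intro next_b_lipschitz i) auto
  also have "\<dots> \<le> (r\<^sup>2 - l\<^sup>2) * (real \<Delta> * e)"
    using a l_le_r l_pos by (intro mult_left_mono) (auto intro: power_mono)
  also have "\<dots> = (r\<^sup>2 - l\<^sup>2) * real \<Delta> * e" by simp
  also have "\<dots> \<le> \<beta> / 2 * e" by (rule mult_right_mono[OF contr_b e])
  finally have B: "\<bar>next_b a i - b0\<bar> \<le> \<beta> * (e / 2)" by (simp add: hom)
  have "step m i s p = (\<Prod>k\<in>?C. \<kappa> k) * subset_poly \<theta> ?C a * msg (next_a a b i) (next_b a i) s p"
    if "s \<in> {0, 1}" "p \<in> {0, 1}" for s p
    by (rule step_msg[OF i(1) _ _ that]) (use m in blast)+
  moreover have "0 \<le> next_a a b i"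
  proof (rule next_a_nonneg[OF i(1)])
    show "0 \<le> a k \<and> 0 \<le> b k" if "k \<in> ?C" for k using m[OF that] l_pos by auto
  qed
  moreover have "next_b a i \<in> {l..r}"
    using next_b_bounds[OF i, of a] m by auto
  ultimately show ?thesis
    unfolding near_msg_def using A B by blast
qed

text \<open>With two layers frozen, the message is a plain product of site weights. Its
  \<open>b\<close> is the ratio \<theta>_(n+1)/\<theta>_n for n occupied children; its
  \<open>a\<close> is nonzero only if no child is occupied, and then collects one such ratio for
  each child. The scaling factor is the weight at spin 0 and empty parent, possibly 0. The bound
  \<open>e\<close> is uniform in the boundary condition.\<close>

lemma boundary_msg_near:
  assumes i: "i \<in> tree_nodes \<Delta>" "i \<noteq> []" and \<omega>: "\<omega> \<in> spins (tree_nodes \<Delta>)"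
    and e: "e \<ge> lam * r ^ \<Delta> / \<theta> 0 + a0" "\<beta> * e \<ge> r - l"
  shows "near_msg e (boundary_msg \<omega> i)"
proof -
  let ?C = "children \<Delta> i"
  define n where "n k = occ \<omega> (children \<Delta> k)" for k
  have \<omega>01: "\<omega> k \<in> {0, 1}" if "k \<in> ?C" for k using \<omega> that by (auto simp: children_def PiE_iff)
  have nC: "n k < \<Delta>" if "k \<in> ?C" for k
    using that card_children_nonroot[of k] occ_le[OF finite_children, of \<omega> \<Delta> k] by (auto simp: children_def n_def)
  have nI: "n i < \<Delta>"
    using card_children_nonroot[OF i] occ_le[OF finite_children, of \<omega> \<Delta> i] by (simp add: n_def)
  have ratio: "\<theta> (Suc k) / \<theta> k \<in> {l..r}" if "k < \<Delta>" for k
    using ratio_ge[OF that] ratio_le[OF that] \<theta>_pos[of k] that by (simp add: field_simps)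
  define Q where "Q = (\<Prod>k\<in>?C. spin_weight (\<omega> k) (n k))"
  define a where "a = (if n i = 0 then lam * (\<Prod>k\<in>?C. \<theta> (Suc (n k)) / \<theta> (n k)) / \<theta> 0 else 0)"
  define b where "b = \<theta> (Suc (n i)) / \<theta> (n i)"
  have bm: "boundary_msg \<omega> i s p = spin_weight s (p + n i) * (\<Prod>k\<in>?C. spin_weight (\<omega> k) (s + n k))" for s p
    by (simp add: boundary_msg_def step_at_def n_def)
  have \<theta>n: "\<theta> (n i) > 0" using nI by (intro \<theta>_pos) simp
  have "boundary_msg \<omega> i s p = \<theta> (n i) * Q * msg a b s p" if sp: "s \<in> {0, 1}" "p \<in> {0, 1}" for s p
  proof (cases "s = 0")
    case True
    then show ?thesis
      using sp \<theta>n by (auto simp: bm spin_weight_def Q_def msg_def b_def plus_1_eq_Suc)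
  next
    case False
    then have s: "s = 1" using sp by simp
    show ?thesis
    proof (cases "p = 0 \<and> n i = 0")
      case True
      then have zero: "\<omega> k = 0" if "k \<in> ?C" for k
        using \<omega>01[OF that] that finite_children[of \<Delta> i] by (auto simp: n_def occ_def)
      have "(\<Prod>k\<in>?C. spin_weight (\<omega> k) (s + n k)) = (\<Prod>k\<in>?C. \<theta> (n k) * (\<theta> (Suc (n k)) / \<theta> (n k)))"
      proof (rule prod.cong[OF refl])
        fix k assume k: "k \<in> ?C"
        have "\<theta> (n k) > 0" using nC[OF k] by (intro \<theta>_pos) simp
        then show "spin_weight (\<omega> k) (s + n k) = \<theta> (n k) * (\<theta> (Suc (n k)) / \<theta> (n k))"
          by (simp add: zero[OF k] spin_weight_def s plus_1_eq_Suc)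
      qed
      also have "\<dots> = Q * (\<Prod>k\<in>?C. \<theta> (Suc (n k)) / \<theta> (n k))"
        unfolding prod.distrib Q_def by (simp add: zero spin_weight_def)
      finally show ?thesis
        using True \<theta>n by (simp add: bm s spin_weight_def msg_def a_def)
    next
      case False
      then show ?thesis by (auto simp: bm s spin_weight_def msg_def a_def)
    qed
  qed
  moreover have a: "0 \<le> a" "a \<le> lam * r ^ \<Delta> / \<theta> 0"
  proof -
    have r: "0 \<le> \<theta> (Suc (n k)) / \<theta> (n k) \<and> \<theta> (Suc (n k)) / \<theta> (n k) \<le> r" if "k \<in> ?C" for k
      using ratio[OF nC[OF that]] l_pos by auto
    have "0 \<le> (\<Prod>k\<in>?C. \<theta> (Suc (n k)) / \<theta> (n k))" by (intro prod_nonneg ballI) (use r in blast)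
    moreover have "(\<Prod>k\<in>?C. \<theta> (Suc (n k)) / \<theta> (n k)) \<le> r ^ \<Delta>"
      by (rule prod_children_le[OF i(1)]) (use r in auto)
    ultimately show "0 \<le> a" "a \<le> lam * r ^ \<Delta> / \<theta> 0"
      using lam_pos \<theta>_pos[of 0] r_ge by (auto simp: a_def intro!: divide_right_mono mult_left_mono)
  qed
  moreover have b: "b \<in> {l..r}" unfolding b_def by (rule ratio[OF nI])
  moreover have "\<bar>a - a0\<bar> \<le> e" using a a0 e(1) by auto
  moreover have "\<bar>b - b0\<bar> \<le> \<beta> * e" using b b0 e(2) by auto
  ultimately show ?thesis
    unfolding near_msg_def by blast
qed

lemma funpow_step_near_msg:
  assumes "\<And>i. i \<in> tree_sphere \<Delta> (Suc n + k) \<Longrightarrow> near_msg e (m i)" "e \<ge> 0"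
    and "i \<in> tree_sphere \<Delta> (Suc n)"
  shows "near_msg (e / 2 ^ k) ((step ^^ k) m i)"
  using assms(1,3)
proof (induction k arbitrary: n i)
  case (Suc k)
  have "near_msg (e / 2 ^ k / 2) (step ((step ^^ k) m) i)"
  proof (rule step_near_msg)
    fix j assume "j \<in> children \<Delta> i"
    then have "j \<in> tree_sphere \<Delta> (Suc (Suc n))"
      using Suc.prems(2) by (auto simp: tree_sphere_Suc[of \<Delta> "Suc n"])
    then show "near_msg (e / 2 ^ k) ((step ^^ k) m j)"
      using Suc.prems(1) by (intro Suc.IH) auto
  qed (use Suc.prems(2) assms(2) in \<open>auto simp: tree_sphere_def\<close>)
  then show ?case by (simp add: mult.commute)
qed simp

text \<open>The scaling factors appear in numerator and normaliser alike and cancel, as the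
  normaliser is nonzero. What remains is a continuous function of finitely many pairs converging to
  \<open>(a0, b0)\<close>.\<close>

lemma tendsto_ball_weight:
  assumes near: "\<And>k i. i \<in> tree_sphere \<Delta> (Suc n) \<Longrightarrow> near_msg (e / 2 ^ k) (M k i)"
    and nz: "\<And>k. normalizer n (M k) \<noteq> 0"
    and \<xi>: "\<xi> \<in> spins (tree_ball \<Delta> (Suc n))"
  shows "(\<lambda>k. ball_weight n (M k) \<xi> / normalizer n (M k)) \<longlonglongrightarrow>
    ball_weight n (\<lambda>_. msg a0 b0) \<xi> / normalizer n (\<lambda>_. msg a0 b0)"
proof -
  let ?S = "tree_sphere \<Delta> (Suc n)"
  have "\<forall>k. \<forall>i. \<exists>\<kappa> a b. i \<in> ?S \<longrightarrow> (0 \<le> a \<and> b \<in> {l..r} \<and> \<bar>a - a0\<bar> \<le> e / 2 ^ k \<and> \<bar>b - b0\<bar> \<le> \<beta> * (e / 2 ^ k) \<and>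
     (\<forall>s\<in>{0, 1}. \<forall>p\<in>{0, 1}. M k i s p = \<kappa> * msg a b s p))"
    using near unfolding near_msg_def by blast
  then obtain \<kappa> a b where M: "\<And>k i. i \<in> ?S \<Longrightarrow> 0 \<le> a k i \<and> b k i \<in> {l..r} \<and> \<bar>a k i - a0\<bar> \<le> e / 2 ^ k \<and>
      \<bar>b k i - b0\<bar> \<le> \<beta> * (e / 2 ^ k) \<and> (\<forall>s\<in>{0, 1}. \<forall>p\<in>{0, 1}. M k i s p = \<kappa> k i * msg (a k i) (b k i) s p)"
    by metis
  define m where "m k i = msg (a k i) (b k i)" for k i
  have scale: "ball_weight n (M k) \<eta> = (\<Prod>i\<in>?S. \<kappa> k i) * ball_weight n (m k) \<eta>"
    if "\<eta> \<in> spins (tree_ball \<Delta> (Suc n))" for k \<eta>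
    by (rule ball_weight_scale[OF that]) (use M in \<open>auto simp: m_def\<close>)
  have scaleZ: "normalizer n (M k) = (\<Prod>i\<in>?S. \<kappa> k i) * normalizer n (m k)" for k
    by (simp add: normalizer_def scale sum_distrib_left)
  have eq: "ball_weight n (M k) \<xi> / normalizer n (M k) = ball_weight n (m k) \<xi> / normalizer n (m k)" for k
    using nz[of k] by (simp add: scale[OF \<xi>] scaleZ)
  have lim0: "(\<lambda>k. c * (e / 2 ^ k)) \<longlonglongrightarrow> 0" for c
    using tendsto_mult_right_zero[OF LIMSEQ_divide_realpow_zero[of 2 e], of c] by simp
  have a: "(\<lambda>k. a k i) \<longlonglongrightarrow> a0" if "i \<in> ?S" for i
  proof (rule LIM_zero_cancel, rule tendsto_rabs_zero_cancel, rule tendsto_sandwich[OF _ _ tendsto_const lim0[of 1]])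
    show "\<forall>\<^sub>F k in sequentially. \<bar>a k i - a0\<bar> \<le> 1 * (e / 2 ^ k)" using M[OF that] by simp
  qed simp
  have b: "(\<lambda>k. b k i) \<longlonglongrightarrow> b0" if "i \<in> ?S" for i
  proof (rule LIM_zero_cancel, rule tendsto_rabs_zero_cancel, rule tendsto_sandwich[OF _ _ tendsto_const lim0[of \<beta>]])
    show "\<forall>\<^sub>F k in sequentially. \<bar>b k i - b0\<bar> \<le> \<beta> * (e / 2 ^ k)" using M[OF that] by simp
  qed simp
  have m: "(\<lambda>k. m k i s p) \<longlonglongrightarrow> msg a0 b0 s p" if "i \<in> ?S" for i s p
    using a[OF that] b[OF that] by (simp add: m_def msg_def)
  have W: "(\<lambda>k. ball_weight n (m k) \<eta>) \<longlonglongrightarrow> ball_weight n (\<lambda>_. msg a0 b0) \<eta>" for \<eta>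
    unfolding ball_weight_def by (intro tendsto_mult tendsto_const tendsto_prod m)
  have "normalizer n (\<lambda>_. msg a0 b0) > 0"
    using normalizer_pos[of n "\<lambda>_. a0" "\<lambda>_. b0"] a0 b0 l_pos by simp
  then show ?thesis
    unfolding eq by (intro tendsto_divide W) (auto simp: normalizer_def intro!: tendsto_sum W)
qed

text \<open>The probability is, for every \<open>k\<close>, the mean of the conditional probability
  \<open>H k\<close> given the spins outside a ball with \<open>k\<close> more layers. Almost surely
  \<open>H k\<close> tends to a value free of the boundary condition, and dominated convergence
  identifies the probability with it.\<close>

lemma gibbs_measure_marginals:
  assumes \<mu>: "gibbs_measure \<Delta> lam \<theta> \<mu>" and \<xi>: "\<xi> \<in> spins (tree_ball \<Delta> (Suc n))"
  shows "measure \<mu> (cyl (tree_nodes \<Delta>) (tree_ball \<Delta> (Suc n)) \<xi>)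
    = ball_weight n (\<lambda>_. msg a0 b0) \<xi> / normalizer n (\<lambda>_. msg a0 b0)"
proof -
  let ?V = "tree_nodes \<Delta>" and ?B = "\<lambda>k. tree_ball \<Delta> (Suc (n + k))"
  let ?L = "ball_weight n (\<lambda>_. msg a0 b0) \<xi> / normalizer n (\<lambda>_. msg a0 b0)"
  have prob: "prob_space \<mu>" and sets: "sets \<mu> = sets (config_space (tree_nodes \<Delta>))"
    using \<mu> unfolding gibbs_measure_alt by auto
  interpret prob_space \<mu> by (rule prob)
  have sp: "space \<mu> = spins ?V"
    using sets_eq_imp_space_eq[OF sets] by (simp add: config_space_def space_PiM_spins)
  have cylm: "cyl ?V (?B k) \<eta> \<in> sets \<mu>" for k \<eta>
    using sets_cyl[OF finite_tree_ball tree_ball_subset] sets by (simp add: config_space_def)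
  define H where "H k \<omega> = (\<Sum>\<eta>\<in>cyl (?B k) (?B 0) \<xi>. gibbs_kernel (?B k) \<eta> \<omega>)" for k \<omega>
  have spins: "\<eta> \<in> spins (?B k)" if "\<eta> \<in> cyl (?B k) (?B 0) \<xi>" for \<eta> k
    using that by (simp add: cyl_def)
  have H_int: "integrable \<mu> (H k)" for k
    unfolding H_def using gibbs_measure_cyl(1)[OF \<mu> finite_tree_ball tree_ball_subset spins]
    by (intro Bochner_Integration.integrable_sum) auto
  have P: "measure \<mu> (cyl ?V (?B 0) \<xi>) = (\<integral>\<omega>. H k \<omega> \<partial>\<mu>)" for k
  proof -
    have "cyl ?V (?B 0) \<xi> = (\<Union>\<eta>\<in>cyl (?B k) (?B 0) \<xi>. cyl ?V (?B k) \<eta>)"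
      by (intro cyl_refine tree_ball_mono tree_ball_subset) simp
    then have "measure \<mu> (cyl ?V (?B 0) \<xi>) = (\<Sum>\<eta>\<in>cyl (?B k) (?B 0) \<xi>. measure \<mu> (cyl ?V (?B k) \<eta>))"
      using cylm cyl_disjoint[of _ _ ?V "?B k"]
      by (simp only:) (intro finite_measure_finite_Union finite_cyl finite_tree_ball,
        auto simp: disjoint_family_on_def)
    also have "\<dots> = (\<Sum>\<eta>\<in>cyl (?B k) (?B 0) \<xi>. \<integral>\<omega>. gibbs_kernel (?B k) \<eta> \<omega> \<partial>\<mu>)"
      by (intro sum.cong refl gibbs_measure_cyl(2)[OF \<mu> finite_tree_ball tree_ball_subset spins])
    also have "\<dots> = (\<integral>\<omega>. H k \<omega> \<partial>\<mu>)"
      unfolding H_def using gibbs_measure_cyl(1)[OF \<mu> finite_tree_ball tree_ball_subset spins]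
      by (intro Bochner_Integration.integral_sum[symmetric]) auto
    finally show ?thesis .
  qed
  \<comment> \<open>The first two summands bound |a - a0| for every boundary message, the last one
    makes \<open>\<beta> * e\<close> at least \<open>r - l\<close>. For \<open>\<beta> = 0\<close>
    the quotient is 0 by convention, and \<open>contr_b\<close> gives r <= l.\<close>
  define e where "e = lam * r ^ \<Delta> / \<theta> 0 + a0 + (r - l) / \<beta>"
  have "AE \<omega> in \<mu>. \<forall>k. (\<Sum>\<eta>\<in>spins (?B k). gibbs_weight \<Delta> lam \<theta> (?B k) \<omega> \<eta>) \<noteq> 0"
    unfolding AE_all_countable
    by (intro allI gibbs_measure_normalizer_nonzero[OF \<mu> finite_tree_ball tree_ball_subset])
  then have lim: "AE \<omega> in \<mu>. (\<lambda>k. H k \<omega>) \<longlonglongrightarrow> ?L"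
  proof (rule AE_mp, intro AE_I2 impI)
    fix \<omega> assume "\<omega> \<in> space \<mu>" and nz: "\<forall>k. (\<Sum>\<eta>\<in>spins (?B k). gibbs_weight \<Delta> lam \<theta> (?B k) \<omega> \<eta>) \<noteq> 0"
    then have \<omega>: "\<omega> \<in> spins ?V" by (simp add: sp)
    let ?M = "\<lambda>k. (step ^^ k) (boundary_msg \<omega>)"
    have H: "H k \<omega> = ball_weight n (?M k) \<xi> / normalizer n (?M k)" for k
      unfolding H_def using sum_cyl_gibbs_kernel_ball(2)[OF \<omega> \<xi>, of k] by simp
    have lr: "r - l \<ge> 0" using l_le_r by simp
    have e0: "lam * r ^ \<Delta> / \<theta> 0 \<ge> 0" using lam_pos r_ge \<theta>_pos[of 0] by simp
    have "(r - l) / \<beta> \<ge> 0" using lr \<beta> by simp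
    then have e1: "e \<ge> 0" "e \<ge> lam * r ^ \<Delta> / \<theta> 0 + a0" using e0 a0 by (auto simp: e_def)
    have e2: "\<beta> * e \<ge> r - l"
    proof (cases "\<beta> = 0")
      case True
      then have "r\<^sup>2 \<le> l\<^sup>2" using contr_b \<Delta>_ge by (simp add: mult_le_0_iff)
      then have "r \<le> l" using l_pos by (meson less_imp_le power2_le_imp_le)
      then show ?thesis using True by simp
    next
      case False
      then have "\<beta> * e = \<beta> * (lam * r ^ \<Delta> / \<theta> 0 + a0) + (r - l)" by (simp add: e_def distrib_left)
      then show ?thesis using e0 a0 \<beta> by simp
    qed
    have near: "near_msg (e / 2 ^ k) (?M k i)" if "i \<in> tree_sphere \<Delta> (Suc n)" for k i
    proof (rule funpow_step_near_msg[OF _ e1(1) that])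
      fix j assume "j \<in> tree_sphere \<Delta> (Suc n + k)"
      then show "near_msg e (boundary_msg \<omega> j)"
        by (intro boundary_msg_near \<omega> e1 e2) (auto simp: tree_sphere_def)
    qed
    show "(\<lambda>k. H k \<omega>) \<longlonglongrightarrow> ?L"
      unfolding H
      by (rule tendsto_ball_weight[OF near]) (use nz sum_cyl_gibbs_kernel_ball(1)[OF \<omega> \<xi>] \<xi> in auto)
  qed
  have "(\<lambda>k. \<integral>\<omega>. H k \<omega> \<partial>\<mu>) \<longlonglongrightarrow> (\<integral>\<omega>. ?L \<partial>\<mu>)"
  proof (rule integral_dominated_convergence[where w="\<lambda>_. 1"])
    show "AE \<omega> in \<mu>. norm (H k \<omega>) \<le> 1" for k
    proof (rule AE_I2)
      fix \<omega>
      have "H k \<omega> \<le> (\<Sum>\<eta>\<in>spins (?B k). gibbs_kernel (?B k) \<eta> \<omega>)"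
        unfolding H_def using spins
        by (intro sum_mono2 finite_spins finite_tree_ball gibbs_kernel_nonneg subsetI)
      also have "\<dots> \<le> 1" by (simp add: sum_gibbs_kernel[OF finite_tree_ball])
      finally show "norm (H k \<omega>) \<le> 1"
        using gibbs_kernel_nonneg by (simp add: H_def sum_nonneg)
    qed
  qed (use lim H_int in auto)
  then show ?thesis
    unfolding P[symmetric] by (simp add: prob_space LIMSEQ_const_iff)
qed

text \<open>For existence, a fixed point is taken as a cycle of length two whose points coincide;
  for uniqueness, the marginals on balls determine the measure.\<close>

lemma uniqueness: "uniqueness_regime \<Delta> lam \<theta>"
  unfolding uniqueness_regime_def
proof (rule ex_ex1I)
  show "\<exists>\<mu>. gibbs_measure \<Delta> lam \<theta> \<mu>"
    using gibbs_measure_of_two_cycle[of "\<lambda>_. a0" "\<lambda>_. b0"] fixpoint a0 b0 l_pos by auto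
next
  fix \<mu> \<nu> assume \<mu>: "gibbs_measure \<Delta> lam \<theta> \<mu>" and \<nu>: "gibbs_measure \<Delta> lam \<theta> \<nu>"
  have *: "prob_space \<rho> \<and> sets \<rho> = sets (\<Pi>\<^sub>M i\<in>tree_nodes \<Delta>. count_space {0, 1})"
    if "gibbs_measure \<Delta> lam \<theta> \<rho>" for \<rho>
    using that unfolding gibbs_measure_alt config_space_def by auto
  have fin: "finite_measure \<mu>" "finite_measure \<nu>" using *[OF \<mu>] *[OF \<nu>] by (auto simp: prob_space_def)
  show "\<mu> = \<nu>"
  proof (rule measure_eqI_cyl[where C="\<lambda>n. tree_ball \<Delta> (Suc n)" and V="tree_nodes \<Delta>" and N=0])
    fix n \<zeta> assume "\<zeta> \<in> spins (tree_ball \<Delta> (Suc n))"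
    then show "emeasure \<mu> (cyl (tree_nodes \<Delta>) (tree_ball \<Delta> (Suc n)) \<zeta>) = emeasure \<nu> (cyl (tree_nodes \<Delta>) (tree_ball \<Delta> (Suc n)) \<zeta>)"
      using fin gibbs_measure_marginals[OF \<mu>] gibbs_measure_marginals[OF \<nu>]
      by (simp add: finite_measure.emeasure_eq_measure)
  next
    show "incseq (\<lambda>n. tree_ball \<Delta> (Suc n))" by (auto simp: incseq_def tree_ball_def)
  qed (use *[OF \<mu>] *[OF \<nu>] fin in \<open>auto simp: finite_tree_ball UN_tree_ball_Suc\<close>)
qed

end

subsection \<open>Coexistence of Gibbs measures and bounds on the critical activity\<close>

context tree_model
begin

lemma tree_ball_0: "tree_ball \<Delta> 0 = {[]}"
  by (auto simp: tree_ball_def tree_nodes_def)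

lemma ball_weight_single_child:
  assumes k: "k \<in> tree_sphere \<Delta> 1"
  shows "ball_weight 0 (\<lambda>i. msg (a (length i mod 2)) (b (length i mod 2)))
    ((zero_config (tree_ball \<Delta> 1))(k := 1)) = \<theta> 1 * a 1"
proof -
  let ?\<eta> = "(zero_config (tree_ball \<Delta> 1))(k := 1)"
  have root: "?\<eta> [] = 0"
    using k tree_ball_0 by (auto simp: zero_config_def tree_sphere_def tree_ball_def tree_nodes_def)
  have S: "?\<eta> i = (if i = k then 1 else 0)" if "i \<in> tree_sphere \<Delta> 1" for i
    using that by (auto simp: zero_config_def tree_sphere_def tree_ball_def)
  have nbrs: "tree_nbrs \<Delta> [] = tree_sphere \<Delta> 1"
    by (auto simp: tree_nbrs_def tree_sphere_def tree_nodes_def length_Suc_conv One_nat_def)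
  have "?\<eta> i = 1 \<longleftrightarrow> i = k" if "i \<in> tree_sphere \<Delta> 1" for i
    unfolding S[OF that] by simp
  then have "{j \<in> tree_nbrs \<Delta> []. ?\<eta> j = 1} = {k}"
    using k unfolding nbrs by blast
  then have "site_weight [] ?\<eta> = \<theta> 1"
    unfolding site_weight_def occ_def root by (simp add: spin_weight_def One_nat_def)
  moreover have "(\<Prod>i\<in>tree_sphere \<Delta> 1. msg (a (length i mod 2)) (b (length i mod 2)) (?\<eta> i) (?\<eta> (tl i)))
      = (\<Prod>i\<in>tree_sphere \<Delta> 1. if i = k then a 1 else 1)"
  proof (rule prod.cong[OF refl])
    fix i assume i: "i \<in> tree_sphere \<Delta> 1"
    then have "length i = 1" by (simp add: tree_sphere_def)
    moreover from this have "tl i = []" by (cases i) auto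
    ultimately show "msg (a (length i mod 2)) (b (length i mod 2)) (?\<eta> i) (?\<eta> (tl i)) = (if i = k then a 1 else 1)"
      using root S[OF i] by (simp add: msg_def)
  qed
  ultimately show ?thesis
    using k by (simp add: ball_weight_def tree_ball_0 One_nat_def[symmetric] prod.delta[OF finite_tree_sphere])
qed

end

context tree_ratio
begin

text \<open>The two Gibbs measures differ in the relative weight of one occupied neighbour of the root.\<close>

lemma nonuniqueness:
  assumes box: "0 \<le> \<alpha>'" "\<beta>' < \<alpha>" "\<alpha> \<le> \<beta>"
    and up: "\<And>x. x \<in> {\<alpha>..\<beta>} \<times> {l..r} \<Longrightarrow> hmap x \<in> {\<alpha>'..\<beta>'} \<times> {l..r}"
    and down: "\<And>x. x \<in> {\<alpha>'..\<beta>'} \<times> {l..r} \<Longrightarrow> hmap x \<in> {\<alpha>..\<beta>} \<times> {l..r}"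
  shows "\<not> uniqueness_regime \<Delta> lam \<theta>"
proof
  assume unique: "uniqueness_regime \<Delta> lam \<theta>"
  \<comment> \<open>The low box contains the image of this point, hence 0 <= \<alpha>' <= \<beta>' <
    \<alpha>.\<close>
  have "(\<alpha>, l) \<in> {\<alpha>..\<beta>} \<times> {l..r}" using box l_le_r by auto
  from up[OF this] have \<alpha>: "\<alpha> \<ge> 0" using box by (cases "hmap (\<alpha>, l)") auto
  obtain x where x: "x \<in> {\<alpha>..\<beta>} \<times> {l..r}" "hmap (hmap x) = x"
    using hmap_two_cycle[OF \<alpha> box(3,1) up down] by blast
  obtain a b where ab: "x = (a, b)" "a \<ge> \<alpha>" "b \<ge> l" using x(1) by auto
  obtain a' b' where ab': "hmap x = (a', b')" "0 \<le> a'" "a' \<le> \<beta>'" "b' \<ge> l"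
    using up[OF x(1)] box by (cases "hmap x") auto
  have B1: "tree_ball \<Delta> (Suc 0) = tree_ball \<Delta> 1" by (simp add: One_nat_def)
  let ?V = "tree_nodes \<Delta>" and ?B = "tree_ball \<Delta> 1" and ?z = "zero_config (tree_ball \<Delta> 1)" and ?k = "[0::nat]"
  have k: "?k \<in> tree_sphere \<Delta> 1" using \<Delta>_ge by (auto simp: tree_sphere_def tree_nodes_def)
  have kB: "?k \<in> ?B" using k by (auto simp: tree_sphere_def tree_ball_def)
  have \<eta>: "?z(?k := 1) \<in> spins ?B"
    using kB by (auto simp: zero_config_def PiE_iff extensional_def)
  \<comment> \<open>Dividing by the probability of the empty configuration removes the normaliser,
    which may differ between the two measures; the quotient then reveals \<open>A 1\<close>, the
    value at the children of the root.\<close>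
  have ratio: "\<exists>\<mu>. gibbs_measure \<Delta> lam \<theta> \<mu> \<and> measure \<mu> (cyl ?V ?B ?z) > 0 \<and>
      measure \<mu> (cyl ?V ?B (?z(?k := 1))) / measure \<mu> (cyl ?V ?B ?z) = \<theta> 1 * A 1 / \<theta> 0"
    if AB: "hmap (A 0, B 0) = (A 1, B 1)" "hmap (A 1, B 1) = (A 0, B 0)" "\<And>j. A j \<ge> 0 \<and> B j \<ge> 0" for A B :: "nat \<Rightarrow> real"
  proof -
    define m where "m = (\<lambda>i :: nat list. msg (A (length i mod 2)) (B (length i mod 2)))"
    obtain \<mu> where \<mu>: "gibbs_measure \<Delta> lam \<theta> \<mu>"
      and marg: "\<And>n \<eta>. \<eta> \<in> spins (tree_ball \<Delta> (Suc n)) \<Longrightarrow>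
        measure \<mu> (cyl ?V (tree_ball \<Delta> (Suc n)) \<eta>) = ball_weight n m \<eta> / normalizer n m"
      using gibbs_measure_of_two_cycle[OF AB] unfolding m_def by blast
    have Z: "normalizer 0 m > 0" unfolding m_def using AB(3) by (intro normalizer_pos) auto
    have "ball_weight 0 m ?z = \<theta> 0"
      unfolding m_def using ball_weight_zero_config[of 0] by (simp add: B1 tree_ball_0)
    then have 1: "measure \<mu> (cyl ?V ?B ?z) = \<theta> 0 / normalizer 0 m"
      using marg[of ?z 0] zero_config_spins[of ?B] by (simp add: B1)
    have "measure \<mu> (cyl ?V ?B (?z(?k := 1))) = \<theta> 1 * A 1 / normalizer 0 m"
      using marg[of "?z(?k := 1)" 0] \<eta> ball_weight_single_child[OF k, of A B] by (simp add: B1 m_def)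
    with 1 show ?thesis using \<mu> Z \<theta>_pos[of 0] by (intro exI[of _ \<mu>]) simp
  qed
  have "\<exists>\<mu>. gibbs_measure \<Delta> lam \<theta> \<mu> \<and> measure \<mu> (cyl ?V ?B ?z) > 0 \<and>
      measure \<mu> (cyl ?V ?B (?z(?k := 1))) / measure \<mu> (cyl ?V ?B ?z) = \<theta> 1 * a' / \<theta> 0"
    using ratio[of "\<lambda>j. if j = 0 then a else a'" "\<lambda>j. if j = 0 then b else b'"] x(2) ab ab' \<alpha> l_pos by simp
  moreover have "\<exists>\<mu>. gibbs_measure \<Delta> lam \<theta> \<mu> \<and> measure \<mu> (cyl ?V ?B ?z) > 0 \<and>
      measure \<mu> (cyl ?V ?B (?z(?k := 1))) / measure \<mu> (cyl ?V ?B ?z) = \<theta> 1 * a / \<theta> 0"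
    using ratio[of "\<lambda>j. if j = 0 then a' else a" "\<lambda>j. if j = 0 then b' else b"] x(2) ab ab' \<alpha> l_pos by simp
  ultimately have "\<theta> 1 * a' / \<theta> 0 = \<theta> 1 * a / \<theta> 0"
    using unique unfolding uniqueness_regime_def by metis
  then have "a' = a" using \<theta>_pos[of 0] \<theta>_pos[of 1] \<Delta>_ge by simp
  then show False using ab ab' box by simp
qed

end

text \<open>The first three terms of the binomial expansion. The quadratic one matters: at u = S/(2
  \<Delta>), in the notation of the large-activity argument, the linear term is below S/2, while the
  power has to reach S e^(2c+2).\<close>

lemma quadratic_le_power:
  fixes u :: real
  assumes "u \<ge> 0"
  shows "1 + real d * u + real d * (real d - 1) / 2 * u\<^sup>2 \<le> (1 + u) ^ d"
proof (induction d)
  case (Suc d)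
  have "0 \<le> real d * (real d - 1)" by (cases d) auto
  then have "0 \<le> real d * (real d - 1) / 2 * u ^ 3" using assms by simp
  then have "1 + real (Suc d) * u + real (Suc d) * (real (Suc d) - 1) / 2 * u\<^sup>2
      \<le> (1 + u) * (1 + real d * u + real d * (real d - 1) / 2 * u\<^sup>2)"
    by (simp add: field_simps power2_eq_square power3_eq_cube)
  also have "\<dots> \<le> (1 + u) * (1 + u) ^ d" using Suc assms by (intro mult_left_mono) auto
  finally show ?case by simp
qed simp

lemma one_plus_power_le_exp:
  fixes c :: real
  assumes "0 \<le> c" "n > 0" "d \<le> n"
  shows "(1 + c / real n) ^ d \<le> exp c"
proof -
  have "(1 + c / real n) ^ d \<le> (1 + c / real n) ^ n"
    using assms by (intro power_increasing) auto
  also have "\<dots> \<le> exp (c / real n) ^ n"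
    using assms by (intro power_mono) (auto simp: exp_ge_add_one_self)
  also have "\<dots> = exp c" using assms by (simp add: exp_of_nat_mult[symmetric])
  finally show ?thesis .
qed

section \<open>Ratios of log-convex vectors, and the two regimes of the activity\<close>

lemma log_convex_ratio_mono:
  assumes "log_convex n x" "k \<le> m" "m < n"
  shows "x (Suc k) / x k \<le> x (Suc m) / x m"
  using assms(2,3)
proof (induction m rule: dec_induct)
  case (step m)
  have "Suc m \<in> {1..n - 1}" using step by auto
  then have "x (Suc m + 1) / x (Suc m) \<ge> x (Suc m) / x (Suc m - 1)"
    using assms(1) unfolding log_convex_def by blast
  then show ?case using step by (simp add: One_nat_def)
qed simp

text \<open>Consecutive ratios increase, so it is enough to bound the last from above and the first
  from below; the maximum consists of the last ratio and the inverse of the first.\<close>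

lemma log_convex_ratio_bounds:
  assumes lc: "log_convex \<Delta> \<theta>" and k: "k < \<Delta>"
    and max: "max (\<theta> \<Delta> / \<theta> (\<Delta> - 1)) (\<theta> 0 / \<theta> 1) \<le> r"
  shows "\<theta> (Suc k) / \<theta> k \<le> r" "1 / r \<le> \<theta> (Suc k) / \<theta> k"
proof -
  have pos: "\<theta> j > 0" if "j \<le> \<Delta>" for j using lc that by (simp add: log_convex_def)
  have "\<theta> (Suc k) / \<theta> k \<le> \<theta> (Suc (\<Delta> - 1)) / \<theta> (\<Delta> - 1)"
    using k by (intro log_convex_ratio_mono[OF lc]) auto
  then show "\<theta> (Suc k) / \<theta> k \<le> r" using max k by simp
  have "0 < \<theta> 0 / \<theta> 1" "\<theta> 0 / \<theta> 1 \<le> r" using max pos[of 0] pos[of 1] k by auto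
  then have "1 / r \<le> 1 / (\<theta> 0 / \<theta> 1)" by (intro divide_left_mono mult_pos_pos) auto
  also have "\<dots> = \<theta> (Suc 0) / \<theta> 0" by (simp add: One_nat_def)
  also have "\<dots> \<le> \<theta> (Suc k) / \<theta> k"
    using k by (intro log_convex_ratio_mono[OF lc]) auto
  finally show "1 / r \<le> \<theta> (Suc k) / \<theta> k" .
qed

lemma tree_ratio_log_convex:
  assumes "\<Delta> \<ge> 3" "log_convex \<Delta> \<theta>" "0 \<le> c" "lam > 0"
    and "max (\<theta> \<Delta> / \<theta> (\<Delta> - 1)) (\<theta> 0 / \<theta> 1) \<le> 1 + c / real \<Delta>"
  shows "tree_ratio \<Delta> lam \<theta> (1 / (1 + c / real \<Delta>)) (1 + c / real \<Delta>)"
proof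
  show pos: "\<theta> k > 0" if "k \<le> \<Delta>" for k using assms(2) that by (simp add: log_convex_def)
  have r: "1 + c / real \<Delta> \<ge> 1" using assms(3) by simp
  then show "1 / (1 + c / real \<Delta>) > 0" by simp
  show "1 / (1 + c / real \<Delta>) * \<theta> k \<le> \<theta> (Suc k)" if "k < \<Delta>" for k
    using log_convex_ratio_bounds(2)[OF assms(2) that assms(5)] pos[of k] that
    by (simp add: pos_le_divide_eq del: times_divide_eq_left)
  show "\<theta> (Suc k) \<le> (1 + c / real \<Delta>) * \<theta> k" if "k < \<Delta>" for k
    using log_convex_ratio_bounds(1)[OF assms(2) that assms(5)] pos[of k] that
    by (simp add: pos_divide_le_eq)
qed (use assms in auto)

text \<open>The weight is \<beta> = 8 c because the total slope 4 c of \<open>b\<close> has to be at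
  most \<beta>/2. Since r <= 2, r^(\<Delta>+1) <= 2 e^c, and \<open>contr_a\<close> then asks for
  lam \<Delta>/\<theta>_0 <= e^(-c)/(4 (1 + 8 c)).\<close>

lemma uniqueness_small_activity:
  assumes \<Delta>: "\<Delta> \<ge> 3" and lc: "log_convex \<Delta> \<theta>" and c: "0 \<le> c" "c \<le> real \<Delta>" and lam: "lam > 0"
    and max: "max (\<theta> \<Delta> / \<theta> (\<Delta> - 1)) (\<theta> 0 / \<theta> 1) \<le> 1 + c / real \<Delta>"
    and small: "lam \<le> exp (- c) / (4 * (1 + 8 * c)) * (\<theta> 0 / real \<Delta>)"
  shows "uniqueness_regime \<Delta> lam \<theta>"
proof -
  define x where "x = c / real \<Delta>"
  have x: "0 \<le> x" "x \<le> 1" using c \<Delta> by (auto simp: x_def)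
  have \<theta>0: "\<theta> 0 > 0" using lc by (simp add: log_convex_def)
  interpret tree_ratio \<Delta> lam \<theta> "1 / (1 + x)" "1 + x"
    unfolding x_def by (rule tree_ratio_log_convex[OF \<Delta> lc c(1) lam max])
  obtain a0 b0 where ab: "0 \<le> a0" "b0 \<in> {1 / (1 + x)..1 + x}" "hmap (a0, b0) = (a0, b0)"
    using hmap_fixed_point by blast
  have "tree_contraction \<Delta> lam \<theta> (1 / (1 + x)) (1 + x) a0 b0 (8 * c)"
  proof
    have "(1 + x) ^ Suc \<Delta> = (1 + x) * (1 + x) ^ \<Delta>" by simp
    also have "\<dots> \<le> 2 * exp c"
      using x one_plus_power_le_exp[OF c(1), of \<Delta> \<Delta>] \<Delta> by (intro mult_mono) (auto simp: x_def)
    finally have r: "(1 + x) ^ Suc \<Delta> \<le> 2 * exp c" .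
    have "lam * (1 + x) ^ Suc \<Delta> / \<theta> 0 * (real \<Delta> * (1 + 8 * c))
        = (lam * real \<Delta> / \<theta> 0) * (1 + x) ^ Suc \<Delta> * (1 + 8 * c)" by simp
    also have "\<dots> \<le> (exp (- c) / (4 * (1 + 8 * c))) * (2 * exp c) * (1 + 8 * c)"
    proof (intro mult_right_mono mult_mono r)
      show "lam * real \<Delta> / \<theta> 0 \<le> exp (- c) / (4 * (1 + 8 * c))"
        using mult_right_mono[OF small, of "real \<Delta> / \<theta> 0"] \<theta>0 \<Delta> by simp
    qed (use x c lam \<theta>0 in auto)
    also have "\<dots> = (exp (- c) * exp c) / 2"
    proof -
      have "A / (4 * D) * (2 * E) * D = A * E / 2" if "D \<noteq> 0" for A D E :: real using that by simp
      then show ?thesis using c by (smt (verit))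
    qed
    also have "\<dots> = 1 / 2" by (simp add: mult_exp_exp)
    finally show "lam * (1 + x) ^ Suc \<Delta> / \<theta> 0 * (real \<Delta> * (1 + 8 * c)) \<le> 1 / 2" .
    \<comment> \<open>With l replaced by its lower bound 1 - x, the difference of squares is exactly
      4 x.\<close>
    have "1 - x \<le> 1 / (1 + x)" using x by (simp add: field_simps)
    then have "(1 - x)\<^sup>2 \<le> (1 / (1 + x))\<^sup>2" using x by (intro power_mono) auto
    then have "(1 + x)\<^sup>2 - (1 / (1 + x))\<^sup>2 \<le> (1 + x)\<^sup>2 - (1 - x)\<^sup>2" by simp
    also have "\<dots> = 4 * x" by (simp add: power2_eq_square algebra_simps)
    finally have "((1 + x)\<^sup>2 - (1 / (1 + x))\<^sup>2) * real \<Delta> \<le> 4 * x * real \<Delta>"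
      by (rule mult_right_mono) simp
    also have "\<dots> = 8 * c / 2" using \<Delta> by (simp add: x_def)
    finally show "((1 + x)\<^sup>2 - (1 / (1 + x))\<^sup>2) * real \<Delta> \<le> 8 * c / 2" .
  qed (use ab c in auto)
  then show ?thesis by (rule tree_contraction.uniqueness)
qed

text \<open>Let the high box begin at S/\<Delta> and the low box end at 1/\<Delta>. Points of the
  low box are mapped to a >= K e^(-c-2)/\<Delta>, which should be S/\<Delta>; points of the high box
  to a <= K e^c/(\<Delta> (1 + u)^d) with (1 + u)^d >= S^2/36, which should be at most 1/\<Delta>.
  Equality in K e^(-c-2) = S and K e^c = S^2/36 gives the constants.\<close>

lemma nonuniqueness_large_activity:
  assumes \<Delta>: "\<Delta> \<ge> 3" and lc: "log_convex \<Delta> \<theta>" and c: "0 \<le> c" "c \<le> real \<Delta>"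
    and max: "max (\<theta> \<Delta> / \<theta> (\<Delta> - 1)) (\<theta> 0 / \<theta> 1) \<le> 1 + c / real \<Delta>"
  shows "\<not> uniqueness_regime \<Delta> (36 * exp (3 * c + 4) * (\<theta> 0 / real \<Delta>)) \<theta>"
proof -
  define x where "x = c / real \<Delta>"
  define K where "K = 36 * exp (3 * c + 4)"
  define S where "S = 36 * exp (2 * c + 2)"
  define lam where "lam = K * (\<theta> 0 / real \<Delta>)"
  define d where "d = \<Delta> - 1"
  have x: "0 \<le> x" "x \<le> 1" using c \<Delta> by (auto simp: x_def)
  have \<theta>0: "\<theta> 0 > 0" using lc by (simp add: log_convex_def)
  have lam: "lam > 0" using \<theta>0 \<Delta> by (simp add: lam_def K_def)
  have \<Delta>0: "real \<Delta> > 0" using \<Delta> by simp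
  interpret tree_ratio \<Delta> lam \<theta> "1 / (1 + x)" "1 + x"
    unfolding x_def by (rule tree_ratio_log_convex[OF \<Delta> lc c(1) lam max])
  have rd: "(1 + x) ^ d \<le> exp c"
    unfolding x_def d_def using one_plus_power_le_exp[OF c(1), of \<Delta> "\<Delta> - 1"] \<Delta> by simp
  have rd1: "(1 + x) ^ d \<ge> 1" using x by simp
  have S: "S \<ge> 36" using c by (simp add: S_def)
  \<comment> \<open>The second entry bounds the first component of \<open>hmap\<close>; the first
    entry ensures that the interval is nonempty.\<close>
  define \<beta> where "\<beta> = Max {S / real \<Delta>, lam * (1 + x) ^ d / \<theta> 0}"
  have "\<not> uniqueness_regime \<Delta> lam \<theta>"
  proof (rule nonuniqueness[of 0 "1 / real \<Delta>" "S / real \<Delta>" \<beta>])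
    show "1 / real \<Delta> < S / real \<Delta>" using S \<Delta>0 by (simp add: divide_strict_right_mono)
    show "S / real \<Delta> \<le> \<beta>" by (simp add: \<beta>_def)
  next
    fix y assume y: "y \<in> {S / real \<Delta>..\<beta>} \<times> {1 / (1 + x)..1 + x}"
    then obtain a b where ab: "y = (a, b)" "S / real \<Delta> \<le> a" "b \<in> {1 / (1 + x)..1 + x}" by auto
    have "S / real \<Delta> \<ge> 0" using S \<Delta>0 by simp
    then have a0: "a \<ge> 0" using ab by linarith
    define u where "u = 1 / (1 + x) * a"
    have "S / (2 * real \<Delta>) = 1 / 2 * (S / real \<Delta>)" by simp
    also have "\<dots> \<le> u"
      unfolding u_def using x ab(2) S \<Delta>0 by (intro mult_mono) (auto simp: field_simps)
    finally have u: "S / (2 * real \<Delta>) \<le> u" .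
    have u0: "0 \<le> S / (2 * real \<Delta>)" using S by simp
    \<comment> \<open>The factor 2/9 is the value of (\<Delta> - 1)(\<Delta> - 2)/\<Delta>^2 at
      \<Delta> = 3. With u >= S/(2 \<Delta>) the quadratic term is then at least S^2/36.\<close>
    have "real d * (real d - 1) \<ge> 2 / 9 * (real \<Delta>)\<^sup>2"
    proof -
      have "0 \<le> (7 * real \<Delta> - 6) * (real \<Delta> - 3)" using \<Delta> by (intro mult_nonneg_nonneg) auto
      moreover have d: "real d = real \<Delta> - 1" using \<Delta> by (simp add: d_def of_nat_diff)
      ultimately show ?thesis unfolding d by (simp add: power2_eq_square algebra_simps)
    qed
    then have "2 / 9 * (real \<Delta>)\<^sup>2 / 2 * (S / (2 * real \<Delta>))\<^sup>2 \<le> real d * (real d - 1) / 2 * (S / (2 * real \<Delta>))\<^sup>2"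
      by (intro mult_right_mono) auto
    also have "\<dots> \<le> real d * (real d - 1) / 2 * u\<^sup>2"
      using u u0 \<Delta> by (intro mult_left_mono power_mono) (auto simp: d_def)
    also have "\<dots> \<le> (1 + u) ^ d"
      using quadratic_le_power[of u d] u u0 by (smt (verit) mult_nonneg_nonneg of_nat_0_le_iff)
    finally have "S\<^sup>2 / 36 \<le> (1 + u) ^ d"
      using \<Delta>0 by (simp add: power2_eq_square field_simps)
    moreover have "S\<^sup>2 / 36 = K * exp c"
      by (simp add: S_def K_def power2_eq_square mult_exp_exp algebra_simps)
    ultimately have large: "K * exp c \<le> (1 + u) ^ d" by simp
    have Kpos: "K > 0" by (simp add: K_def)
    have "fst (hmap y) \<le> lam * (1 + x) ^ d / (\<theta> 0 * (1 + u) ^ d)"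
      using fst_hmap_le[OF a0 ab(3)] by (simp add: ab(1) d_def u_def)
    also have "\<dots> \<le> lam * exp c / (\<theta> 0 * (K * exp c))"
      using large rd lam \<theta>0 x Kpos by (intro frac_le mult_left_mono mult_pos_pos) auto
    also have "\<dots> = 1 / real \<Delta>" using \<theta>0 by (simp add: lam_def K_def)
    finally show "hmap y \<in> {0..1 / real \<Delta>} \<times> {1 / (1 + x)..1 + x}"
      using fst_hmap_nonneg[OF a0 ab(3)] snd_hmap_bounds[of y] a0 by (simp add: ab(1) mem_Times_iff)
  next
    fix y assume y: "y \<in> {0..1 / real \<Delta>} \<times> {1 / (1 + x)..1 + x}"
    then obtain a b where ab: "y = (a, b)" "0 \<le> a" "a \<le> 1 / real \<Delta>" "b \<in> {1 / (1 + x)..1 + x}" by auto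
    have "(1 + x) * a \<le> 2 * (1 / real \<Delta>)" using x ab by (intro mult_mono) auto
    then have "(1 + (1 + x) * a) ^ d \<le> (1 + 2 / real \<Delta>) ^ d" using x ab by (intro power_mono) auto
    also have "\<dots> \<le> exp 2" using one_plus_power_le_exp[of 2 \<Delta> d] \<Delta> by (simp add: d_def)
    finally have D: "(1 + (1 + x) * a) ^ d \<le> exp 2" .
    have D1: "(1 + (1 + x) * a) ^ d \<ge> 1" using x ab by simp
    have "exp (- c) \<le> (1 / (1 + x)) ^ d"
      using rd x by (simp add: power_one_over exp_minus inverse_eq_divide divide_left_mono)
    then have "lam * exp (- c) / (\<theta> 0 * exp 2) \<le> lam * (1 / (1 + x)) ^ d / (\<theta> 0 * (1 + (1 + x) * a) ^ d)"
      using D D1 lam \<theta>0 x by (intro frac_le mult_left_mono mult_pos_pos mult_nonneg_nonneg) auto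
    also have "\<dots> \<le> fst (hmap y)" using fst_hmap_ge[OF ab(2,4)] by (simp add: ab(1) d_def)
    also have "lam * exp (- c) / (\<theta> 0 * exp 2) = S / real \<Delta>"
    proof -
      have "K * exp (- c) / exp 2 = S"
        unfolding K_def S_def by (simp add: exp_minus field_simps mult_exp_exp)
      then show ?thesis using \<theta>0 \<Delta>0 by (simp add: lam_def field_simps)
    qed
    finally have lower: "S / real \<Delta> \<le> fst (hmap y)" .
    have "fst (hmap y) \<le> lam * (1 + x) ^ d / (\<theta> 0 * (1 + 1 / (1 + x) * a) ^ d)"
      using fst_hmap_le[OF ab(2,4)] by (simp add: ab(1) d_def)
    also have "\<dots> \<le> lam * (1 + x) ^ d / \<theta> 0"
    proof -
      have "\<theta> 0 * 1 \<le> \<theta> 0 * (1 + 1 / (1 + x) * a) ^ d"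
        using x ab \<theta>0 by (intro mult_left_mono one_le_power) auto
      then show ?thesis using lam x \<theta>0 by (intro divide_left_mono mult_pos_pos) auto
    qed
    also have "\<dots> \<le> \<beta>" by (simp add: \<beta>_def)
    finally show "hmap y \<in> {S / real \<Delta>..\<beta>} \<times> {1 / (1 + x)..1 + x}"
      using lower snd_hmap_bounds[of y] ab by (simp add: mem_Times_iff)
  qed simp
  then show ?thesis by (simp add: lam_def K_def)
qed

text \<open>The quantity inverted in \<open>lambda_lower\<close> is bounded factor by factor:
  \<open>psi\<close> by \<Delta> (1 + x), which joins the power of the last ratio to give at most
  \<Delta> e^c, and the last factor by 1 + 4 c. Positivity of every factor is needed to invert the
  inequality.\<close>

lemma lambda_lower_ge:
  assumes \<Delta>: "\<Delta> \<ge> 3" and lc: "log_convex \<Delta> \<theta>" and c: "0 \<le> c"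
    and max: "max (\<theta> \<Delta> / \<theta> (\<Delta> - 1)) (\<theta> 0 / \<theta> 1) \<le> 1 + c / real \<Delta>"
  shows "lambda_lower \<Delta> \<theta> \<ge> inverse (2 * exp c * (1 + 4 * c)) * (\<theta> 0 / real \<Delta>)"
proof -
  define x where "x = c / real \<Delta>"
  define R where "R = \<theta> \<Delta> / \<theta> (\<Delta> - 1)"
  define R0 where "R0 = \<theta> 1 / \<theta> 0"
  have pos: "\<theta> j > 0" if "j \<le> \<Delta>" for j using lc that by (simp add: log_convex_def)
  have x: "0 \<le> x" using c by (simp add: x_def)
  have xD: "x * real \<Delta> = c" using \<Delta> by (simp add: x_def)
  have ratio: "\<theta> (k + 1) / \<theta> k \<le> 1 + x" "1 / (1 + x) \<le> \<theta> (k + 1) / \<theta> k" if "k < \<Delta>" for k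
    using log_convex_ratio_bounds[OF lc that max] by (auto simp: x_def Suc_eq_plus1)
  have R: "R \<le> 1 + x" "R > 0" using max pos by (auto simp: R_def x_def)
  have R0: "1 / (1 + x) \<le> R0" using ratio(2)[of 0] \<Delta> by (simp add: R0_def)
  have RR: "R0 \<le> R"
    using log_convex_ratio_mono[OF lc, of 0 "\<Delta> - 1"] \<Delta> by (simp add: R_def R0_def One_nat_def)
  have psi_le: "psi \<Delta> \<theta> \<le> real \<Delta> * (1 + x)"
    unfolding psi_def
  proof (subst Max_le_iff)
    show "\<forall>y\<in>(\<lambda>k. (real \<Delta> - (real k + 1)) * (\<theta> (k + 1) / \<theta> k)) ` {0..\<Delta> - 2}. y \<le> real \<Delta> * (1 + x)"
    proof clarify
      fix k assume k: "k \<in> {0..\<Delta> - 2}"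
      then have "k < \<Delta>" using \<Delta> by auto
      then show "(real \<Delta> - (real k + 1)) * (\<theta> (k + 1) / \<theta> k) \<le> real \<Delta> * (1 + x)"
        using ratio(1)[of k] pos[of k] pos[of "k + 1"] by (intro mult_mono) auto
    qed
  qed auto
  have psi_pos: "psi \<Delta> \<theta> > 0"
    unfolding psi_def
  proof (subst Max_gr_iff)
    have "(real \<Delta> - (real 0 + 1)) * (\<theta> (0 + 1) / \<theta> 0) > 0"
      using \<Delta> pos[of 0] pos[of "0 + 1"] by (intro mult_pos_pos divide_pos_pos) auto
    then show "\<exists>y\<in>(\<lambda>k. (real \<Delta> - (real k + 1)) * (\<theta> (k + 1) / \<theta> k)) ` {0..\<Delta> - 2}. 0 < y"
      by (intro bexI[OF _ imageI[of 0]]) auto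
  qed auto
  define Y where "Y = R + (real \<Delta> - 1) * (R - R0)"
  have "(1 + x) - 1 / (1 + x) \<le> 2 * x" using x by (simp add: field_simps)
  then have "R - R0 \<le> 2 * x" using R(1) R0 by linarith
  then have "(real \<Delta> - 1) * (R - R0) \<le> (real \<Delta> - 1) * (2 * x)" using \<Delta> by (intro mult_left_mono) auto
  \<comment> \<open>The loss of 2 x absorbs the x in R <= 1 + x, which leaves the bound 1 + 2
    c.\<close>
  also have "\<dots> = 2 * c - 2 * x" using xD by (simp add: algebra_simps)
  finally have "Y \<le> 1 + 2 * c" using R(1) x unfolding Y_def by linarith
  then have Y: "Y \<le> 1 + 4 * c" using c by simp
  have Y0: "Y > 0" using R RR \<Delta> by (auto simp: Y_def intro!: add_pos_nonneg)
  define X where "X = 2 * psi \<Delta> \<theta> * inverse (\<theta> 0) * R ^ (\<Delta> - 2) * Y"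
  have X0: "X > 0" using psi_pos pos[of 0] R Y0 by (simp add: X_def)
  have "X \<le> 2 * (real \<Delta> * (1 + x)) * inverse (\<theta> 0) * (1 + x) ^ (\<Delta> - 2) * (1 + 4 * c)"
    unfolding X_def using psi_le psi_pos pos[of 0] R Y Y0 x
    by (intro mult_mono power_mono) auto
  also have "\<dots> = 2 * real \<Delta> * (1 + x) ^ Suc (\<Delta> - 2) * inverse (\<theta> 0) * (1 + 4 * c)" by simp
  also have "\<dots> \<le> 2 * real \<Delta> * exp c * inverse (\<theta> 0) * (1 + 4 * c)"
    using one_plus_power_le_exp[OF c, of \<Delta> "Suc (\<Delta> - 2)"] \<Delta> pos[of 0] c
    by (intro mult_right_mono mult_left_mono) (auto simp: x_def)
  finally have "inverse (2 * real \<Delta> * exp c * inverse (\<theta> 0) * (1 + 4 * c)) \<le> inverse X"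
    using X0 by (rule le_imp_inverse_le)
  moreover have "lambda_lower \<Delta> \<theta> = inverse X"
    by (simp add: lambda_lower_def X_def Y_def R_def R0_def)
  ultimately show ?thesis by (simp add: field_simps)
qed

text \<open>From c <= \<Delta> both ratios are at most 2, so the exponent is at most 3 * 2 * 2 = 12;
  the finer bound 1 + c/\<Delta> is kept for the power \<Delta>, where it gives e^c.\<close>

lemma lambda_upper_le:
  assumes \<Delta>: "\<Delta> \<ge> 3" and lc: "log_convex \<Delta> \<theta>" and c: "0 \<le> c" "c \<le> real \<Delta>"
    and max: "max (\<theta> \<Delta> / \<theta> (\<Delta> - 1)) (\<theta> 0 / \<theta> 1) \<le> 1 + c / real \<Delta>"
  shows "lambda_upper \<Delta> \<theta> \<le> 3 * exp (12 + c) * (\<theta> 0 / real \<Delta>)"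
proof -
  have pos: "\<theta> j > 0" if "j \<le> \<Delta>" for j using lc that by (simp add: log_convex_def)
  have "c / real \<Delta> \<le> 1" using c \<Delta> by simp
  then have 2: "\<theta> \<Delta> / \<theta> (\<Delta> - 1) \<le> 2" "\<theta> 0 / \<theta> 1 \<le> 2" using max by auto
  have nn: "0 \<le> \<theta> \<Delta> / \<theta> (\<Delta> - 1)" "0 \<le> \<theta> 0 / \<theta> 1"
    using pos[of \<Delta>] pos[of "\<Delta> - 1"] pos[of 0] pos[of 1] \<Delta> by auto
  have "3 * (\<theta> \<Delta> / \<theta> (\<Delta> - 1)) * (\<theta> 0 / \<theta> 1) \<le> 3 * 2 * 2"
    using 2 nn by (intro mult_mono) auto
  then have e: "exp (3 * (\<theta> \<Delta> / \<theta> (\<Delta> - 1)) * (\<theta> 0 / \<theta> 1)) \<le> exp 12" by simp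
  have "(\<theta> 0 / \<theta> 1) ^ \<Delta> \<le> (1 + c / real \<Delta>) ^ \<Delta>"
    using max nn by (intro power_mono) auto
  also have "\<dots> \<le> exp c" using one_plus_power_le_exp[OF c(1), of \<Delta> \<Delta>] \<Delta> by simp
  finally have p: "(\<theta> 0 / \<theta> 1) ^ \<Delta> \<le> exp c" .
  have "lambda_upper \<Delta> \<theta> \<le> 3 * \<theta> 0 / real \<Delta> * exp 12 * exp c"
    unfolding lambda_upper_def using e p nn pos[of 0]
    by (intro mult_mono mult_left_mono) auto
  also have "\<dots> = 3 * exp (12 + c) * (\<theta> 0 / real \<Delta>)" by (simp add: exp_add)
  finally show ?thesis .
qed

theorem mainTheorem6:
  shows "(\<forall>(\<Delta>::nat) (\<theta>::nat \<Rightarrow> real) (c::real).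
            \<Delta> \<ge> 3 \<longrightarrow> log_convex \<Delta> \<theta> \<longrightarrow> 0 \<le> c \<longrightarrow> c \<le> real \<Delta> \<longrightarrow>
            max (\<theta> \<Delta> / \<theta> (\<Delta> - 1)) (\<theta> 0 / \<theta> 1) \<le> 1 + c / real \<Delta> \<longrightarrow>
              lambda_lower \<Delta> \<theta> \<ge> inverse (2 * exp c * (1 + 4 * c)) * (\<theta> 0 / real \<Delta>) \<and>
              lambda_upper \<Delta> \<theta> \<le> 3 * exp (12 + c) * (\<theta> 0 / real \<Delta>))
       \<and> (\<forall>c::real. 0 \<le> c \<longrightarrow>
            (\<exists>K\<^sub>1 K\<^sub>2 :: real. 0 < K\<^sub>1 \<and> 0 < K\<^sub>2 \<and>
              (\<forall>(\<Delta>::nat) (\<theta>::nat \<Rightarrow> real).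
                 \<Delta> \<ge> 3 \<longrightarrow> log_convex \<Delta> \<theta> \<longrightarrow> c \<le> real \<Delta> \<longrightarrow>
                 max (\<theta> \<Delta> / \<theta> (\<Delta> - 1)) (\<theta> 0 / \<theta> 1) \<le> 1 + c / real \<Delta> \<longrightarrow>
                   ereal (K\<^sub>1 * (\<theta> 0 / real \<Delta>)) \<le> critical_activity \<Delta> \<theta> \<and>
                   critical_activity \<Delta> \<theta> \<le> ereal (K\<^sub>2 * (\<theta> 0 / real \<Delta>)))))"
proof (rule conjI; intro allI impI)
  fix \<Delta> :: nat and \<theta> :: "nat \<Rightarrow> real" and c :: real
  assume "\<Delta> \<ge> 3" "log_convex \<Delta> \<theta>" "0 \<le> c" "c \<le> real \<Delta>"
    "max (\<theta> \<Delta> / \<theta> (\<Delta> - 1)) (\<theta> 0 / \<theta> 1) \<le> 1 + c / real \<Delta>"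
  then show "lambda_lower \<Delta> \<theta> \<ge> inverse (2 * exp c * (1 + 4 * c)) * (\<theta> 0 / real \<Delta>) \<and>
      lambda_upper \<Delta> \<theta> \<le> 3 * exp (12 + c) * (\<theta> 0 / real \<Delta>)"
    by (intro conjI lambda_lower_ge lambda_upper_le)
next
  fix c :: real assume c: "0 \<le> c"
  define K1 where "K1 = exp (- c) / (4 * (1 + 8 * c))"
  define K2 where "K2 = 36 * exp (3 * c + 4)"
  have K: "K1 > 0" "K2 > 0" using c by (auto simp: K1_def K2_def)
  have "ereal (K1 * (\<theta> 0 / real \<Delta>)) \<le> critical_activity \<Delta> \<theta> \<and>
      critical_activity \<Delta> \<theta> \<le> ereal (K2 * (\<theta> 0 / real \<Delta>))"
    if *: "\<Delta> \<ge> 3" "log_convex \<Delta> \<theta>" "c \<le> real \<Delta>"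
      "max (\<theta> \<Delta> / \<theta> (\<Delta> - 1)) (\<theta> 0 / \<theta> 1) \<le> 1 + c / real \<Delta>" for \<Delta> \<theta>
    unfolding critical_activity_def
  \<comment> \<open>The lower bound says that every activity without uniqueness exceeds the
    threshold; the upper bound exhibits one such activity.\<close>
  proof (intro conjI Inf_greatest Inf_lower)
    fix y assume "y \<in> {ereal lam |lam. 0 < lam \<and> \<not> uniqueness_regime \<Delta> lam \<theta>}"
    then obtain lam where lam: "y = ereal lam" "0 < lam" "\<not> uniqueness_regime \<Delta> lam \<theta>" by auto
    have "\<not> lam \<le> K1 * (\<theta> 0 / real \<Delta>)"
      using uniqueness_small_activity[OF *(1,2) c *(3) lam(2) *(4)] lam(3) unfolding K1_def by blast
    then show "ereal (K1 * (\<theta> 0 / real \<Delta>)) \<le> y" by (simp add: lam(1))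
  next
    have "\<theta> 0 > 0" using *(2) by (simp add: log_convex_def)
    then have "K2 * (\<theta> 0 / real \<Delta>) > 0" using K *(1) by simp
    then show "ereal (K2 * (\<theta> 0 / real \<Delta>)) \<in> {ereal lam |lam. 0 < lam \<and> \<not> uniqueness_regime \<Delta> lam \<theta>}"
      using nonuniqueness_large_activity[OF *(1,2) c *(3,4)] unfolding K2_def by blast
  qed
  with K show "\<exists>K\<^sub>1 K\<^sub>2 :: real. 0 < K\<^sub>1 \<and> 0 < K\<^sub>2 \<and>
      (\<forall>(\<Delta>::nat) (\<theta>::nat \<Rightarrow> real).
         \<Delta> \<ge> 3 \<longrightarrow> log_convex \<Delta> \<theta> \<longrightarrow> c \<le> real \<Delta> \<longrightarrow>
         max (\<theta> \<Delta> / \<theta> (\<Delta> - 1)) (\<theta> 0 / \<theta> 1) \<le> 1 + c / real \<Delta> \<longrightarrow>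
           ereal (K\<^sub>1 * (\<theta> 0 / real \<Delta>)) \<le> critical_activity \<Delta> \<theta> \<and>
           critical_activity \<Delta> \<theta> \<le> ereal (K\<^sub>2 * (\<theta> 0 / real \<Delta>)))"
    by blast
qed

end
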